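(* Let $f:\mathbb{R}^n\to\mathbb{R}$ be a regular function and assume that there exists $\psi:\mathbb{R}_+\to\mathbb{R}$ such that (1) for any $t\geq 0$, $$\int_{\mathbb{R}^n}\Gamma_2(P_tf)\,d\gamma_n\leq \int_{\mathbb{R}^n}\Gamma(P_tf)\,d\gamma_n+\psi(t);$$ (2) $$\int_0^\infty e^{-2t}\int_t^\infty e^{2s}\psi(s)\,ds\,dt<\infty.$$ Then $$\mathrm{Var}_{\gamma_n}(f)\leq \left|\int_{\mathbb{R}^n}\nabla f\,d\gamma_n\right|^2+4\int_0^\infty e^{-2t}\int_t^\infty e^{2s}\psi(s)\,ds\,dt,$$ where $|\cdot|$ is the standard Euclidean norm.
   Context: $\gamma_n$ is the standard Gaussian measure on $\mathbb{R}^n$, and $\mathrm{Var}_{\gamma_n}(f)=\int f^2d\gamma_n-(\int f\,d\gamma_n)^2$. $(P_t)_{t\geq0}$ is the Ornstein-Uhlenbeck semigroup $$P_tf(x)=\int_{\mathbb{R}^n}f\big(e^{-t}x+\sqrt{1-e^{-2t}}\,y\big)\,d\gamma_n(y),$$ with infinitesimal generator $L=\Delta-x\cdot\nabla$. The operators $\Gamma,\Gamma_2$ are defined by $\Gamma(f,g)=\frac12[L(fg)-fLg-gLf]$, $\Gamma_2(f,g)=\frac12[L\Gamma(f,g)-\Gamma(f,Lg)-\Gamma(Lf,g)]$, $\Gamma(f)=\Gamma(f,f)$, $\Gamma_2(f)=\Gamma_2(f,f)$. Explicitly, $\Gamma(f)=|\nabla f|^2$ and $\Gamma_2(f)=\|\mathrm{Hess}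 f\|_2^2+|\nabla f|^2$, where $\|\mathrm{Hess} f\|_2^2=\sum_{i,j=1}^n(\partial^2_{ij}f)^2$. "Regular" is used informally, in the sense of "smooth"; no precise regularity class is specified. *)

theory Defs
  imports "HOL-Probability.Probability"
begin

definition gauss :: "(real ^ 'n) measure" where
  "gauss = density lborel (\<lambda>x. ennreal (\<Prod>i\<in>UNIV. std_normal_density (x $ i)))"

definition gauss_var :: "(real ^ 'n \<Rightarrow> real) \<Rightarrow> real" where
  "gauss_var f = (\<integral>x. (f x)\<^sup>2 \<partial>gauss) - (\<integral>x. f x \<partial>gauss)\<^sup>2"

definition OU :: "real \<Rightarrow> (real ^ 'n \<Rightarrow> real) \<Rightarrow> real ^ 'n \<Rightarrow> real" where
  "OU t f x = (\<integral>y. f (exp (- t) *\<^sub>R x + sqrt (1 - exp (- 2 * t)) *\<^sub>R y) \<partial>gauss)"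

definition partial :: "'n \<Rightarrow> (real ^ 'n \<Rightarrow> real) \<Rightarrow> real ^ 'n \<Rightarrow> real" where
  "partial i f x = frechet_derivative f (at x) (axis i 1)"

definition grad :: "(real ^ 'n \<Rightarrow> real) \<Rightarrow> real ^ 'n \<Rightarrow> real ^ 'n" where
  "grad f x = (\<chi> i. partial i f x)"

definition OU_gen :: "(real ^ 'n \<Rightarrow> real) \<Rightarrow> real ^ 'n \<Rightarrow> real" where
  "OU_gen f x = (\<Sum>i\<in>UNIV. partial i (partial i f) x) - x \<bullet> grad f x"

text \<open>The operators \<open>\<Gamma>\<close> and \<open>\<Gamma>\<^sub>2\<close>. For smooth \<open>f\<close> one has
  \<open>\<Gamma>(f,f) = |\<nabla>f|\<^sup>2\<close> and \<open>\<Gamma>\<^sub>2(f,f) = \<parallel>Hess f\<parallel>\<^sup>2 + |\<nabla>f|\<^sup>2\<close>.\<close>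

definition carre_du_champ ::
    "(real ^ 'n \<Rightarrow> real) \<Rightarrow> (real ^ 'n \<Rightarrow> real) \<Rightarrow> real ^ 'n \<Rightarrow> real" where
  "carre_du_champ f g x =
     (OU_gen (\<lambda>y. f y * g y) x - f x * OU_gen g x - g x * OU_gen f x) / 2"

definition carre_du_champ2 ::
    "(real ^ 'n \<Rightarrow> real) \<Rightarrow> (real ^ 'n \<Rightarrow> real) \<Rightarrow> real ^ 'n \<Rightarrow> real" where
  "carre_du_champ2 f g x =
     (OU_gen (carre_du_champ f g) x - carre_du_champ f (OU_gen g) x
        - carre_du_champ (OU_gen f) g x) / 2"

primrec Ck :: "nat \<Rightarrow> (real ^ 'n \<Rightarrow> real) \<Rightarrow> bool" where
  "Ck 0 f \<longleftrightarrow> continuous_on UNIV f"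
| "Ck (Suc k) f \<longleftrightarrow> (\<forall>x. f differentiable (at x)) \<and> (\<forall>i. Ck k (partial i f))"

definition smooth :: "(real ^ 'n \<Rightarrow> real) \<Rightarrow> bool" where
  "smooth f \<longleftrightarrow> (\<forall>k. Ck k f)"

text \<open>``Regular'' means smooth, together with the integrability needed for the variance of
  \<open>f\<close> and for \<open>\<integral>\<Gamma>(f)\<close> and \<open>\<integral>\<Gamma>\<^sub>2(f)\<close> to be finite; that is, \<open>f\<close> is smooth and \<open>f\<close>, its first
  and its second partial derivatives are square-integrable for the Gaussian measure. The same
  then holds for \<open>OU t f\<close> for every \<open>t \<ge> 0\<close>.\<close>

definition regular :: "(real ^ 'n \<Rightarrow> real) \<Rightarrow> bool" where
  "regular f \<longleftrightarrow> smooth f \<and> integrable gauss (\<lambda>x. (f x)\<^sup>2)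
     \<and> integrable gauss (carre_du_champ f f) \<and> integrable gauss (carre_du_champ2 f f)"

text \<open>The double integral \<open>\<integral>\<^sub>0\<^sup>\<infinity> e\<^sup>-\<^sup>2\<^sup>t \<integral>\<^sub>t\<^sup>\<infinity> e\<^sup>2\<^sup>s \<psi>(s) ds dt\<close>, with values in \<open>[0,\<infinity>]\<close>. It is only used
  for \<open>\<psi>\<close> with \<open>\<integral>\<Gamma>\<^sub>2(P\<^sub>t f) \<le> \<integral>\<Gamma>(P\<^sub>t f) + \<psi>(t)\<close> for all \<open>t \<ge> 0\<close>. Since
  \<open>\<Gamma>\<^sub>2 - \<Gamma> = \<parallel>Hess\<parallel>\<^sup>2 \<ge> 0\<close>, such a \<open>\<psi>\<close> is nonnegative on \<open>[0,\<infinity>)\<close>, so the coercion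
  \<open>ennreal\<close> truncates nothing.\<close>

definition psi_integral :: "(real \<Rightarrow> real) \<Rightarrow> ennreal" where
  "psi_integral \<psi> =
     (\<integral>\<^sup>+ t. ennreal (exp (- 2 * t))
          * (\<integral>\<^sup>+ s. ennreal (exp (2 * s) * \<psi> s) \<partial>lebesgue_on {t..}) \<partial>lebesgue_on {0..})"

end

theory Submission
  imports Defs
begin

text \<open>Write \<open>c(g, t) = \<integral>(P\<^sub>t g)\<^sup>2 d\<gamma>\<close>. If \<open>g\<close> and its gradient are square-integrable, integration by
  parts gives \<open>\<partial>\<^sub>t c(g, t) = - 2 e\<^sup>-\<^sup>2\<^sup>t \<Sum>\<^sub>i c(\<partial>\<^sub>i g, t)\<close>, and \<open>c(g, t) \<rightarrow> (\<integral>g d\<gamma>)\<^sup>2\<close> as \<open>t \<rightarrow> \<infinity>\<close>, hence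
  \<open>c(g, t) - (\<integral>g d\<gamma>)\<^sup>2 = \<integral>\<^sub>t\<^sup>\<infinity> 2 e\<^sup>-\<^sup>2\<^sup>s \<Sum>\<^sub>i c(\<partial>\<^sub>i g, s) ds\<close>.
  For \<open>g = f\<close> and \<open>t = 0\<close> the left-hand side is the variance. Applying the identity again to each
  \<open>\<partial>\<^sub>i f\<close> produces \<open>|\<integral>\<nabla>f d\<gamma>|\<^sup>2\<close> and a double integral of \<open>\<Sum>\<^sub>i\<^sub>j c(\<partial>\<^sub>i\<^sub>j f, s)\<close>. Because
  \<open>\<partial>\<^sub>i P\<^sub>s = e\<^sup>-\<^sup>s P\<^sub>s \<partial>\<^sub>i\<close>, this sum equals \<open>e\<^sup>4\<^sup>s \<integral>\<parallel>Hess P\<^sub>s f\<parallel>\<^sup>2 d\<gamma>\<close>, and the hypothesis bounds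
  the integral by \<open>\<psi>(s)\<close>.

  The identity follows from differentiation under the integral for compactly supported \<open>C\<^sup>2\<close>
  functions and extends by cutoffs. For \<open>t > 0\<close> the function \<open>P\<^sub>t g\<close> is a Gaussian factor times the
  Laplace transform of a rapidly decaying function, so it is smooth for every square-integrable \<open>g\<close>;
  this makes the pointwise formulas for \<open>\<Gamma>\<close> and \<open>\<Gamma>\<^sub>2\<close> applicable.\<close>

subsection \<open>Partial derivatives of \<open>C\<^sup>k\<close> functions\<close>

text \<open>Square integrability is all that is known about the growth of \<open>f\<close> and of
  its first and second derivatives, so neither differentiation of \<open>f\<close> inside the
  integral defining \<open>OU t f\<close> nor integration by parts against \<open>f\<close> can be
  justified directly. For \<open>t > 0\<close> smoothness is read off the kernel instead: its
  variance \<open>1 - exp (- 2 * t)\<close> is below 1, so it decays faster than the Gaussian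
  weight, with enough room to absorb any factor \<open>exp (c * norm z)\<close>. Integration by
  parts is done for bounded functions only. The energy identity contains no derivative of
  \<open>g\<close> beyond the first, so cutoffs converge under L2 control of \<open>g\<close> and
  its gradient alone; this is why control of second derivatives of \<open>f\<close> is enough to
  apply it to each first partial. Each application contributes a factor 2, hence the 4; the term
  with the mean gradient meets twice the integral of \<open>exp (- 2 * t)\<close>, which is 1. The
  kernel degenerates at \<open>t = 0\<close>, so derivative formulas are confined to
  \<open>t > 0\<close> and the endpoint is recovered by continuity or discarded as a null
  set.\<close>

lemma partial_eq:
  "(f has_derivative D) (at x) \<Longrightarrow> partial i f x = D (axis i 1)"
  unfolding partial_def by (metis frechet_derivative_at)

lemma has_derivative_partial:
  fixes f :: "real ^ 'n \<Rightarrow> real"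
  assumes "f differentiable (at x)"
  shows "(f has_derivative (\<lambda>h. \<Sum>i\<in>UNIV. h $ i * partial i f x)) (at x)"
proof -
  obtain D where D: "(f has_derivative D) (at x)"
    using assms by (auto simp: differentiable_def)
  have "D h = (\<Sum>i\<in>UNIV. h $ i * partial i f x)" for h
  proof -
    have "D h = D (\<Sum>i\<in>UNIV. h $ i *\<^sub>R axis i 1)"
      by (simp only: scalar_mult_eq_scaleR [symmetric] basis_expansion)
    also have "\<dots> = (\<Sum>i\<in>UNIV. D (h $ i *\<^sub>R axis i 1))"
      using has_derivative_linear[OF D] by (rule linear_sum)
    also have "\<dots> = (\<Sum>i\<in>UNIV. h $ i * partial i f x)"
      using linear_cmul[OF has_derivative_linear[OF D]] partial_eq[OF D] by simp
    finally show ?thesis .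
  qed
  then have "D = (\<lambda>h. \<Sum>i\<in>UNIV. h $ i * partial i f x)" by (rule ext)
  with D show ?thesis by (simp only:)
qed

text \<open>The bridge to one-variable calculus: the mean value theorem, the fundamental theorem and
  uniqueness of derivatives all reach \<open>real ^ 'n\<close> along coordinate lines through
  it.\<close>

lemma has_real_derivative_line:
  fixes f :: "real ^ 'n \<Rightarrow> real"
  assumes "\<And>x. f differentiable (at x)"
  shows "((\<lambda>s. f (x + s *\<^sub>R axis i 1)) has_real_derivative partial i f (x + s *\<^sub>R axis i 1)) (at s)"
proof -
  have "((\<lambda>s. x + s *\<^sub>R axis i 1) has_derivative (\<lambda>h. h *\<^sub>R axis i 1)) (at s)"
    by (auto intro!: derivative_eq_intros)
  from has_derivative_compose[OF this has_derivative_partial[OF assms]]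
  have "((\<lambda>s. f (x + s *\<^sub>R axis i 1)) has_derivative
      (\<lambda>h. \<Sum>j\<in>UNIV. (h *\<^sub>R axis i 1) $ j * partial j f (x + s *\<^sub>R axis i 1))) (at s)" .
  moreover have "(\<Sum>j\<in>UNIV. (h *\<^sub>R axis i 1) $ j * partial j f (x + s *\<^sub>R axis i 1))
      = h * partial i f (x + s *\<^sub>R axis i 1)" for h
  proof -
    have "(\<Sum>j\<in>UNIV. (h *\<^sub>R axis i 1) $ j * partial j f (x + s *\<^sub>R axis i 1))
        = (\<Sum>j\<in>UNIV. if j = i then h * partial i f (x + s *\<^sub>R axis i 1) else 0)"
      by (intro sum.cong) (auto simp: axis_def)
    then show ?thesis by simp
  qed
  ultimately have "((\<lambda>s. f (x + s *\<^sub>R axis i 1)) has_derivative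
      (\<lambda>h. h * partial i f (x + s *\<^sub>R axis i 1))) (at s)"
    by (simp only:)
  then show ?thesis
    by (simp only: has_field_derivative_def mult_commute_abs)
qed

lemma Ck_partial: "Ck (Suc k) f \<Longrightarrow> Ck k (partial i f)"
  by simp

lemma Ck_Suc_D: "Ck (Suc k) f \<Longrightarrow> Ck k f"
proof (induction k arbitrary: f)
  case 0
  then show ?case
    by (auto simp: differentiable_imp_continuous_on differentiable_on_def intro: differentiable_at_withinI)
next
  case (Suc k)
  then show ?case by (metis Ck.simps(2))
qed

lemma Ck_le: "Ck k f \<Longrightarrow> j \<le> k \<Longrightarrow> Ck j f"
  by (induction k) (auto simp: le_Suc_eq dest: Ck_Suc_D simp del: Ck.simps)

lemma Ck_continuous: "Ck k f \<Longrightarrow> continuous_on UNIV f"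
  using Ck_le[of k f 0] by simp

section \<open>Differentiation rules and closure properties of the classes
  \<open>Ck k\<close>\<close>

lemma partial_const: "partial i (\<lambda>x. c) = (\<lambda>x. 0)"
  by (rule ext, subst partial_eq[of _ "\<lambda>_. 0"]) auto

lemma partial_coord:
  "partial i (\<lambda>x :: real ^ 'n. x $ j) = (\<lambda>x. if j = i then 1 else 0)"
proof (rule ext)
  fix x :: "real ^ 'n"
  have "((\<lambda>x. x $ j) has_derivative (\<lambda>h. h $ j)) (at x)"
    by (rule bounded_linear_imp_has_derivative) (rule bounded_linear_vec_nth)
  from partial_eq[OF this] show "partial i (\<lambda>x. x $ j) x = (if j = i then 1 else 0)"
    by (simp add: axis_def)
qed

lemma partial_add:
  assumes "f differentiable (at x)" "g differentiable (at x)"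
  shows "partial i (\<lambda>x. f x + g x) x = partial i f x + partial i g x"
proof -
  obtain D E where D: "(f has_derivative D) (at x)" and E: "(g has_derivative E) (at x)"
    using assms by (auto simp: differentiable_def)
  show ?thesis
    using partial_eq[OF has_derivative_add[OF D E]] partial_eq[OF D] partial_eq[OF E] by simp
qed

lemma partial_mult:
  assumes "f differentiable (at x)" "g differentiable (at x)"
  shows "partial i (\<lambda>x. f x * g x) x = f x * partial i g x + partial i f x * g x"
proof -
  obtain D E where D: "(f has_derivative D) (at x)" and E: "(g has_derivative E) (at x)"
    using assms by (auto simp: differentiable_def)
  show ?thesis
    using partial_eq[OF has_derivative_mult[OF D E]] partial_eq[OF D] partial_eq[OF E] by simp
qed

lemma Ck_const: "Ck k (\<lambda>x. c)"
  by (induction k arbitrary: c) (auto simp: partial_const)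

lemma Ck_coord: "Ck k (\<lambda>x. x $ i)"
proof (cases k)
  case 0
  then show ?thesis by (auto intro!: continuous_intros)
next
  case (Suc j)
  have "(\<lambda>x :: real ^ 'a. x $ i) differentiable (at x)" for x
    using bounded_linear_vec_nth by (rule bounded_linear_imp_differentiable)
  then show ?thesis using Suc by (simp add: partial_coord Ck_const)
qed

lemma Ck_add: "Ck k f \<Longrightarrow> Ck k g \<Longrightarrow> Ck k (\<lambda>x. f x + g x)"
proof (induction k arbitrary: f g)
  case (Suc k)
  then have "partial i (\<lambda>x. f x + g x) = (\<lambda>x. partial i f x + partial i g x)" for i
    by (auto simp: partial_add)
  with Suc show ?case by auto
qed (auto intro: continuous_intros)

lemma Ck_mult: "Ck k f \<Longrightarrow> Ck k g \<Longrightarrow> Ck k (\<lambda>x. f x * g x)"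
proof (induction k arbitrary: f g)
  case (Suc k)
  then have "partial i (\<lambda>x. f x * g x) = (\<lambda>x. f x * partial i g x + partial i f x * g x)" for i
    by (auto simp: partial_mult)
  moreover have "Ck k (\<lambda>x. f x * partial i g x + partial i f x * g x)" for i
    using Suc by (intro Ck_add Suc.IH Ck_Suc_D[of k f] Ck_Suc_D[of k g]) auto
  ultimately show ?case using Suc.prems by auto
qed (auto intro: continuous_intros)

lemma Ck_sum: "(\<And>i. i \<in> I \<Longrightarrow> Ck k (f i)) \<Longrightarrow> Ck k (\<lambda>x. \<Sum>i\<in>I. f i x)"
  by (induction I rule: infinite_finite_induct) (auto intro: Ck_const Ck_add)

lemma partial_cmult:
  "f differentiable (at x) \<Longrightarrow> partial i (\<lambda>x. c * f x) x = c * partial i f x"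
  by (simp add: partial_mult partial_const)

lemma partial_diff:
  assumes "f differentiable (at x)" "g differentiable (at x)"
  shows "partial i (\<lambda>x. f x - g x) x = partial i f x - partial i g x"
proof -
  obtain D E where D: "(f has_derivative D) (at x)" and E: "(g has_derivative E) (at x)"
    using assms by (auto simp: differentiable_def)
  show ?thesis
    using partial_eq[OF has_derivative_diff[OF D E]] partial_eq[OF D] partial_eq[OF E] by simp
qed

lemma partial_sum:
  assumes "finite I" "\<And>j. j \<in> I \<Longrightarrow> f j differentiable (at x)"
  shows "partial i (\<lambda>x. \<Sum>j\<in>I. f j x) x = (\<Sum>j\<in>I. partial i (f j) x)"
  using assms
  by (induction I rule: finite_induct) (auto simp: partial_const partial_add differentiable_sum)

lemma Ck_diff: "Ck k f \<Longrightarrow> Ck k g \<Longrightarrow> Ck k (\<lambda>x. f x - g x)"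
  using Ck_add[of k f "\<lambda>x. (-1) * g x"] Ck_mult[OF Ck_const[of k "-1"], of g] by simp

text \<open>The second difference is \<open>G h - G 0\<close>, where \<open>G\<close> is an
  increment in direction \<open>j\<close>. The mean value theorem is applied to \<open>G\<close>
  along direction \<open>i\<close>, then to \<open>partial i f\<close> along direction
  \<open>j\<close>.\<close>

lemma mixed_difference:
  fixes f :: "real ^ 'n \<Rightarrow> real"
  assumes f: "Ck 2 f" and h: "h > 0"
  shows "\<exists>a b. 0 < a \<and> a < h \<and> 0 < b \<and> b < h \<and>
    f (x + h *\<^sub>R axis i 1 + h *\<^sub>R axis j 1) - f (x + h *\<^sub>R axis i 1) - f (x + h *\<^sub>R axis j 1) + f x
      = h * (h * partial j (partial i f) (x + a *\<^sub>R axis i 1 + b *\<^sub>R axis j 1))"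
proof -
  have d: "\<And>x. f differentiable (at x)" "\<And>x i. partial i f differentiable (at x)"
    using f by (auto simp: numeral_2_eq_2)
  define G where "G s = f (x + s *\<^sub>R axis i 1 + h *\<^sub>R axis j 1) - f (x + s *\<^sub>R axis i 1)" for s
  have "(G has_real_derivative
      partial i f (x + s *\<^sub>R axis i 1 + h *\<^sub>R axis j 1) - partial i f (x + s *\<^sub>R axis i 1)) (at s)" for s
    unfolding G_def
    using has_real_derivative_line[OF d(1), of "x + h *\<^sub>R axis j 1" i s]
    by (auto intro!: derivative_intros has_real_derivative_line[OF d(1)] simp: algebra_simps)
  from MVT2[OF h this] obtain a where a: "0 < a" "a < h" and
    eq1: "G h - G 0 = h * (partial i f (x + a *\<^sub>R axis i 1 + h *\<^sub>R axis j 1) - partial i f (x + a *\<^sub>R axis i 1))"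
    by auto
  from MVT2[OF h, of "\<lambda>s. partial i f (x + a *\<^sub>R axis i 1 + s *\<^sub>R axis j 1)",
      OF has_real_derivative_line[OF d(2)]]
  obtain b where b: "0 < b" "b < h" and
    eq2: "partial i f (x + a *\<^sub>R axis i 1 + h *\<^sub>R axis j 1) - partial i f (x + a *\<^sub>R axis i 1)
      = h * partial j (partial i f) (x + a *\<^sub>R axis i 1 + b *\<^sub>R axis j 1)"
    by auto
  show ?thesis
    using a b eq1 eq2 by (intro exI[of _ a] exI[of _ b]) (auto simp: G_def)
qed

text \<open>Schwarz's theorem. The second difference does not change when \<open>i\<close> and
  \<open>j\<close> are swapped, so its two mean value expressions agree for every
  \<open>h n\<close>. The square of \<open>h n\<close> cancels, the intermediate points shrink to
  \<open>x\<close>, and continuity of the second derivatives finishes.\<close>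

lemma partial_commute:
  fixes f :: "real ^ 'n \<Rightarrow> real"
  assumes f: "Ck 2 f"
  shows "partial i (partial j f) = partial j (partial i f)"
proof
  fix x
  define h where "h n = inverse (real (Suc n))" for n
  have h: "h n > 0" for n by (simp add: h_def)
  have lim: "(\<lambda>n. partial j (partial i f) (x + a n *\<^sub>R axis i 1 + b n *\<^sub>R axis j 1))
      \<longlonglongrightarrow> partial j (partial i f) x"
    if "\<And>n. 0 < a n \<and> a n < h n \<and> 0 < b n \<and> b n < h n" for a b :: "nat \<Rightarrow> real" and i j :: 'n
  proof -
    have h0: "h \<longlonglongrightarrow> 0" unfolding h_def by (rule LIMSEQ_inverse_real_of_nat)
    have a: "a \<longlonglongrightarrow> 0"
      by (rule tendsto_sandwich[OF _ _ tendsto_const h0]) (auto intro!: always_eventually less_imp_le simp: that)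
    have b: "b \<longlonglongrightarrow> 0"
      by (rule tendsto_sandwich[OF _ _ tendsto_const h0]) (auto intro!: always_eventually less_imp_le simp: that)
    have "(\<lambda>n. x + a n *\<^sub>R axis i 1 + b n *\<^sub>R axis j 1) \<longlonglongrightarrow> x + 0 *\<^sub>R axis i 1 + 0 *\<^sub>R axis j 1"
      by (intro tendsto_intros a b)
    moreover have "isCont (partial j (partial i f)) x"
      using f by (auto simp: numeral_2_eq_2 continuous_on_eq_continuous_at)
    ultimately show ?thesis using isCont_tendsto_compose by fastforce
  qed
  define D where "D n = f (x + h n *\<^sub>R axis i 1 + h n *\<^sub>R axis j 1) - f (x + h n *\<^sub>R axis i 1)
    - f (x + h n *\<^sub>R axis j 1) + f x" for n
  have "\<forall>n. \<exists>a b. (0 < a \<and> a < h n \<and> 0 < b \<and> b < h n) \<and>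
     D n = h n * (h n * partial j (partial i f) (x + a *\<^sub>R axis i 1 + b *\<^sub>R axis j 1))"
  proof
    fix n
    show "\<exists>a b. (0 < a \<and> a < h n \<and> 0 < b \<and> b < h n) \<and>
     D n = h n * (h n * partial j (partial i f) (x + a *\<^sub>R axis i 1 + b *\<^sub>R axis j 1))"
      using mixed_difference[OF f h[of n], where x = x and i = i and j = j]
      unfolding D_def conj_assoc .
  qed
  then obtain a b where ab: "\<And>n. (0 < a n \<and> a n < h n \<and> 0 < b n \<and> b n < h n)"
    "\<And>n. D n = h n * (h n * partial j (partial i f) (x + a n *\<^sub>R axis i 1 + b n *\<^sub>R axis j 1))"
    by metis
  have "\<forall>n. \<exists>a b. (0 < a \<and> a < h n \<and> 0 < b \<and> b < h n) \<and>
     D n = h n * (h n * partial i (partial j f) (x + a *\<^sub>R axis j 1 + b *\<^sub>R axis i 1))"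
  proof
    fix n
    have "D n = f (x + h n *\<^sub>R axis j 1 + h n *\<^sub>R axis i 1) - f (x + h n *\<^sub>R axis j 1)
      - f (x + h n *\<^sub>R axis i 1) + f x"
      unfolding D_def by (simp add: add.commute add.left_commute)
    then show "\<exists>a b. (0 < a \<and> a < h n \<and> 0 < b \<and> b < h n) \<and>
     D n = h n * (h n * partial i (partial j f) (x + a *\<^sub>R axis j 1 + b *\<^sub>R axis i 1))"
      using mixed_difference[OF f h[of n], where x = x and i = j and j = i]
      unfolding conj_assoc by (simp only:)
  qed
  then obtain c d where cd: "\<And>n. (0 < c n \<and> c n < h n \<and> 0 < d n \<and> d n < h n)"
    "\<And>n. D n = h n * (h n * partial i (partial j f) (x + c n *\<^sub>R axis j 1 + d n *\<^sub>R axis i 1))"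
    by metis
  have "partial i (partial j f) (x + c n *\<^sub>R axis j 1 + d n *\<^sub>R axis i 1)
      = partial j (partial i f) (x + a n *\<^sub>R axis i 1 + b n *\<^sub>R axis j 1)" for n
    using ab(2)[of n] cd(2)[of n] h[of n] by simp
  with lim[OF ab(1), of j i] lim[OF cd(1), of i j]
  show "partial i (partial j f) x = partial j (partial i f) x"
    using LIMSEQ_unique by simp
qed

subsection \<open>The operators \<open>\<Gamma>\<close> and \<open>\<Gamma>\<^sub>2\<close>\<close>

lemma OU_gen_alt:
  "OU_gen f x = (\<Sum>i\<in>UNIV. partial i (partial i f) x - x $ i * partial i f x)"
  by (simp add: OU_gen_def grad_def inner_vec_def sum_subtractf)

lemma Ck_OU_gen: "Ck (Suc (Suc k)) f \<Longrightarrow> Ck k (OU_gen f)"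
  unfolding OU_gen_alt[abs_def]
  by (intro Ck_sum Ck_diff Ck_mult Ck_coord Ck_partial)
     (auto intro: Ck_Suc_D simp del: Ck.simps dest: Ck_partial)

text \<open>The drift part of \<open>OU_gen\<close> is a derivation and cancels; only the cross
  terms in the product rule for the Laplacian survive.\<close>

lemma carre_du_champ_eq:
  fixes f g :: "real ^ 'n \<Rightarrow> real"
  assumes f: "Ck 2 f" and g: "Ck 2 g"
  shows "carre_du_champ f g x = (\<Sum>i\<in>UNIV. partial i f x * partial i g x)"
proof -
  have d: "\<And>x. f differentiable (at x)" "\<And>x. g differentiable (at x)"
    "\<And>i x. partial i f differentiable (at x)" "\<And>i x. partial i g differentiable (at x)"
    using f g by (auto simp: numeral_2_eq_2)
  have 1: "partial i (\<lambda>x. f x * g x) = (\<lambda>x. f x * partial i g x + partial i f x * g x)" for i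
    by (rule ext) (rule partial_mult[OF d(1,2)])
  have 2: "partial i (partial i (\<lambda>x. f x * g x)) x
      = f x * partial i (partial i g) x + 2 * (partial i f x * partial i g x)
        + partial i (partial i f) x * g x" for i
    unfolding 1 using d
    by (subst partial_add) (auto simp: partial_mult)
  have "OU_gen (\<lambda>y. f y * g y) x
      = f x * OU_gen g x + g x * OU_gen f x + 2 * (\<Sum>i\<in>UNIV. partial i f x * partial i g x)"
    unfolding OU_gen_alt 2 unfolding 1
    by (simp add: sum_distrib_left flip: sum.distrib) (simp add: algebra_simps)
  then show ?thesis by (simp add: carre_du_champ_def)
qed

text \<open>The definition of \<Gamma> solved for the generator of a square. It is meant for
  \<open>u\<close> a first partial derivative, since \<Gamma>(f) is a sum of such squares.\<close>

lemma OU_gen_square: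
  assumes "Ck 2 u"
  shows "OU_gen (\<lambda>y. u y * u y) x = 2 * (u x * OU_gen u x + (\<Sum>i\<in>UNIV. (partial i u x)\<^sup>2))"
  using carre_du_champ_eq[OF assms assms, of x]
  by (simp add: carre_du_champ_def power2_eq_square)

lemma OU_gen_sum:
  assumes "finite I" "\<And>j. j \<in> I \<Longrightarrow> Ck 2 (u j)"
  shows "OU_gen (\<lambda>y. \<Sum>j\<in>I. u j y) x = (\<Sum>j\<in>I. OU_gen (u j) x)"
proof -
  have d: "\<And>j x. j \<in> I \<Longrightarrow> u j differentiable (at x)"
    "\<And>i j x. j \<in> I \<Longrightarrow> partial i (u j) differentiable (at x)"
    using assms(2) by (auto simp: numeral_2_eq_2)
  have 1: "partial i (\<lambda>y. \<Sum>j\<in>I. u j y) = (\<lambda>y. \<Sum>j\<in>I. partial i (u j) y)" for i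
    by (rule ext) (rule partial_sum[OF assms(1) d(1)])
  have "OU_gen (\<lambda>y. \<Sum>j\<in>I. u j y) x
     = (\<Sum>i\<in>UNIV. \<Sum>j\<in>I. partial i (partial i (u j)) x - x $ i * partial i (u j) x)"
    unfolding OU_gen_alt 1
    by (intro sum.cong refl)
       (simp add: partial_sum[OF assms(1) d(2)] sum_distrib_left sum_subtractf)
  also have "\<dots> = (\<Sum>j\<in>I. OU_gen (u j) x)"
    unfolding OU_gen_alt by (rule sum.swap)
  finally show ?thesis .
qed

text \<open>The commutator comes entirely from the coefficient \<open>x $ j\<close> of the drift, as
  the constant-coefficient Laplacian commutes with \<open>partial j\<close>. It is the infinitesimal
  form of the factor \<open>exp (- t)\<close> in the commutation of derivatives with the
  semigroup.\<close>

lemma partial_OU_gen: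
  fixes f :: "real ^ 'n \<Rightarrow> real"
  assumes f: "Ck 3 f"
  shows "partial j (OU_gen f) x = OU_gen (partial j f) x - partial j f x"
proof -
  have d: "\<And>x. f differentiable (at x)" "\<And>i x. partial i f differentiable (at x)"
    "\<And>i j x. partial j (partial i f) differentiable (at x)"
    using f by (auto simp: numeral_3_eq_3)
  have c: "Ck 2 f" "\<And>i. Ck 2 (partial i f)"
    using Ck_le[OF f, of 2] Ck_partial[of 2 f] f by (simp_all add: numeral_3_eq_3 numeral_2_eq_2)
  have co: "(\<lambda>x::real^'n. x $ i) differentiable (at x)" for i x
    using Ck_coord[of 1 i] by simp
  have comm: "partial j (partial i (partial i f)) = partial i (partial i (partial j f))" for i
    using partial_commute[OF c(2), of j i i] partial_commute[OF c(1), of j i] by simp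
  have "partial j (OU_gen f) x
      = (\<Sum>i\<in>UNIV. partial j (\<lambda>x. partial i (partial i f) x - x $ i * partial i f x) x)"
    unfolding OU_gen_alt[abs_def] using d co
    by (intro partial_sum differentiable_diff differentiable_mult) auto
  also have "\<dots> = (\<Sum>i\<in>UNIV. partial i (partial i (partial j f)) x - x $ i * partial i (partial j f) x
      - (if i = j then partial i f x else 0))"
  proof (intro sum.cong refl)
    fix i
    have "partial j (\<lambda>x. partial i (partial i f) x - x $ i * partial i f x) x
      = partial j (partial i (partial i f)) x - partial j (\<lambda>x. x $ i * partial i f x) x"
      using d co by (intro partial_diff differentiable_mult)
    also have "partial j (\<lambda>x. x $ i * partial i f x) x
      = x $ i * partial j (partial i f) x + (if i = j then partial i f x else 0)"
      by (subst partial_mult[OF co d(2)]) (simp add: partial_coord)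
    finally show "partial j (\<lambda>x. partial i (partial i f) x - x $ i * partial i f x) x
      = partial i (partial i (partial j f)) x - x $ i * partial i (partial j f) x
      - (if i = j then partial i f x else 0)"
      by (simp add: comm partial_commute[OF c(1), of j i])
  qed
  also have "\<dots> = OU_gen (partial j f) x - partial j f x"
    by (simp add: OU_gen_alt sum_subtractf)
  finally show ?thesis .
qed

text \<open>Bochner's formula. The generator applied to a sum of squares produces the Hessian term,
  and the commutator of \<open>partial j\<close> with \<open>OU_gen\<close> leaves the gradient
  term. Four derivatives appear because the closed form of \<Gamma> is applied to
  \<open>OU_gen f\<close>, which must be of class \<open>Ck 2\<close>.\<close>

lemma carre_du_champ2_eq:
  fixes f :: "real ^ 'n \<Rightarrow> real"
  assumes f: "Ck 4 f"
  shows "carre_du_champ2 f f x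
    = (\<Sum>j\<in>UNIV. \<Sum>i\<in>UNIV. (partial i (partial j f) x)\<^sup>2) + (\<Sum>i\<in>UNIV. (partial i f x)\<^sup>2)"
proof -
  have "(4 :: nat) = Suc (Suc 2)" by simp
  then have f4: "Ck (Suc (Suc 2)) f" using f by (simp only:)
  have c: "Ck 2 f" "Ck 3 f" by (rule Ck_le[OF f]; simp)+
  have cp: "Ck 2 (partial i f)" for i
    using Ck_le[OF Ck_partial[OF f4], of 2] by simp
  have cL: "Ck 2 (OU_gen f)" by (rule Ck_OU_gen[OF f4])
  have G: "carre_du_champ f f = (\<lambda>x. \<Sum>j\<in>UNIV. partial j f x * partial j f x)"
    by (rule ext) (rule carre_du_champ_eq[OF c(1) c(1)])
  have "OU_gen (carre_du_champ f f) x = (\<Sum>j\<in>UNIV. 2 *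
      (partial j f x * OU_gen (partial j f) x + (\<Sum>i\<in>UNIV. (partial i (partial j f) x)\<^sup>2)))"
    unfolding G
    by (subst OU_gen_sum) (auto intro: Ck_mult cp simp: OU_gen_square[OF cp])
  moreover have "carre_du_champ f (OU_gen f) x
      = (\<Sum>j\<in>UNIV. partial j f x * OU_gen (partial j f) x - (partial j f x)\<^sup>2)"
    unfolding carre_du_champ_eq[OF c(1) cL] partial_OU_gen[OF c(2)]
    by (simp add: algebra_simps power2_eq_square)
  moreover have "carre_du_champ (OU_gen f) f x = carre_du_champ f (OU_gen f) x"
    unfolding carre_du_champ_eq[OF c(1) cL] carre_du_champ_eq[OF cL c(1)]
    by (simp add: mult.commute)
  ultimately show ?thesis
    unfolding carre_du_champ2_def
    by (simp add: sum_distrib_left[symmetric] sum.distrib sum_subtractf)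
qed

subsection \<open>The Gaussian measure and the Mehler kernel\<close>

text \<open>The radial closed form of the product density in \<open>gauss_def\<close>, chosen
  because the kernel computations expand squared norms.\<close>

definition gauss_density :: "real ^ 'n \<Rightarrow> real" where
  "gauss_density x = (1 / sqrt (2 * pi)) ^ CARD('n) * exp (- (norm x)\<^sup>2 / 2)"

lemma power2_norm_vec: "(norm (x :: real ^ 'n))\<^sup>2 = (\<Sum>i\<in>UNIV. (x $ i)\<^sup>2)"
  unfolding power2_norm_eq_inner inner_vec_def by (simp add: power2_eq_square)

lemma gauss_density_prod: "gauss_density x = (\<Prod>i\<in>UNIV. std_normal_density (x $ i))"
proof -
  have "(\<Prod>i\<in>UNIV. std_normal_density (x $ i))
      = (1 / sqrt (2 * pi)) ^ CARD('a) * (\<Prod>i\<in>UNIV. exp (- (x $ i)\<^sup>2 / 2))"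
    unfolding std_normal_density_def prod.distrib by (simp add: power_one_over)
  also have "(\<Prod>i\<in>UNIV. exp (- (x $ i)\<^sup>2 / 2)) = exp (- (norm x)\<^sup>2 / 2)"
    by (simp add: exp_sum[symmetric] power2_norm_vec sum_negf sum_divide_distrib)
  finally show ?thesis by (simp add: gauss_density_def)
qed

lemma gauss_eq: "gauss = density lborel (\<lambda>x. ennreal (gauss_density x))"
  by (simp add: gauss_def gauss_density_prod)

lemma sets_gauss [simp, measurable_cong]: "sets gauss = sets borel"
  by (simp add: gauss_eq)

lemma space_gauss [simp]: "space gauss = UNIV"
  by (simp add: gauss_eq)

lemma gauss_density_pos: "0 < gauss_density x"
  by (simp add: gauss_density_def)

lemma gauss_density_nonneg [simp]: "0 \<le> gauss_density x"
  using gauss_density_pos[of x] by simp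

lemma borel_measurable_gauss_density [measurable]: "gauss_density \<in> borel_measurable borel"
  unfolding gauss_density_def by measurable

lemma prob_space_gauss: "prob_space (gauss :: (real ^ 'n) measure)"
proof
  have inj: "inj_on (\<lambda>i::'n. axis i (1::real)) UNIV"
    by (auto simp: inj_on_def axis_eq_axis)
  have B: "(Basis :: (real ^ 'n) set) = (\<lambda>i. axis i 1) ` UNIV"
    by (auto simp: Basis_vec_def)
  have "emeasure gauss (space (gauss :: (real ^ 'n) measure)) = (\<integral>\<^sup>+ x. ennreal (gauss_density (x :: real ^ 'n)) \<partial>lborel)"
    by (simp add: gauss_eq emeasure_density)
  also have "\<dots> = (\<integral>\<^sup>+ (x :: real ^ 'n). (\<Prod>b\<in>Basis. ennreal (std_normal_density (x \<bullet> b))) \<partial>lborel)"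
    by (intro nn_integral_cong)
       (simp add: gauss_density_prod B prod.reindex[OF inj] inner_axis prod_ennreal)
  also have "\<dots> = (\<Prod>b\<in>(Basis :: (real ^ 'n) set). \<integral>\<^sup>+ x. ennreal (std_normal_density x) \<partial>lborel)"
    by (rule nn_integral_lborel_prod) auto
  also have "(\<integral>\<^sup>+ x. ennreal (std_normal_density x) \<partial>lborel) = 1"
    using prob_space.emeasure_space_1[OF prob_space_normal_density[of 1 0]]
    by (simp add: emeasure_density)
  finally show "emeasure gauss (space (gauss :: (real ^ 'n) measure)) = 1" by simp
qed

interpretation gauss: prob_space "gauss :: (real ^ 'n) measure"
  by (rule prob_space_gauss)

section \<open>Passage to Lebesgue measure and affine substitution\<close>

lemma nn_integral_gauss:
  "f \<in> borel_measurable borel \<Longrightarrow>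
    (\<integral>\<^sup>+ x. f x \<partial>gauss) = (\<integral>\<^sup>+ x. ennreal (gauss_density x) * f x \<partial>lborel)"
  by (simp add: gauss_eq nn_integral_density)

lemma integrable_gauss:
  fixes f :: "real ^ 'n \<Rightarrow> real"
  assumes "f \<in> borel_measurable borel"
  shows "integrable gauss f \<longleftrightarrow> integrable lborel (\<lambda>x. gauss_density x * f x)"
  using assms by (simp add: gauss_eq integrable_density)

lemma integral_gauss:
  fixes f :: "real ^ 'n \<Rightarrow> real"
  assumes "f \<in> borel_measurable borel"
  shows "integral\<^sup>L gauss f = (\<integral>x. gauss_density x * f x \<partial>lborel)"
  using assms by (simp add: gauss_eq integral_density)

lemma nn_integral_lborel_affine:
  fixes f :: "'a :: euclidean_space \<Rightarrow> ennreal"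
  assumes [measurable]: "f \<in> borel_measurable borel" and "c \<noteq> 0"
  shows "(\<integral>\<^sup>+ x. f x \<partial>lborel) = ennreal (\<bar>c\<bar> ^ DIM('a)) * (\<integral>\<^sup>+ x. f (t + c *\<^sub>R x) \<partial>lborel)"
  by (subst lborel_affine[OF assms(2), of t])
     (simp add: nn_integral_density nn_integral_distr nn_integral_cmult)

text \<open>Rescaling by \<open>s = sqrt (2 * c)\<close> turns the density into a multiple of
  \<open>exp (- c * (norm x)^2)\<close>, so finiteness follows from the total mass 1 of
  \<open>gauss\<close>.\<close>

lemma integrable_exp_norm:
  fixes c :: real
  assumes "c > 0"
  shows "integrable lborel (\<lambda>x :: real ^ 'n. exp (- c * (norm x)\<^sup>2))"
proof -
  define s where "s = sqrt (2 * c)"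
  have s: "s > 0" "s\<^sup>2 = 2 * c" using assms by (auto simp: s_def)
  define K :: real where "K = (1 / sqrt (2 * pi)) ^ CARD('n)"
  have K: "K > 0" by (simp add: K_def)
  have "(\<integral>\<^sup>+ x. ennreal (gauss_density (x :: real ^ 'n)) \<partial>lborel) = 1"
    using gauss.emeasure_space_1 by (simp add: gauss_eq emeasure_density)
  moreover have "(\<integral>\<^sup>+ x. ennreal (gauss_density (x :: real ^ 'n)) \<partial>lborel)
      = ennreal (s ^ CARD('n)) * (\<integral>\<^sup>+ x. ennreal (gauss_density (0 + s *\<^sub>R x :: real ^ 'n)) \<partial>lborel)"
    using nn_integral_lborel_affine[of "\<lambda>x. ennreal (gauss_density (x :: real ^ 'n))" s 0] s(1)
    by simp
  moreover have "gauss_density (0 + s *\<^sub>R x :: real ^ 'n) = K * exp (- c * (norm x)\<^sup>2)" for x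
    using s by (simp add: gauss_density_def K_def power_mult_distrib)
  ultimately have "ennreal (s ^ CARD('n)) * (\<integral>\<^sup>+ x. ennreal (K * exp (- c * (norm (x :: real ^ 'n))\<^sup>2)) \<partial>lborel) = 1"
    by simp
  then have "(\<integral>\<^sup>+ x. ennreal (K * exp (- c * (norm (x :: real ^ 'n))\<^sup>2)) \<partial>lborel) < \<infinity>"
    using s(1) by (auto simp: top.not_eq_extremum[symmetric] ennreal_mult_top)
  then have "integrable lborel (\<lambda>x :: real ^ 'n. K * exp (- c * (norm x)\<^sup>2))"
    using K by (intro integrableI_nonneg) auto
  from integrable_mult_right[OF this, of "1 / K"] show ?thesis using K by simp
qed

text \<open>The transition kernel: for \<open>a\<^sup>2 + s\<^sup>2 = 1\<close> this is the Lebesgue density of \<open>a x + s Y\<close>, \<open>Y\<close>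
  standard Gaussian. Its reversibility with respect to the Gaussian measure yields the invariance.\<close>

definition mehler :: "real \<Rightarrow> real \<Rightarrow> real ^ 'n \<Rightarrow> real ^ 'n \<Rightarrow> real" where
  "mehler a s x z = gauss_density ((1 / s) *\<^sub>R (z - a *\<^sub>R x)) / s ^ CARD('n)"

lemma mehler_nonneg: "s > 0 \<Longrightarrow> 0 \<le> mehler a s x z"
  by (simp add: mehler_def)

text \<open>Detailed balance. Up to the factor \<open>-1 / (2 * s^2)\<close>, the joint exponent is
  \<open>s^2 * (norm x)^2 + (norm (z - a x))^2\<close>; when \<open>a^2 + s^2 = 1\<close> this is
  \<open>(norm x)^2 - 2 * a * (x \<bullet> z) + (norm z)^2\<close>, which is symmetric in
  \<open>x\<close> and \<open>z\<close>.\<close>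

lemma mehler_symmetric:
  fixes x z :: "real ^ 'n"
  assumes "s > 0" "a\<^sup>2 + s\<^sup>2 = 1"
  shows "gauss_density x * mehler a s x z = gauss_density z * mehler a s z x"
proof -
  have n: "(norm (u - a *\<^sub>R v))\<^sup>2 = (norm u)\<^sup>2 - 2 * a * (u \<bullet> v) + a\<^sup>2 * (norm v)\<^sup>2" for u v :: "real ^ 'n"
    unfolding power2_norm_eq_inner
    by (simp add: inner_diff inner_commute[of v u] algebra_simps power2_eq_square[of a])
  have 1: "s\<^sup>2 * (norm x)\<^sup>2 + (norm (z - a *\<^sub>R x))\<^sup>2 = s\<^sup>2 * (norm z)\<^sup>2 + (norm (x - a *\<^sub>R z))\<^sup>2"
  proof -
    have s2: "s\<^sup>2 = 1 - a\<^sup>2" using assms(2) by simp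
    show ?thesis unfolding n s2 by (simp add: algebra_simps inner_commute)
  qed
  have e: "- (norm u)\<^sup>2 / 2 + - (norm ((1 / s) *\<^sub>R v))\<^sup>2 / 2 = - (s\<^sup>2 * (norm u)\<^sup>2 + (norm v)\<^sup>2) / (2 * s\<^sup>2)"
    for u v :: "real ^ 'n"
    using assms(1) by (simp add: power_divide field_simps)
  have E: "exp (- (norm x)\<^sup>2 / 2) * exp (- (norm ((1 / s) *\<^sub>R (z - a *\<^sub>R x)))\<^sup>2 / 2)
      = exp (- (norm z)\<^sup>2 / 2) * exp (- (norm ((1 / s) *\<^sub>R (x - a *\<^sub>R z)))\<^sup>2 / 2)"
    unfolding exp_add[symmetric] e 1 ..
  have alg: "k * p * (k * q / r) = k * k / r * (p * q)" for k p q r :: real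
    by simp
  show ?thesis
    unfolding mehler_def gauss_density_def alg E ..
qed

lemma nn_integral_mehler:
  fixes F :: "real ^ 'n \<Rightarrow> ennreal"
  assumes [measurable]: "F \<in> borel_measurable borel" and s: "s > 0"
  shows "(\<integral>\<^sup>+ y. F (a *\<^sub>R x + s *\<^sub>R y) \<partial>gauss) = (\<integral>\<^sup>+ z. ennreal (mehler a s x z) * F z \<partial>lborel)"
proof -
  have "(\<integral>\<^sup>+ z. ennreal (mehler a s x z) * F z \<partial>lborel)
      = ennreal (s ^ CARD('n)) * (\<integral>\<^sup>+ y. ennreal (mehler a s x (a *\<^sub>R x + s *\<^sub>R y)) * F (a *\<^sub>R x + s *\<^sub>R y) \<partial>lborel)"
    using nn_integral_lborel_affine[of "\<lambda>z. ennreal (mehler a s x z) * F z" s "a *\<^sub>R x"] s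
    by (simp add: mehler_def)
  also have "\<dots> = (\<integral>\<^sup>+ y. ennreal (s ^ CARD('n)) * (ennreal (mehler a s x (a *\<^sub>R x + s *\<^sub>R y)) * F (a *\<^sub>R x + s *\<^sub>R y)) \<partial>lborel)"
    by (rule nn_integral_cmult[symmetric]) (simp add: mehler_def)
  also have "\<dots> = (\<integral>\<^sup>+ y. ennreal (gauss_density y) * F (a *\<^sub>R x + s *\<^sub>R y) \<partial>lborel)"
    using s by (intro nn_integral_cong) (simp add: mehler_def mult.assoc[symmetric] ennreal_mult[symmetric])
  also have "\<dots> = (\<integral>\<^sup>+ y. F (a *\<^sub>R x + s *\<^sub>R y) \<partial>gauss)"
    by (rule nn_integral_gauss[symmetric]) simp
  finally show ?thesis by simp
qed

text \<open>Tonelli and detailed balance move the kernel onto the other variable, where it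
  integrates to 1. Working with values in \<open>ennreal\<close> makes this applicable to the square
  of a function before anything is known about integrability along the semigroup.\<close>

lemma nn_integral_gauss_invariant:
  fixes F :: "real ^ 'n \<Rightarrow> ennreal"
  assumes [measurable]: "F \<in> borel_measurable borel" and s: "s > 0" "a\<^sup>2 + s\<^sup>2 = 1"
  shows "(\<integral>\<^sup>+ x. \<integral>\<^sup>+ y. F (a *\<^sub>R x + s *\<^sub>R y) \<partial>gauss \<partial>gauss) = (\<integral>\<^sup>+ x. F x \<partial>gauss)"
proof -
  have m [measurable]: "(\<lambda>z. mehler a s x z) \<in> borel_measurable borel"
    "(\<lambda>x. mehler a s x z) \<in> borel_measurable borel" for x z :: "real ^ 'n"
    unfolding mehler_def by measurable
  have "(\<integral>\<^sup>+ x. \<integral>\<^sup>+ y. F (a *\<^sub>R x + s *\<^sub>R y) \<partial>gauss \<partial>gauss)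
      = (\<integral>\<^sup>+ x. ennreal (gauss_density x) * (\<integral>\<^sup>+ z. ennreal (mehler a s x z) * F z \<partial>lborel) \<partial>lborel)"
    unfolding nn_integral_mehler[OF assms(1) s(1)]
    by (rule nn_integral_gauss) (unfold mehler_def, measurable)
  also have "\<dots> = (\<integral>\<^sup>+ x. \<integral>\<^sup>+ z. ennreal (gauss_density x) * (ennreal (mehler a s x z) * F z) \<partial>lborel \<partial>lborel)"
    by (intro nn_integral_cong nn_integral_cmult[symmetric]) measurable
  also have "\<dots> = (\<integral>\<^sup>+ z. \<integral>\<^sup>+ x. ennreal (gauss_density x) * (ennreal (mehler a s x z) * F z) \<partial>lborel \<partial>lborel)"
    by (rule lborel_pair.Fubini') (unfold mehler_def, measurable)
  also have "\<dots> = (\<integral>\<^sup>+ z. \<integral>\<^sup>+ x. ennreal (gauss_density z) * F z * ennreal (mehler a s z x) \<partial>lborel \<partial>lborel)"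
  proof (intro nn_integral_cong)
    fix x z :: "real ^ 'n"
    have "ennreal (gauss_density x) * ennreal (mehler a s x z) = ennreal (gauss_density z) * ennreal (mehler a s z x)"
      using mehler_symmetric[OF s, of x z] by (simp add: ennreal_mult[symmetric] mehler_nonneg s(1))
    then show "ennreal (gauss_density x) * (ennreal (mehler a s x z) * F z)
        = ennreal (gauss_density z) * F z * ennreal (mehler a s z x)"
      by (metis mult.assoc mult.commute)
  qed
  also have "\<dots> = (\<integral>\<^sup>+ z. ennreal (gauss_density z) * F z * (\<integral>\<^sup>+ x. ennreal (mehler a s z x) \<partial>lborel) \<partial>lborel)"
    by (intro nn_integral_cong nn_integral_cmult) measurable
  also have "\<dots> = (\<integral>\<^sup>+ z. ennreal (gauss_density z) * F z \<partial>lborel)"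
  proof -
    have "(\<integral>\<^sup>+ x. ennreal (mehler a s z x) \<partial>lborel) = emeasure gauss (space (gauss :: (real ^ 'n) measure))"
      for z :: "real ^ 'n"
      using nn_integral_mehler[OF _ s(1), of "\<lambda>_. 1" a z] by simp
    then show ?thesis by (simp only: gauss.emeasure_space_1 mult_1_right)
  qed
  also have "\<dots> = (\<integral>\<^sup>+ x. F x \<partial>gauss)"
    by (rule nn_integral_gauss[symmetric]) simp
  finally show ?thesis .
qed

subsection \<open>Laplace transforms\<close>

definition laplace :: "real \<Rightarrow> (real ^ 'n \<Rightarrow> real) \<Rightarrow> real ^ 'n \<Rightarrow> real" where
  "laplace b h x = (\<integral>z. h z * exp (b * (x \<bullet> z)) \<partial>lborel)"

text \<open>Every rate \<open>c\<close> is demanded so that the class is stable under multiplication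
  by coordinates, the operation that differentiation induces on a Laplace transform.\<close>

definition exp_integrable :: "(real ^ 'n \<Rightarrow> real) \<Rightarrow> bool" where
  "exp_integrable h \<longleftrightarrow> h \<in> borel_measurable borel \<and>
     (\<forall>c. integrable lborel (\<lambda>z. h z * exp (c * norm z)))"

lemma exp_integrable_mult_norm_le:
  fixes h p :: "real ^ 'n \<Rightarrow> real"
  assumes h: "exp_integrable h" and p [measurable]: "p \<in> borel_measurable borel"
    and le: "\<And>z. \<bar>p z\<bar> \<le> C * exp (c * norm z)"
  shows "integrable lborel (\<lambda>z. h z * p z)"
proof (rule Bochner_Integration.integrable_bound)
  have [measurable]: "h \<in> borel_measurable borel" using h by (simp add: exp_integrable_def)
  show "integrable lborel (\<lambda>z. C * (h z * exp (c * norm z)))"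
    using h by (simp add: exp_integrable_def)
  show "(\<lambda>z. h z * p z) \<in> borel_measurable lborel" by simp
  have "\<bar>h z * p z\<bar> \<le> \<bar>C * (h z * exp (c * norm z))\<bar>" for z
  proof -
    have "\<bar>h z * p z\<bar> \<le> \<bar>h z\<bar> * (C * exp (c * norm z))"
      unfolding abs_mult by (intro mult_left_mono le) simp
    also have "\<dots> \<le> \<bar>h z\<bar> * \<bar>C * exp (c * norm z)\<bar>"
      by (intro mult_left_mono) auto
    finally show ?thesis by (simp add: abs_mult mult_ac)
  qed
  then show "AE z in lborel. norm (h z * p z) \<le> norm (C * (h z * exp (c * norm z)))" by simp
qed

lemma exp_integrable_coord:
  fixes h :: "real ^ 'n \<Rightarrow> real"
  assumes h: "exp_integrable h"
  shows "exp_integrable (\<lambda>z. b * z $ i * h z)"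
  unfolding exp_integrable_def
proof (intro conjI allI)
  have [measurable]: "h \<in> borel_measurable borel" using h by (simp add: exp_integrable_def)
  show "(\<lambda>z. b * z $ i * h z) \<in> borel_measurable borel" by simp
  fix c
  have "\<bar>b * z $ i * exp (c * norm z)\<bar> \<le> \<bar>b\<bar> * exp ((1 + c) * norm z)" for z :: "real ^ 'n"
  proof -
    have "\<bar>z $ i\<bar> \<le> norm z" by (rule component_le_norm_cart)
    also have "\<dots> \<le> exp (norm z)" using exp_ge_add_one_self[of "norm z"] by linarith
    finally have "\<bar>z $ i\<bar> * exp (c * norm z) \<le> exp (norm z) * exp (c * norm z)"
      by (rule mult_right_mono) simp
    then have "\<bar>b\<bar> * (\<bar>z $ i\<bar> * exp (c * norm z)) \<le> \<bar>b\<bar> * exp ((1 + c) * norm z)"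
      by (intro mult_left_mono) (simp_all add: exp_add distrib_right)
    then show ?thesis by (simp add: abs_mult mult.assoc)
  qed
  from exp_integrable_mult_norm_le[OF h _ this]
  have "integrable lborel (\<lambda>z. h z * (b * z $ i * exp (c * norm z)))" by simp
  then show "integrable lborel (\<lambda>z. b * z $ i * h z * exp (c * norm z))"
    by (simp add: mult_ac)
qed

lemma exp_inner_le: "exp (b * (x \<bullet> z)) \<le> exp (\<bar>b\<bar> * norm x * norm z)"
proof -
  have "b * (x \<bullet> z) \<le> \<bar>b\<bar> * \<bar>x \<bullet> z\<bar>" by (metis abs_ge_self abs_mult)
  also have "\<dots> \<le> \<bar>b\<bar> * (norm x * norm z)" by (intro mult_left_mono Cauchy_Schwarz_ineq2) simp
  finally show ?thesis by (simp add: mult.assoc)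
qed

lemma integrable_laplace:
  "exp_integrable h \<Longrightarrow> integrable lborel (\<lambda>z. h z * exp (b * (x \<bullet> z)))"
  by (rule exp_integrable_mult_norm_le[of _ _ 1 "\<bar>b\<bar> * norm x"]) (use exp_inner_le in auto)

lemma exp_remainder_le: "\<bar>exp u - 1 - u\<bar> \<le> u\<^sup>2 * exp \<bar>u :: real\<bar>"
proof -
  obtain t where t: "\<bar>t\<bar> \<le> \<bar>u\<bar>" "exp u = (\<Sum>m<2. u ^ m / fact m) + exp t / fact 2 * u\<^sup>2"
    using Maclaurin_exp_le[of u 2] by blast
  have "\<bar>exp u - 1 - u\<bar> = exp t / 2 * u\<^sup>2"
    using t(2) by (simp add: numeral_2_eq_2)
  also have "\<dots> \<le> exp \<bar>u\<bar> * u\<^sup>2"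
  proof (rule mult_right_mono)
    have "exp t \<le> exp \<bar>u\<bar>" "0 < exp t" using t(1) by auto
    then show "exp t / 2 \<le> exp \<bar>u\<bar>" by linarith
  qed simp
  finally show ?thesis by (simp add: mult.commute)
qed

text \<open>With \<open>u = b * (k \<bullet> z)\<close> for the increment \<open>k = y - x\<close>,
  the first-order error of the integrand is controlled by \<open>exp u - 1 - u\<close>, which is
  quadratic in \<open>k\<close>. Integration therefore leaves an error of order
  \<open>(norm k)^2\<close>, with the integral of \<open>w\<close> as the constant.\<close>

lemma laplace_has_derivative:
  fixes h :: "real ^ 'n \<Rightarrow> real"
  assumes h: "exp_integrable h"
  shows "(laplace b h has_derivative
    (\<lambda>k. \<Sum>i\<in>UNIV. k $ i * laplace b (\<lambda>z. b * z $ i * h z) x)) (at x)"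
proof (rule has_derivativeI_sandwich[of 1])
  define D where "D k = (\<Sum>i\<in>UNIV. k $ i * laplace b (\<lambda>z. b * z $ i * h z) x)" for k
  have hm [measurable]: "h \<in> borel_measurable borel" using h by (simp add: exp_integrable_def)
  \<comment> \<open>The extra 1 next to \<open>norm x\<close> absorbs the factor
    \<open>exp \<bar>u\<bar>\<close> of the remainder, uniformly over increments with
    \<open>norm k \<le> 1\<close>.\<close>
  define w where "w z = \<bar>h z\<bar> * (b\<^sup>2 * (norm z)\<^sup>2 * exp (\<bar>b\<bar> * (norm x + 1) * norm z))" for z
  have n2: "(norm z)\<^sup>2 \<le> 2 * exp (norm z)" for z :: "real ^ 'n"
  proof -
    have "1 + norm z + (norm z)\<^sup>2 / 2 \<le> exp (norm z)"
      by (rule exp_lower_Taylor_quadratic) simp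
    with norm_ge_zero[of z] show ?thesis by linarith
  qed
  have ah: "exp_integrable (\<lambda>z. \<bar>h z\<bar>)"
    unfolding exp_integrable_def
  proof (intro conjI allI)
    fix c
    have "integrable lborel (\<lambda>z. \<bar>h z * exp (c * norm z)\<bar>)"
      by (rule integrable_abs) (use h in \<open>simp add: exp_integrable_def\<close>)
    then show "integrable lborel (\<lambda>z. \<bar>h z\<bar> * exp (c * norm z))" by (simp add: abs_mult)
  qed simp
  have w: "integrable lborel w"
    unfolding w_def
  proof (rule exp_integrable_mult_norm_le[OF ah])
    fix z :: "real ^ 'n"
    have "b\<^sup>2 * (norm z)\<^sup>2 * exp (\<bar>b\<bar> * (norm x + 1) * norm z)
        \<le> b\<^sup>2 * (2 * exp (norm z)) * exp (\<bar>b\<bar> * (norm x + 1) * norm z)"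
      by (intro mult_mono n2) auto
    also have "\<dots> = (2 * b\<^sup>2) * exp ((1 + \<bar>b\<bar> * (norm x + 1)) * norm z)"
      by (simp add: exp_add distrib_right)
    finally show "\<bar>b\<^sup>2 * (norm z)\<^sup>2 * exp (\<bar>b\<bar> * (norm x + 1) * norm z)\<bar>
        \<le> (2 * b\<^sup>2) * exp ((1 + \<bar>b\<bar> * (norm x + 1)) * norm z)"
      by simp
  qed simp
  show "bounded_linear (\<lambda>k. \<Sum>i\<in>UNIV. k $ i * laplace b (\<lambda>z. b * z $ i * h z) x)"
    by (intro bounded_linear_sum bounded_linear_mult_const[OF bounded_linear_vec_nth])
  have D: "D k = (\<integral>z. h z * (b * (k \<bullet> z)) * exp (b * (x \<bullet> z)) \<partial>lborel)"
    and Di: "integrable lborel (\<lambda>z. h z * (b * (k \<bullet> z)) * exp (b * (x \<bullet> z)))" for k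
  proof -
    have i: "integrable lborel (\<lambda>z. k $ i * (b * z $ i * h z * exp (b * (x \<bullet> z))))" for i
      by (intro integrable_mult_right integrable_laplace exp_integrable_coord h)
    have e: "(\<Sum>i\<in>UNIV. k $ i * (b * z $ i * h z * exp (b * (x \<bullet> z))))
        = h z * (b * (k \<bullet> z)) * exp (b * (x \<bullet> z))" for z
      by (simp add: inner_vec_def sum_distrib_left sum_distrib_right mult_ac)
    show "D k = (\<integral>z. h z * (b * (k \<bullet> z)) * exp (b * (x \<bullet> z)) \<partial>lborel)"
      unfolding D_def laplace_def e[symmetric]
      by (subst Bochner_Integration.integral_sum) (use i in auto)
    show "integrable lborel (\<lambda>z. h z * (b * (k \<bullet> z)) * exp (b * (x \<bullet> z)))"
      unfolding e[symmetric] by (intro Bochner_Integration.integrable_sum i)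
  qed
  show "norm (laplace b h y - laplace b h x - (\<Sum>i\<in>UNIV. (y - x) $ i * laplace b (\<lambda>z. b * z $ i * h z) x))
      / norm (y - x) \<le> integral\<^sup>L lborel w * norm (y - x)" if y: "y \<noteq> x" "dist y x < 1" for y
  proof -
    define k where "k = y - x"
    have k: "norm k \<le> 1" "y = x + k" using y by (auto simp: k_def dist_norm)
    let ?r = "\<lambda>z. h z * exp (b * (y \<bullet> z)) - h z * exp (b * (x \<bullet> z)) - h z * (b * (k \<bullet> z)) * exp (b * (x \<bullet> z))"
    have "laplace b h y - laplace b h x - D k = (\<integral>z. ?r z \<partial>lborel)"
      unfolding D laplace_def
      by (simp add: integrable_laplace h Di)
    also have "norm \<dots> \<le> (\<integral>z. w z * (norm k)\<^sup>2 \<partial>lborel)"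
    proof (rule Bochner_Integration.integral_norm_bound_integral)
      show "integrable lborel ?r"
        by (intro Bochner_Integration.integrable_diff integrable_laplace h Di)
      show "integrable lborel (\<lambda>z. w z * (norm k)\<^sup>2)" using w by simp
      fix z
      define u where "u = b * (k \<bullet> z)"
      have "\<bar>u\<bar> \<le> \<bar>b\<bar> * (norm k * norm z)"
        unfolding u_def abs_mult by (intro mult_left_mono Cauchy_Schwarz_ineq2) simp
      moreover have "norm k * norm z \<le> 1 * norm z" by (intro mult_right_mono k) simp
      ultimately have u: "\<bar>u\<bar> \<le> \<bar>b\<bar> * norm k * norm z" "\<bar>u\<bar> \<le> \<bar>b\<bar> * norm z"
        using mult_left_mono[of "norm k * norm z" "norm z" "\<bar>b\<bar>"] by (simp_all add: mult.assoc)
      have "u\<^sup>2 \<le> (\<bar>b\<bar> * norm k * norm z)\<^sup>2"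
        using u(1) by (metis abs_ge_zero power2_abs power_mono)
      then have u2: "u\<^sup>2 \<le> b\<^sup>2 * (norm z)\<^sup>2 * (norm k)\<^sup>2" by (simp add: power_mult_distrib mult_ac)
      have "?r z = h z * exp (b * (x \<bullet> z)) * (exp u - 1 - u)"
        by (simp add: k(2) u_def inner_add_left distrib_left exp_add algebra_simps)
      then have "norm (?r z) = \<bar>h z\<bar> * (exp (b * (x \<bullet> z)) * \<bar>exp u - 1 - u\<bar>)"
        by (simp add: abs_mult mult.assoc)
      also have "\<dots> \<le> \<bar>h z\<bar> * (exp (\<bar>b\<bar> * norm x * norm z) * (b\<^sup>2 * (norm z)\<^sup>2 * (norm k)\<^sup>2 * exp (\<bar>b\<bar> * norm z)))"
      proof (intro mult_left_mono mult_mono exp_inner_le)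
        show "\<bar>exp u - 1 - u\<bar> \<le> b\<^sup>2 * (norm z)\<^sup>2 * (norm k)\<^sup>2 * exp (\<bar>b\<bar> * norm z)"
          by (rule order_trans[OF exp_remainder_le mult_mono]) (use u2 u(2) in auto)
      qed auto
      also have "\<dots> = w z * (norm k)\<^sup>2"
        unfolding w_def by (simp add: exp_add distrib_right distrib_left)
      finally show "norm (?r z) \<le> w z * (norm k)\<^sup>2" .
    qed
    also have "\<dots> = integral\<^sup>L lborel w * (norm k)\<^sup>2" by simp
    finally have "norm (laplace b h y - laplace b h x - D k) \<le> integral\<^sup>L lborel w * (norm k)\<^sup>2" .
    then show ?thesis
      unfolding D_def k_def using y(1) by (simp add: divide_le_eq power2_eq_square mult.assoc)
  qed
  have "((\<lambda>y. integral\<^sup>L lborel w * norm (y - x)) \<longlongrightarrow> integral\<^sup>L lborel w * norm (x - x)) (at x)"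
    by (intro tendsto_intros)
  then show "((\<lambda>y. integral\<^sup>L lborel w * norm (y - x)) \<longlongrightarrow> 0) (at x)" by simp
qed simp

lemma partial_laplace:
  assumes "exp_integrable h"
  shows "partial i (laplace b h) = laplace b (\<lambda>z. b * z $ i * h z)"
proof
  fix x
  have "partial i (laplace b h) x = (\<Sum>j\<in>UNIV. axis i 1 $ j * laplace b (\<lambda>z. b * z $ j * h z) x)"
    by (rule partial_eq[OF laplace_has_derivative[OF assms]])
  also have "\<dots> = (\<Sum>j\<in>UNIV. if j = i then laplace b (\<lambda>z. b * z $ i * h z) x else 0)"
    by (intro sum.cong) (auto simp: axis_def)
  finally show "partial i (laplace b h) x = laplace b (\<lambda>z. b * z $ i * h z) x" by simp
qed

text \<open>The induction varies \<open>h\<close>, because a partial derivative is again a Laplace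
  transform, of a coordinate multiple of \<open>h\<close>.\<close>

lemma Ck_laplace: "exp_integrable h \<Longrightarrow> Ck k (laplace b h)"
proof (induction k arbitrary: h)
  case 0
  have "laplace b h differentiable (at x)" for x
    using laplace_has_derivative[OF 0] by (auto simp: differentiable_def)
  then show ?case
    by (auto simp: differentiable_on_def intro: differentiable_at_withinI differentiable_imp_continuous_on)
next
  case (Suc k)
  have "laplace b h differentiable (at x)" for x
    using laplace_has_derivative[OF Suc.prems] by (auto simp: differentiable_def)
  with Suc show ?case by (simp add: partial_laplace exp_integrable_coord)
qed

lemma Ck_exp_norm: "Ck k (\<lambda>x :: real ^ 'n. exp (c * (norm x)\<^sup>2))"
proof -
  have der: "((\<lambda>x :: real ^ 'n. exp (c * (norm x)\<^sup>2)) has_derivative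
      (\<lambda>h. exp (c * (norm x)\<^sup>2) * (c * (2 * (x \<bullet> h))))) (at x)" for x
    unfolding power2_norm_eq_inner
    by (auto intro!: derivative_eq_intros simp: inner_commute)
  have p: "partial i (\<lambda>x :: real ^ 'n. exp (c * (norm x)\<^sup>2))
      = (\<lambda>x. (2 * c) * (x $ i * exp (c * (norm x)\<^sup>2)))" for i
    by (rule ext) (simp add: partial_eq[OF der] inner_axis)
  show ?thesis
  proof (induction k)
    case 0
    then show ?case by (auto intro!: continuous_intros)
  next
    case (Suc k)
    have "(\<lambda>x :: real ^ 'n. exp (c * (norm x)\<^sup>2)) differentiable (at x)" for x
      using der by (auto simp: differentiable_def)
    then show ?case
      using Suc by (simp add: p Ck_mult Ck_const Ck_coord)
  qed
qed

subsection \<open>The Ornstein-Uhlenbeck semigroup on square-integrable functions\<close>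

definition gauss_L2 :: "(real ^ 'n \<Rightarrow> real) \<Rightarrow> bool" where
  "gauss_L2 g \<longleftrightarrow> g \<in> borel_measurable borel \<and> integrable gauss (\<lambda>x. (g x)\<^sup>2)"

lemma gauss_L2_measurable: "gauss_L2 g \<Longrightarrow> g \<in> borel_measurable borel"
  by (simp add: gauss_L2_def)

lemma gauss_L2_bound:
  fixes f g :: "real ^ 'n \<Rightarrow> real"
  assumes g: "gauss_L2 g" and f [measurable]: "f \<in> borel_measurable borel"
    and le: "\<And>x. \<bar>f x\<bar> \<le> \<bar>g x\<bar>"
  shows "gauss_L2 f"
proof -
  have "integrable gauss (\<lambda>x. (f x)\<^sup>2)"
  proof (rule Bochner_Integration.integrable_bound)
    show "integrable gauss (\<lambda>x. (g x)\<^sup>2)" using g by (simp add: gauss_L2_def)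
    show "AE x in gauss. norm ((f x)\<^sup>2) \<le> norm ((g x)\<^sup>2)"
      using le by (simp add: abs_le_square_iff[symmetric])
  qed simp
  then show ?thesis by (simp add: gauss_L2_def)
qed

lemma gauss_L2_add:
  fixes f g :: "real ^ 'n \<Rightarrow> real"
  assumes "gauss_L2 f" "gauss_L2 g"
  shows "gauss_L2 (\<lambda>x. f x + g x)"
proof -
  have [measurable]: "f \<in> borel_measurable borel" "g \<in> borel_measurable borel"
    using assms by (simp_all add: gauss_L2_def)
  have "integrable gauss (\<lambda>x. (f x + g x)\<^sup>2)"
  proof (rule Bochner_Integration.integrable_bound)
    show "integrable gauss (\<lambda>x. 2 * (f x)\<^sup>2 + 2 * (g x)\<^sup>2)"
      using assms by (simp add: gauss_L2_def)
    have "(f x + g x)\<^sup>2 \<le> 2 * (f x)\<^sup>2 + 2 * (g x)\<^sup>2" for x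
      using sum_squares_bound[of "f x" "g x"] by (simp add: power2_sum)
    then show "AE x in gauss. norm ((f x + g x)\<^sup>2) \<le> norm (2 * (f x)\<^sup>2 + 2 * (g x)\<^sup>2)"
      by simp
  qed simp
  then show ?thesis by (simp add: gauss_L2_def)
qed

lemma gauss_L2_cmult: "gauss_L2 g \<Longrightarrow> gauss_L2 (\<lambda>x. c * g x)"
  unfolding gauss_L2_def power_mult_distrib by (auto intro: borel_measurable_times)

lemma gauss_L2_integrable:
  fixes g :: "real ^ 'n \<Rightarrow> real"
  assumes "gauss_L2 g"
  shows "integrable gauss g"
proof (rule Bochner_Integration.integrable_bound)
  have [measurable]: "g \<in> borel_measurable borel" using assms by (simp add: gauss_L2_def)
  show "g \<in> borel_measurable gauss" by simp
  show "integrable gauss (\<lambda>x. 1 + (g x)\<^sup>2)" using assms by (simp add: gauss_L2_def)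
  have "\<bar>g x\<bar> \<le> 1 + (g x)\<^sup>2" for x
    using sum_squares_bound[of 1 "\<bar>g x\<bar>"] by simp
  then show "AE x in gauss. norm (g x) \<le> norm (1 + (g x)\<^sup>2)" by simp
qed

lemma prob_gauss_UNIV [simp]: "measure (gauss :: (real ^ 'n) measure) UNIV = 1"
  using gauss.prob_space unfolding space_gauss .

lemma OU_0 [simp]: "OU 0 g = g"
  by (simp add: OU_def fun_eq_iff)

text \<open>The substitution formula as an identity of measures; in this form it also applies to
  signed functions and yields integrability together with the value of the integral.\<close>

lemma distr_gauss_affine:
  fixes x :: "real ^ 'n"
  assumes s: "s > 0"
  shows "distr gauss borel (\<lambda>y. a *\<^sub>R x + s *\<^sub>R y) = density lborel (\<lambda>z. ennreal (mehler a s x z))"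
proof (rule measure_eqI)
  have m [measurable]: "(\<lambda>z. mehler a s x z) \<in> borel_measurable borel"
    unfolding mehler_def by measurable
  fix A assume "A \<in> sets (distr gauss borel (\<lambda>y. a *\<^sub>R x + s *\<^sub>R y))"
  then have A [measurable]: "A \<in> sets borel" by simp
  have "emeasure (distr gauss borel (\<lambda>y. a *\<^sub>R x + s *\<^sub>R y)) A
      = (\<integral>\<^sup>+ z. indicator A z \<partial>distr gauss borel (\<lambda>y. a *\<^sub>R x + s *\<^sub>R y))"
    by simp
  also have "\<dots> = (\<integral>\<^sup>+ y. indicator A (a *\<^sub>R x + s *\<^sub>R y) \<partial>gauss)"
    by (rule nn_integral_distr) measurable
  also have "\<dots> = (\<integral>\<^sup>+ z. ennreal (mehler a s x z) * indicator A z \<partial>lborel)"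
    by (rule nn_integral_mehler[OF _ s]) measurable
  also have "\<dots> = emeasure (density lborel (\<lambda>z. ennreal (mehler a s x z))) A"
    by (simp add: emeasure_density)
  finally show "emeasure (distr gauss borel (\<lambda>y. a *\<^sub>R x + s *\<^sub>R y)) A
      = emeasure (density lborel (\<lambda>z. ennreal (mehler a s x z))) A" .
qed simp

lemma
  fixes g :: "real ^ 'n \<Rightarrow> real"
  assumes [measurable]: "g \<in> borel_measurable borel" and s: "s > 0"
  shows integral_mehler:
      "(\<integral>y. g (a *\<^sub>R x + s *\<^sub>R y) \<partial>gauss) = (\<integral>z. mehler a s x z * g z \<partial>lborel)"
    and integrable_mehler:
      "integrable gauss (\<lambda>y. g (a *\<^sub>R x + s *\<^sub>R y)) \<longleftrightarrow> integrable lborel (\<lambda>z. mehler a s x z * g z)"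
proof -
  have m [measurable]: "(\<lambda>z. mehler a s x z) \<in> borel_measurable borel"
    unfolding mehler_def by measurable
  have "(\<integral>y. g (a *\<^sub>R x + s *\<^sub>R y) \<partial>gauss) = (\<integral>z. g z \<partial>distr gauss borel (\<lambda>y. a *\<^sub>R x + s *\<^sub>R y))"
    by (simp add: integral_distr)
  then show "(\<integral>y. g (a *\<^sub>R x + s *\<^sub>R y) \<partial>gauss) = (\<integral>z. mehler a s x z * g z \<partial>lborel)"
    by (simp add: distr_gauss_affine[OF s] integral_density mehler_nonneg[OF s])
  have "integrable gauss (\<lambda>y. g (a *\<^sub>R x + s *\<^sub>R y)) \<longleftrightarrow> integrable (distr gauss borel (\<lambda>y. a *\<^sub>R x + s *\<^sub>R y)) g"
    by (simp add: integrable_distr_eq)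
  then show "integrable gauss (\<lambda>y. g (a *\<^sub>R x + s *\<^sub>R y)) \<longleftrightarrow> integrable lborel (\<lambda>z. mehler a s x z * g z)"
    by (simp add: distr_gauss_affine[OF s] integrable_density mehler_nonneg[OF s])
qed

text \<open>Expanding the square separates a factor in \<open>x\<close>, a factor in
  \<open>z\<close> and the exponential of a multiple of \<open>x \<bullet> z\<close>: the kernel
  integral is a Laplace transform up to a smooth prefactor.\<close>

lemma mehler_expand:
  fixes x z :: "real ^ 'n"
  assumes s: "s > 0"
  shows "mehler a s x z = ((1 / sqrt (2 * pi)) ^ CARD('n) / s ^ CARD('n)) * exp ((- (a\<^sup>2 / (2 * s\<^sup>2))) * (norm x)\<^sup>2)
    * (exp ((- 1 / (2 * s\<^sup>2)) * (norm z)\<^sup>2) * exp ((a / s\<^sup>2) * (x \<bullet> z)))"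
proof -
  have n: "(norm (z - a *\<^sub>R x))\<^sup>2 = (norm z)\<^sup>2 - 2 * a * (x \<bullet> z) + a\<^sup>2 * (norm x)\<^sup>2"
    unfolding power2_norm_eq_inner
    by (simp add: inner_diff inner_commute[of z x] algebra_simps power2_eq_square[of a])
  have "- (norm ((1 / s) *\<^sub>R (z - a *\<^sub>R x)))\<^sup>2 / 2 = - ((norm (z - a *\<^sub>R x))\<^sup>2 / (2 * s\<^sup>2))"
    using s by (simp add: power_divide)
  also have "\<dots> = (- (a\<^sup>2 / (2 * s\<^sup>2))) * (norm x)\<^sup>2 + ((- 1 / (2 * s\<^sup>2)) * (norm z)\<^sup>2 + (a / s\<^sup>2) * (x \<bullet> z))"
    unfolding n using s by (simp add: field_simps)
  finally have "exp (- (norm ((1 / s) *\<^sub>R (z - a *\<^sub>R x)))\<^sup>2 / 2)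
      = exp ((- (a\<^sup>2 / (2 * s\<^sup>2))) * (norm x)\<^sup>2) * (exp ((- 1 / (2 * s\<^sup>2)) * (norm z)\<^sup>2) * exp ((a / s\<^sup>2) * (x \<bullet> z)))"
    by (simp only: exp_add)
  then show ?thesis unfolding mehler_def gauss_density_def by simp
qed

text \<open>The condition \<open>s < 1\<close> is decisive. Half of the Gaussian weight, at the
  level of exponents, is spent on making \<open>g\<close> square-integrable for Lebesgue measure;
  what remains of the kernel must still decay after the factor \<open>exp (c * norm z)\<close>. The
  two pieces are joined by bounding a product by a sum of squares.\<close>

lemma exp_integrable_gauss_L2:
  fixes g :: "real ^ 'n \<Rightarrow> real"
  assumes g: "gauss_L2 g" and s: "0 < s" "s < 1"
  shows "exp_integrable (\<lambda>z. exp ((- 1 / (2 * s\<^sup>2)) * (norm z)\<^sup>2) * g z)"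
  unfolding exp_integrable_def
proof (intro conjI allI)
  have [measurable]: "g \<in> borel_measurable borel" using g by (simp add: gauss_L2_def)
  show "(\<lambda>z. exp ((- 1 / (2 * s\<^sup>2)) * (norm z)\<^sup>2) * g z) \<in> borel_measurable borel" by measurable
  fix c :: real
  \<comment> \<open>Chosen so that \<open>1 / (2 * s^2) = 1 / 4 + b / 2\<close>: the part
    \<open>1 / 4\<close> goes into \<open>p\<close>, the square root of the Gaussian exponential,
    and \<open>b / 2\<close> into \<open>q\<close>.\<close>
  define b where "b = 1 / s\<^sup>2 - 1 / 2"
  have b: "b > 1 / 2"
    unfolding b_def using s by (simp add: field_simps power_less_one_iff)
  define K :: real where "K = (1 / sqrt (2 * pi)) ^ CARD('n)"
  have K: "K > 0" by (simp add: K_def)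
  define M where "M = exp (c\<^sup>2 / (b - 1 / 2))"
  show "integrable lborel (\<lambda>z. exp ((- 1 / (2 * s\<^sup>2)) * (norm z)\<^sup>2) * g z * exp (c * norm z))"
  proof (rule Bochner_Integration.integrable_bound)
    have "integrable lborel (\<lambda>z. gauss_density z * (g z)\<^sup>2)"
      using g integrable_gauss[of "\<lambda>z. (g z)\<^sup>2"] by (simp add: gauss_L2_def)
    then show "integrable lborel (\<lambda>z. (1 / K) * (gauss_density z * (g z)\<^sup>2) + M * exp (- (1 / 2) * (norm z)\<^sup>2))"
      using integrable_exp_norm[of "1 / 2"] by (intro Bochner_Integration.integrable_add integrable_mult_right) auto
    show "(\<lambda>z. exp ((- 1 / (2 * s\<^sup>2)) * (norm z)\<^sup>2) * g z * exp (c * norm z)) \<in> borel_measurable lborel"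
      by measurable
    have "\<bar>exp ((- 1 / (2 * s\<^sup>2)) * (norm z)\<^sup>2) * g z * exp (c * norm z)\<bar>
        \<le> (1 / K) * (gauss_density z * (g z)\<^sup>2) + M * exp (- (1 / 2) * (norm z)\<^sup>2)" for z
    proof -
      define p where "p = exp (- (norm z)\<^sup>2 / 4)"
      define q where "q = exp (- b / 2 * (norm z)\<^sup>2 + c * norm z)"
      have "exp ((- 1 / (2 * s\<^sup>2)) * (norm z)\<^sup>2) * exp (c * norm z) = p * q"
      proof -
        have "- 1 / (2 * s\<^sup>2) = - 1 / 4 - b / 2" 
          unfolding b_def by (simp add: diff_divide_distrib mult.commute)
        then have "(- 1 / (2 * s\<^sup>2)) * (norm z)\<^sup>2 + c * norm z
            = - (norm z)\<^sup>2 / 4 + (- b / 2 * (norm z)\<^sup>2 + c * norm z)"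
          by (simp only:) (simp add: algebra_simps)
        then show ?thesis unfolding p_def q_def exp_add[symmetric] by (simp only:)
      qed
      then have "\<bar>exp ((- 1 / (2 * s\<^sup>2)) * (norm z)\<^sup>2) * g z * exp (c * norm z)\<bar> = \<bar>p * g z\<bar> * q"
        by (simp add: abs_mult p_def q_def mult_ac)
      also have "\<dots> \<le> (p * g z)\<^sup>2 + q\<^sup>2"
      proof -
        have "2 * (\<bar>p * g z\<bar> * q) \<le> (p * g z)\<^sup>2 + q\<^sup>2"
          using sum_squares_bound[of "\<bar>p * g z\<bar>" q] by simp
        moreover have "0 \<le> \<bar>p * g z\<bar> * q" by (simp add: q_def)
        ultimately show ?thesis by linarith
      qed
      finally have le: "\<bar>exp ((- 1 / (2 * s\<^sup>2)) * (norm z)\<^sup>2) * g z * exp (c * norm z)\<bar> \<le> (p * g z)\<^sup>2 + q\<^sup>2" .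
      have "(p * g z)\<^sup>2 = (1 / K) * (gauss_density z * (g z)\<^sup>2)"
        using K by (simp add: power_mult_distrib gauss_density_def K_def[symmetric] p_def exp_double[symmetric])
      moreover have "q\<^sup>2 \<le> M * exp (- (1 / 2) * (norm z)\<^sup>2)"
      proof -
        \<comment> \<open>Completing the square with \<open>d = b - 1 / 2\<close> trades the linear
          term in \<open>norm z\<close> for the constant \<open>M\<close> and leaves the decay rate
          \<open>1 / 2\<close> for the square of \<open>q\<close>.\<close>
        have alg: "(d * n - c)\<^sup>2 / d = d * n\<^sup>2 - 2 * c * n + c\<^sup>2 / d" if "d > 0" for d n :: real
          using that by (simp add: field_simps power2_eq_square)
        have "0 \<le> ((b - 1 / 2) * norm z - c)\<^sup>2 / (b - 1 / 2)" using b by simp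
        also have "\<dots> = (b - 1 / 2) * (norm z)\<^sup>2 - 2 * c * norm z + c\<^sup>2 / (b - 1 / 2)"
          using b by (intro alg) simp
        finally have "2 * (- b / 2 * (norm z)\<^sup>2 + c * norm z) \<le> c\<^sup>2 / (b - 1 / 2) + - (1 / 2) * (norm z)\<^sup>2"
          by (simp add: algebra_simps)
        then show ?thesis
          unfolding q_def M_def exp_double[symmetric] exp_add[symmetric] by simp
      qed
      ultimately show ?thesis using le by linarith
    qed
    then show "AE z in lborel. norm (exp ((- 1 / (2 * s\<^sup>2)) * (norm z)\<^sup>2) * g z * exp (c * norm z))
        \<le> norm ((1 / K) * (gauss_density z * (g z)\<^sup>2) + M * exp (- (1 / 2) * (norm z)\<^sup>2))"
      unfolding real_norm_def by (intro AE_I2 order_trans[OF _ abs_ge_self])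
  qed
qed

lemma OU_coeff:
  fixes t :: real
  assumes "t > 0"
  shows "0 < sqrt (1 - exp (- 2 * t))" "sqrt (1 - exp (- 2 * t)) < 1"
    "(exp (- t))\<^sup>2 + (sqrt (1 - exp (- 2 * t)))\<^sup>2 = 1"
proof -
  have "exp (- 2 * t) < 1" "exp (- 2 * t) > 0" using assms by auto
  then show "0 < sqrt (1 - exp (- 2 * t))" "sqrt (1 - exp (- 2 * t)) < 1"
    "(exp (- t))\<^sup>2 + (sqrt (1 - exp (- 2 * t)))\<^sup>2 = 1"
    by (auto simp: exp_double[symmetric])
qed

lemma OU_eq_laplace:
  fixes g :: "real ^ 'n \<Rightarrow> real"
  assumes [measurable]: "g \<in> borel_measurable borel" and t: "t > 0"
  defines "a \<equiv> exp (- t)" and "s \<equiv> sqrt (1 - exp (- 2 * t))"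
  shows "OU t g x = ((1 / sqrt (2 * pi)) ^ CARD('n) / s ^ CARD('n)) * exp ((- (a\<^sup>2 / (2 * s\<^sup>2))) * (norm x)\<^sup>2)
    * laplace (a / s\<^sup>2) (\<lambda>z. exp ((- 1 / (2 * s\<^sup>2)) * (norm z)\<^sup>2) * g z) x"
proof -
  have s: "s > 0" unfolding s_def by (rule OU_coeff[OF t])
  have "OU t g x = (\<integral>z. mehler a s x z * g z \<partial>lborel)"
    unfolding OU_def a_def[symmetric] s_def[symmetric] by (rule integral_mehler[OF assms(1) s])
  also have "\<dots> = (\<integral>z. ((1 / sqrt (2 * pi)) ^ CARD('n) / s ^ CARD('n)) * exp ((- (a\<^sup>2 / (2 * s\<^sup>2))) * (norm x)\<^sup>2)
      * (exp ((- 1 / (2 * s\<^sup>2)) * (norm z)\<^sup>2) * g z * exp ((a / s\<^sup>2) * (x \<bullet> z))) \<partial>lborel)"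
    unfolding mehler_expand[OF s] by (intro Bochner_Integration.integral_cong) auto
  finally show ?thesis unfolding laplace_def by simp
qed

lemma Ck_OU:
  fixes g :: "real ^ 'n \<Rightarrow> real"
  assumes g: "gauss_L2 g" and t: "t > 0"
  shows "Ck k (OU t g)"
  unfolding OU_eq_laplace[OF gauss_L2_measurable[OF g] t, abs_def]
  by (intro Ck_mult Ck_const Ck_exp_norm Ck_laplace exp_integrable_gauss_L2 g OU_coeff t)

text \<open>Integrability at every \<open>x\<close>, not merely almost everywhere, is what allows
  pointwise limits and pointwise derivatives of \<open>OU t g\<close> later on.\<close>

lemma integrable_OU_pos:
  fixes g :: "real ^ 'n \<Rightarrow> real"
  assumes g: "gauss_L2 g" and t: "t > 0"
  shows "integrable gauss (\<lambda>y. g (exp (- t) *\<^sub>R x + sqrt (1 - exp (- 2 * t)) *\<^sub>R y))"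
proof -
  define a s where "a = exp (- t)" and "s = sqrt (1 - exp (- 2 * t))"
  have s: "0 < s" "s < 1" unfolding s_def by (rule OU_coeff[OF t])+
  have "integrable lborel (\<lambda>z. ((1 / sqrt (2 * pi)) ^ CARD('n) / s ^ CARD('n)) * exp ((- (a\<^sup>2 / (2 * s\<^sup>2))) * (norm x)\<^sup>2)
      * (exp ((- 1 / (2 * s\<^sup>2)) * (norm z)\<^sup>2) * g z * exp ((a / s\<^sup>2) * (x \<bullet> z))))"
    by (intro integrable_mult_right integrable_laplace exp_integrable_gauss_L2 g s)
  then have "integrable lborel (\<lambda>z. mehler a s x z * g z)"
    unfolding mehler_expand[OF s(1)] by (simp add: mult_ac)
  then show ?thesis
    unfolding a_def[symmetric] s_def[symmetric]
    using integrable_mehler[OF gauss_L2_measurable[OF g] s(1)] by blast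
qed

lemma OU_measurable [measurable]:
  fixes g :: "real ^ 'n \<Rightarrow> real"
  assumes [measurable]: "g \<in> borel_measurable borel"
  shows "OU t g \<in> borel_measurable borel"
  unfolding OU_def by measurable

section \<open>Contraction of the semigroup in the Gaussian L2 norm\<close>

lemma gauss_square_integral_le:
  fixes g :: "real ^ 'n \<Rightarrow> real"
  assumes "integrable gauss g" "integrable gauss (\<lambda>x. (g x)\<^sup>2)"
  shows "(\<integral>x. g x \<partial>gauss)\<^sup>2 \<le> (\<integral>x. (g x)\<^sup>2 \<partial>gauss)"
  using gauss.variance_eq[OF assms] gauss.variance_positive[of g] by linarith

text \<open>Jensen's inequality at each point, followed by invariance of \<open>gauss\<close> under
  the averaged affine map.\<close>

lemma nn_integral_OU_square_le:
  fixes g :: "real ^ 'n \<Rightarrow> real"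
  assumes g: "gauss_L2 g" and t: "t \<ge> 0"
  shows "(\<integral>\<^sup>+ x. ennreal ((OU t g x)\<^sup>2) \<partial>gauss) \<le> (\<integral>\<^sup>+ x. ennreal ((g x)\<^sup>2) \<partial>gauss)"
proof (cases "t = 0")
  case False
  then have t: "t > 0" using t by simp
  have gm [measurable]: "g \<in> borel_measurable borel" using g by (simp add: gauss_L2_def)
  have "ennreal ((OU t g x)\<^sup>2)
      \<le> (\<integral>\<^sup>+ y. ennreal ((g (exp (- t) *\<^sub>R x + sqrt (1 - exp (- 2 * t)) *\<^sub>R y))\<^sup>2) \<partial>gauss)" for x
  proof (cases "integrable gauss (\<lambda>y. (g (exp (- t) *\<^sub>R x + sqrt (1 - exp (- 2 * t)) *\<^sub>R y))\<^sup>2)")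
    case True
    then show ?thesis
      unfolding OU_def using gauss_square_integral_le[OF integrable_OU_pos[OF g t] True]
      by (subst nn_integral_eq_integral) (auto intro: ennreal_leI)
  next
    \<comment> \<open>At points where the squared integrand is not integrable, the right-hand side
      is infinite and nothing has to be compared.\<close>
    case False
    then have "(\<integral>\<^sup>+ y. ennreal ((g (exp (- t) *\<^sub>R x + sqrt (1 - exp (- 2 * t)) *\<^sub>R y))\<^sup>2) \<partial>gauss) = \<infinity>"
      by (rule contrapos_np) (auto intro!: integrableI_nonneg simp: top.not_eq_extremum)
    then show ?thesis by simp
  qed
  then have "(\<integral>\<^sup>+ x. ennreal ((OU t g x)\<^sup>2) \<partial>gauss)
      \<le> (\<integral>\<^sup>+ x. \<integral>\<^sup>+ y. ennreal ((g (exp (- t) *\<^sub>R x + sqrt (1 - exp (- 2 * t)) *\<^sub>R y))\<^sup>2) \<partial>gauss \<partial>gauss)"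
    by (intro nn_integral_mono) auto
  also have "\<dots> = (\<integral>\<^sup>+ x. ennreal ((g x)\<^sup>2) \<partial>gauss)"
    using nn_integral_gauss_invariant[OF _ OU_coeff(1)[OF t] OU_coeff(3)[OF t], of "\<lambda>z. ennreal ((g z)\<^sup>2)"]
    by simp
  finally show ?thesis .
qed simp

lemma
  fixes g :: "real ^ 'n \<Rightarrow> real"
  assumes g: "gauss_L2 g" and t: "t \<ge> 0"
  shows gauss_L2_OU: "gauss_L2 (OU t g)"
    and integral_OU_square_le: "(\<integral>x. (OU t g x)\<^sup>2 \<partial>gauss) \<le> (\<integral>x. (g x)\<^sup>2 \<partial>gauss)"
proof -
  have [measurable]: "g \<in> borel_measurable borel" using g by (simp add: gauss_L2_def)
  have e: "(\<integral>\<^sup>+ x. ennreal ((g x)\<^sup>2) \<partial>gauss) = ennreal (\<integral>x. (g x)\<^sup>2 \<partial>gauss)"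
    using g by (intro nn_integral_eq_integral) (auto simp: gauss_L2_def)
  have i: "integrable gauss (\<lambda>x. (OU t g x)\<^sup>2)"
    using nn_integral_OU_square_le[OF g t] unfolding e
    by (intro integrableI_nonneg) (auto intro: le_less_trans)
  then show "gauss_L2 (OU t g)" by (simp add: gauss_L2_def)
  have "ennreal (\<integral>x. (OU t g x)\<^sup>2 \<partial>gauss) \<le> ennreal (\<integral>x. (g x)\<^sup>2 \<partial>gauss)"
    using nn_integral_OU_square_le[OF g t] unfolding e
    by (subst (asm) nn_integral_eq_integral[OF i]) auto
  then show "(\<integral>x. (OU t g x)\<^sup>2 \<partial>gauss) \<le> (\<integral>x. (g x)\<^sup>2 \<partial>gauss)"
    by (subst (asm) ennreal_le_iff) auto
qed

subsection \<open>Integration by parts and commutation with derivatives\<close>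

lemma Ck_measurable: "Ck k f \<Longrightarrow> f \<in> borel_measurable borel"
  by (rule borel_measurable_continuous_onI) (rule Ck_continuous)

section \<open>The fundamental theorem of calculus along lines, and its integrated
  consequences\<close>

lemma has_real_derivative_line_scaled:
  fixes f :: "real ^ 'n \<Rightarrow> real"
  assumes "\<And>x. f differentiable (at x)"
  shows "((\<lambda>u. f (x + (c * u) *\<^sub>R axis i 1)) has_real_derivative
    c * partial i f (x + (c * u) *\<^sub>R axis i 1)) (at u)"
proof -
  have "((\<lambda>u. c * u) has_real_derivative c) (at u)"
    by (auto intro!: derivative_eq_intros)
  from DERIV_chain2[OF has_real_derivative_line[OF assms] this]
  show ?thesis by (simp add: mult.commute)
qed

text \<open>Written as a Lebesgue integral with an indicator so that Fubini applies to it; the scale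
  \<open>c\<close> accommodates the factor \<open>exp (- t)\<close> in front of \<open>x\<close> in
  the semigroup.\<close>

lemma integral_partial_line:
  fixes f :: "real ^ 'n \<Rightarrow> real"
  assumes f: "Ck 1 f" and "0 \<le> h"
  shows "(\<integral>u. c * partial i f (x + (c * u) *\<^sub>R axis i 1) * indicator {0..h} u \<partial>lborel)
    = f (x + (c * h) *\<^sub>R axis i 1) - f x"
proof -
  have c: "continuous_on UNIV (partial i f)" using f by simp
  have "continuous_on UNIV (\<lambda>u. c * partial i f (x + (c * u) *\<^sub>R axis i 1))"
    by (intro continuous_on_mult continuous_on_const continuous_on_compose2[OF c] continuous_intros) simp
  then have "isCont (\<lambda>u. c * partial i f (x + (c * u) *\<^sub>R axis i 1)) u" for u
    by (simp add: continuous_on_eq_continuous_at)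
  then show ?thesis
    using integral_FTC_Icc_real[OF assms(2), of "\<lambda>u. f (x + (c * u) *\<^sub>R axis i 1)"
        "\<lambda>u. c * partial i f (x + (c * u) *\<^sub>R axis i 1)"]
      has_real_derivative_line_scaled[of f x c i] f
    by simp
qed

lemma
  fixes f :: "'a :: euclidean_space \<Rightarrow> real"
  assumes [measurable]: "f \<in> borel_measurable borel"
  shows integral_lborel_translate: "(\<integral>x. f (x + c) \<partial>lborel) = (\<integral>x. f x \<partial>lborel)"
    and integrable_lborel_translate: "integrable lborel (\<lambda>x. f (x + c)) \<longleftrightarrow> integrable lborel f"
proof -
  have "(\<integral>x. f x \<partial>distr lborel borel ((+) c)) = (\<integral>x. f (c + x) \<partial>lborel)"
    by (rule integral_distr) auto
  then show "(\<integral>x. f (x + c) \<partial>lborel) = (\<integral>x. f x \<partial>lborel)"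
    by (simp add: lborel_distr_plus add.commute)
  have "integrable (distr lborel borel ((+) c)) f \<longleftrightarrow> integrable lborel (\<lambda>x. f (c + x))"
    by (rule integrable_distr_eq) auto
  then show "integrable lborel (\<lambda>x. f (x + c)) \<longleftrightarrow> integrable lborel f"
    by (simp add: lborel_distr_plus add.commute)
qed

text \<open>Integrate \<open>w (x + e) - w x = \<integral>\<^sub>0\<^sup>1 \<partial>\<^sub>i w (x + u e) du\<close> over \<open>x\<close>: the left-hand side vanishes by
  translation invariance.\<close>

lemma integral_partial_eq_0:
  fixes w :: "real ^ 'n \<Rightarrow> real"
  assumes w: "Ck 1 w" and iw: "integrable lborel w" and ip: "integrable lborel (partial i w)"
  shows "(\<integral>x. partial i w x \<partial>lborel) = 0"
proof -
  define e :: "real ^ 'n" where "e = axis i 1"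
  have cont: "continuous_on UNIV (partial i w)" using w by simp
  have [measurable]: "w \<in> borel_measurable borel" "partial i w \<in> borel_measurable borel"
    using w cont by (auto intro: Ck_measurable[of 1] borel_measurable_continuous_onI)
  let ?F = "\<lambda>u x. partial i w (x + u *\<^sub>R e) * indicator {0..1::real} u"
  have int: "integrable (lborel \<Otimes>\<^sub>M lborel) (case_prod ?F)"
  proof (rule lborel_pair.Fubini_integrable)
    show "case_prod ?F \<in> borel_measurable (lborel \<Otimes>\<^sub>M lborel)" by measurable
    have "(\<integral>x. norm (case (u, x) of (u, x) \<Rightarrow> ?F u x) \<partial>lborel)
        = (\<integral>x. \<bar>partial i w x\<bar> \<partial>lborel) * indicator {0..1} u" for u
      using integral_lborel_translate[of "\<lambda>x. \<bar>partial i w x\<bar>" "u *\<^sub>R e"]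
      by (simp add: abs_mult indicator_def)
    then show "integrable lborel (\<lambda>u. \<integral>x. norm (case (u, x) of (u, x) \<Rightarrow> ?F u x) \<partial>lborel)"
      by simp
    show "AE u in lborel. integrable lborel (\<lambda>x. case (u, x) of (u, x) \<Rightarrow> ?F u x)"
      using ip by (auto simp: integrable_lborel_translate)
  qed
  have "(\<integral>x. \<integral>u. ?F u x \<partial>lborel \<partial>lborel) = (\<integral>x. w (x + e) - w x \<partial>lborel)"
    using integral_partial_line[OF w, of 1 1 i] by (simp add: e_def)
  also have "\<dots> = 0"
    using iw by (subst Bochner_Integration.integral_diff)
      (simp_all add: integral_lborel_translate integrable_lborel_translate)
  finally have "0 = (\<integral>u. \<integral>x. ?F u x \<partial>lborel \<partial>lborel)"
    using lborel_pair.Fubini_integral[OF int] by simp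
  also have "\<dots> = (\<integral>u. (\<integral>x. partial i w x \<partial>lborel) * indicator {0..1::real} u \<partial>lborel)"
    by (simp add: integral_lborel_translate)
  also have "\<dots> = (\<integral>x. partial i w x \<partial>lborel)" by simp
  finally show ?thesis by simp
qed

lemma partial_gauss_density: "partial i gauss_density = (\<lambda>x. - (x $ i * gauss_density x))"
proof
  fix x :: "real ^ 'a"
  have "(gauss_density has_derivative (\<lambda>h. - ((x \<bullet> h) * gauss_density x))) (at x)"
    unfolding gauss_density_def power2_norm_eq_inner
    by (auto intro!: derivative_eq_intros simp: inner_commute)
  from partial_eq[OF this] show "partial i gauss_density x = - (x $ i * gauss_density x)"
    by (simp add: inner_axis)
qed

lemma Ck_gauss_density: "Ck k (gauss_density :: real ^ 'n \<Rightarrow> real)"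
proof -
  have eq: "gauss_density = (\<lambda>x :: real ^ 'n. (1 / sqrt (2 * pi)) ^ CARD('n) * exp ((- 1 / 2) * (norm x)\<^sup>2))"
    by (simp add: gauss_density_def fun_eq_iff)
  show ?thesis unfolding eq by (intro Ck_mult Ck_const Ck_exp_norm)
qed

lemma integrable_gauss_norm: "integrable gauss (\<lambda>x :: real ^ 'n. norm x)"
proof -
  define K :: real where "K = (1 / sqrt (2 * pi)) ^ CARD('n)"
  have K: "K > 0" by (simp add: K_def)
  have "integrable lborel (\<lambda>x :: real ^ 'n. gauss_density x * norm x)"
  proof (rule Bochner_Integration.integrable_bound)
    show "integrable lborel (\<lambda>x :: real ^ 'n. K * exp (- (1 / 4) * (norm x)\<^sup>2))"
      using integrable_exp_norm[of "1 / 4"] by (intro integrable_mult_right) auto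
    have "gauss_density x * norm x \<le> K * exp (- (1 / 4) * (norm x)\<^sup>2)" for x :: "real ^ 'n"
    proof -
      have "norm x \<le> 1 + (norm x)\<^sup>2 / 4"
        using sum_squares_bound[of 1 "norm x / 2"] by (simp add: power_divide)
      also have "\<dots> \<le> exp ((norm x)\<^sup>2 / 4)" by (rule exp_ge_add_one_self)
      finally have "gauss_density x * norm x \<le> gauss_density x * exp ((norm x)\<^sup>2 / 4)"
        by (rule mult_left_mono) simp
      also have "\<dots> = K * exp (- (1 / 4) * (norm x)\<^sup>2)"
        by (simp add: gauss_density_def K_def exp_add[symmetric])
      finally show ?thesis .
    qed
    then show "AE x in lborel. norm (gauss_density x * norm x) \<le> norm (K * exp (- (1 / 4) * (norm (x :: real ^ 'n))\<^sup>2))"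
      using K by simp
  qed simp
  then show ?thesis by (simp add: integrable_gauss)
qed

lemma integrable_gauss_mult_bounded:
  fixes p q :: "real ^ 'n \<Rightarrow> real"
  assumes "integrable gauss p" and [measurable]: "q \<in> borel_measurable borel" and "\<And>x. \<bar>q x\<bar> \<le> C"
  shows "integrable gauss (\<lambda>x. p x * q x)"
proof (rule Bochner_Integration.integrable_bound)
  show "integrable gauss (\<lambda>x. C * p x)" using assms by simp
  have [measurable]: "p \<in> borel_measurable borel"
    using borel_measurable_integrable[OF assms(1)] by simp
  show "(\<lambda>x. p x * q x) \<in> borel_measurable gauss" by simp
  have "\<bar>p x * q x\<bar> \<le> \<bar>C * p x\<bar>" for x
  proof -
    have "\<bar>p x\<bar> * \<bar>q x\<bar> \<le> \<bar>p x\<bar> * C" by (intro mult_left_mono assms) simp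
    also have "\<dots> \<le> \<bar>p x\<bar> * \<bar>C\<bar>" by (intro mult_left_mono) auto
    finally show ?thesis by (simp add: abs_mult mult.commute)
  qed
  then show "AE x in gauss. norm (p x * q x) \<le> norm (C * p x)" by simp
qed

lemma integrable_gauss_bounded:
  fixes q :: "real ^ 'n \<Rightarrow> real"
  assumes "q \<in> borel_measurable borel" "\<And>x. \<bar>q x\<bar> \<le> C"
  shows "integrable gauss q"
  using integrable_gauss_mult_bounded[of "\<lambda>_. 1" q C] assms by simp

lemma integrable_gauss_coord: "integrable gauss (\<lambda>x :: real ^ 'n. x $ i)"
  by (rule Bochner_Integration.integrable_bound[OF integrable_gauss_norm])
     (auto simp: component_le_norm_cart)

text \<open>The integral of a partial derivative of \<open>gauss_density x * u x\<close> vanishes,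
  and differentiating the density produces the factor \<open>- x $ i\<close>. Boundedness of
  \<open>u\<close> and of its derivative supplies the required integrability.\<close>

lemma integral_gauss_by_parts:
  fixes u :: "real ^ 'n \<Rightarrow> real"
  assumes u: "Ck 1 u" and b: "\<And>x. \<bar>u x\<bar> \<le> C" "\<And>x. \<bar>partial i u x\<bar> \<le> C'"
  shows "(\<integral>x. x $ i * u x \<partial>gauss) = (\<integral>x. partial i u x \<partial>gauss)"
proof -
  have um [measurable]: "u \<in> borel_measurable borel" "partial i u \<in> borel_measurable borel"
    using u by (auto intro: Ck_measurable[of 1] borel_measurable_continuous_onI)
  have d: "u differentiable (at x)" "gauss_density differentiable (at x)" for x :: "real ^ 'n"
    using u Ck_gauss_density[of 1, where 'n = 'n] by auto
  define w where "w x = gauss_density x * u x" for x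
  have p: "partial i w = (\<lambda>x. gauss_density x * partial i u x - gauss_density x * (x $ i * u x))"
    unfolding w_def by (rule ext) (simp add: partial_mult[OF d(2,1)] partial_gauss_density)
  have i1: "integrable lborel (\<lambda>x. gauss_density x * partial i u x)"
    using integrable_gauss_bounded[OF um(2) b(2)] by (simp add: integrable_gauss)
  have i2: "integrable lborel (\<lambda>x. gauss_density x * (x $ i * u x))"
    using integrable_gauss_mult_bounded[OF integrable_gauss_coord um(1) b(1), of i]
    by (simp add: integrable_gauss)
  have i3: "integrable lborel w"
    using integrable_gauss_bounded[OF um(1) b(1)] by (simp add: integrable_gauss w_def[abs_def])
  have "Ck 1 w" unfolding w_def by (intro Ck_mult Ck_gauss_density u)
  from integral_partial_eq_0[OF this i3, of i, unfolded p] i1 i2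
  show ?thesis by (simp add: integral_gauss)
qed

lemma
  fixes f :: "real ^ 'n \<Rightarrow> real"
  shows Ck_affine: "Ck k f \<Longrightarrow> Ck k (\<lambda>y. f (c + s *\<^sub>R y))"
    and partial_affine: "(\<And>x. f differentiable (at x)) \<Longrightarrow>
    partial i (\<lambda>y. f (c + s *\<^sub>R y)) = (\<lambda>y. s * partial i f (c + s *\<^sub>R y))"
proof -
  have der: "((\<lambda>y. f (c + s *\<^sub>R y)) has_derivative
      (\<lambda>h. frechet_derivative f (at (c + s *\<^sub>R y)) (s *\<^sub>R h))) (at y)"
    if "\<And>x. f differentiable (at x)" for f :: "real ^ 'n \<Rightarrow> real" and y
  proof -
    have "((\<lambda>y. c + s *\<^sub>R y) has_derivative (\<lambda>h. s *\<^sub>R h)) (at y)"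
      by (auto intro!: derivative_eq_intros)
    from has_derivative_compose[OF this that[THEN frechet_derivative_works[THEN iffD1]]]
    show ?thesis .
  qed
  have lin: "linear (frechet_derivative f (at x))"
    if "\<And>x. f differentiable (at x)" for f :: "real ^ 'n \<Rightarrow> real" and x
    using that by (rule linear_frechet_derivative)
  have p: "partial i (\<lambda>y. f (c + s *\<^sub>R y)) = (\<lambda>y. s * partial i f (c + s *\<^sub>R y))"
    if "\<And>x. f differentiable (at x)" for f :: "real ^ 'n \<Rightarrow> real" and i
    using partial_eq[OF der[OF that]] linear_cmul[OF lin[OF that]]
    by (simp add: fun_eq_iff partial_def)
  then show "(\<And>x. f differentiable (at x)) \<Longrightarrow>
    partial i (\<lambda>y. f (c + s *\<^sub>R y)) = (\<lambda>y. s * partial i f (c + s *\<^sub>R y))"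
    by blast
  show "Ck k f \<Longrightarrow> Ck k (\<lambda>y. f (c + s *\<^sub>R y))"
  proof (induction k arbitrary: f)
    case 0
    then show ?case
      by (auto intro!: continuous_intros continuous_on_compose2[of UNIV f])
  next
    case (Suc k)
    then have d: "\<And>x. f differentiable (at x)" by simp
    have "(\<lambda>y. f (c + s *\<^sub>R y)) differentiable (at y)" for y
      using der[OF d] by (auto simp: differentiable_def)
    moreover have "Ck k (partial i (\<lambda>y. f (c + s *\<^sub>R y)))" for i
      unfolding p[OF d] using Suc by (intro Ck_mult Ck_const Suc.IH) auto
    ultimately show ?case by simp
  qed
qed

text \<open>No locally uniform bound on \<open>partial i f\<close> along the paths is available for
  differentiation under the integral. Increments of \<open>OU t f\<close> are instead written by the
  fundamental theorem and Fubini as line integrals of \<open>OU t (partial i f)\<close>, whose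
  integrand is continuous by the smoothing of the semigroup.\<close>

lemma partial_OU:
  fixes f :: "real ^ 'n \<Rightarrow> real"
  assumes f: "Ck 1 f" and L: "gauss_L2 f" "gauss_L2 (partial i f)" and t: "t > 0"
  shows "partial i (OU t f) = (\<lambda>x. exp (- t) * OU t (partial i f) x)"
proof
  fix x :: "real ^ 'n"
  define a s where "a = exp (- t)" and "s = sqrt (1 - exp (- 2 * t))"
  define e :: "real ^ 'n" where "e = axis i 1"
  have [measurable]: "f \<in> borel_measurable borel" "partial i f \<in> borel_measurable borel"
    using L by (auto simp: gauss_L2_def)
  \<comment> \<open>The semigroup applied to this absolute value is continuous, hence integrable
    over a bounded segment; that is the hypothesis of Fubini below.\<close>
  have L': "gauss_L2 (\<lambda>x. \<bar>partial i f x\<bar>)"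
    by (rule gauss_L2_bound[OF L(2)]) auto
  have cont: "continuous_on UNIV (\<lambda>u. OU t g (x + u *\<^sub>R e))" if "gauss_L2 g" for g
    using Ck_continuous[OF Ck_OU[OF that t, of 0]]
    by (auto intro!: continuous_intros continuous_on_compose2[of UNIV "OU t g"])
  interpret P: pair_sigma_finite "lborel :: real measure" "gauss :: (real ^ 'n) measure" ..
  have FTC: "OU t f (x + h *\<^sub>R e) - OU t f x = integral {0..h} (\<lambda>u. a * OU t (partial i f) (x + u *\<^sub>R e))"
    if h: "h \<ge> 0" for h
  proof -
    let ?F = "\<lambda>u y. a * partial i f (a *\<^sub>R (x + u *\<^sub>R e) + s *\<^sub>R y) * indicator {0..h} u"
    have int: "integrable (lborel \<Otimes>\<^sub>M gauss) (case_prod ?F)"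
    proof (rule P.Fubini_integrable)
      show "case_prod ?F \<in> borel_measurable (lborel \<Otimes>\<^sub>M gauss)" by measurable
      have "(\<integral>y. norm (case (u, y) of (u, y) \<Rightarrow> ?F u y) \<partial>gauss)
          = a * OU t (\<lambda>x. \<bar>partial i f x\<bar>) (x + u *\<^sub>R e) * indicator {0..h} u" for u
        unfolding OU_def a_def[symmetric] s_def[symmetric]
        by (simp add: abs_mult a_def indicator_def)
      moreover have "integrable lborel (\<lambda>u. a * OU t (\<lambda>x. \<bar>partial i f x\<bar>) (x + u *\<^sub>R e) * indicator {0..h} u)"
        using cont[OF L']
        by (intro borel_integrable_atLeastAtMost) (auto simp: continuous_on_eq_continuous_at)
      ultimately show "integrable lborel (\<lambda>u. \<integral>y. norm (case (u, y) of (u, y) \<Rightarrow> ?F u y) \<partial>gauss)"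
        by simp
      show "AE u in lborel. integrable gauss (\<lambda>y. case (u, y) of (u, y) \<Rightarrow> ?F u y)"
        using integrable_OU_pos[OF L(2) t] by (auto simp: a_def s_def)
    qed
    have 1: "(\<integral>u. ?F u y \<partial>lborel) = f (a *\<^sub>R (x + h *\<^sub>R e) + s *\<^sub>R y) - f (a *\<^sub>R x + s *\<^sub>R y)" for y
      using integral_partial_line[OF f h, of a i "a *\<^sub>R x + s *\<^sub>R y"]
      by (simp add: e_def algebra_simps)
    have "OU t f (x + h *\<^sub>R e) - OU t f x = (\<integral>y. \<integral>u. ?F u y \<partial>lborel \<partial>gauss)"
      unfolding 1 unfolding OU_def a_def s_def
      by (rule Bochner_Integration.integral_diff[symmetric]) (rule integrable_OU_pos[OF L(1) t])+
    also have "\<dots> = (\<integral>u. \<integral>y. ?F u y \<partial>gauss \<partial>lborel)"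
      by (rule P.Fubini_integral[OF int])
    also have "\<dots> = (\<integral>u. indicator {0..h} u *\<^sub>R (a * OU t (partial i f) (x + u *\<^sub>R e)) \<partial>lborel)"
      unfolding OU_def a_def[symmetric] s_def[symmetric]
      by (intro Bochner_Integration.integral_cong) (auto simp: indicator_def)
    also have "\<dots> = integral {0..h} (\<lambda>u. a * OU t (partial i f) (x + u *\<^sub>R e))"
    proof (rule set_borel_integral_eq_integral(2)[unfolded set_lebesgue_integral_def])
      show "set_integrable lborel {0..h} (\<lambda>u. a * OU t (partial i f) (x + u *\<^sub>R e))"
        by (rule borel_integrable_atLeastAtMost')
           (auto intro!: continuous_intros continuous_on_subset[OF cont[OF L(2)]])
    qed
    finally show ?thesis .
  qed
  \<comment> \<open>A one-sided derivative at 0 suffices: \<open>OU t f\<close> is already known to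
    be differentiable, so the derivative within \<open>{0..1}\<close> determines its partial
    derivative.\<close>
  have "((\<lambda>h. integral {0..h} (\<lambda>u. a * OU t (partial i f) (x + u *\<^sub>R e)))
      has_real_derivative a * OU t (partial i f) (x + 0 *\<^sub>R e)) (at 0 within {0..1})"
    by (rule integral_has_real_derivative)
       (auto intro!: continuous_intros continuous_on_subset[OF cont[OF L(2)]])
  then have "((\<lambda>h. OU t f (x + h *\<^sub>R e) - OU t f x)
      has_real_derivative a * OU t (partial i f) (x + 0 *\<^sub>R e)) (at 0 within {0..1})"
    by (rule has_field_derivative_transform_within[of _ _ _ _ 1]) (auto simp: FTC)
  moreover have "((\<lambda>h. OU t f (x + h *\<^sub>R e) - OU t f x)
      has_real_derivative partial i (OU t f) (x + 0 *\<^sub>R e)) (at 0 within {0..1})"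
  proof -
    have "\<And>x. OU t f differentiable (at x)" using Ck_OU[OF L(1) t, of 1] by simp
    from has_real_derivative_line[OF this, of x i 0]
    have "((\<lambda>h. OU t f (x + h *\<^sub>R e) - OU t f x)
      has_real_derivative partial i (OU t f) (x + 0 *\<^sub>R e) - 0) (at 0)"
      unfolding e_def by (intro derivative_intros)
    then show ?thesis by (auto intro: DERIV_subset)
  qed
  ultimately have "a * OU t (partial i f) (x + 0 *\<^sub>R e) = partial i (OU t f) (x + 0 *\<^sub>R e)"
    unfolding has_real_derivative_iff_has_vector_derivative
    by (intro vector_derivative_unique_within) (auto simp: trivial_limit_within islimpt_Icc)
  then show "partial i (OU t f) x = exp (- t) * OU t (partial i f) x"
    by (simp add: a_def)
qed

subsection \<open>Dissipation of the energy\<close>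

text \<open>The mean value inequality turns the bound on \<open>F'\<close> into the same bound on
  difference quotients, so dominated convergence applies along every sequence tending to
  \<open>t0\<close>.\<close>

lemma has_real_derivative_integral_dominated:
  fixes F :: "real \<Rightarrow> 'a \<Rightarrow> real"
  assumes \<delta>: "\<delta> > 0"
    and int: "\<And>t. \<bar>t - t0\<bar> < \<delta> \<Longrightarrow> integrable M (F t)"
    and der: "\<And>t x. \<bar>t - t0\<bar> < \<delta> \<Longrightarrow> x \<in> space M \<Longrightarrow> ((\<lambda>t. F t x) has_real_derivative F' t x) (at t)"
    and bound: "\<And>t x. \<bar>t - t0\<bar> < \<delta> \<Longrightarrow> x \<in> space M \<Longrightarrow> \<bar>F' t x\<bar> \<le> w x"
    and w: "integrable M w"
    and meas: "F' t0 \<in> borel_measurable M"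
  shows "((\<lambda>t. \<integral>x. F t x \<partial>M) has_real_derivative (\<integral>x. F' t0 x \<partial>M)) (at t0)"
proof -
  have "((\<lambda>t. ((\<integral>x. F t x \<partial>M) - (\<integral>x. F t0 x \<partial>M)) / (t - t0)) \<longlongrightarrow> (\<integral>x. F' t0 x \<partial>M)) (at t0)"
    unfolding tendsto_at_iff_sequentially
  proof (intro allI impI)
    fix X :: "nat \<Rightarrow> real" assume X: "\<forall>i. X i \<in> UNIV - {t0}" "X \<longlonglongrightarrow> t0"
    obtain N where N: "\<And>n. n \<ge> N \<Longrightarrow> \<bar>X n - t0\<bar> < \<delta>"
      using X(2) \<delta> unfolding lim_sequentially dist_real_def by blast
    define Y where "Y n = X (n + N)" for n
    have Y: "Y \<longlonglongrightarrow> t0" "\<And>n. Y n \<noteq> t0" "\<And>n. \<bar>Y n - t0\<bar> < \<delta>"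
      using X N LIMSEQ_ignore_initial_segment[OF X(2), of N] by (auto simp: Y_def[abs_def])
    have "(\<lambda>n. \<integral>x. (F (Y n) x - F t0 x) / (Y n - t0) \<partial>M) \<longlonglongrightarrow> (\<integral>x. F' t0 x \<partial>M)"
    proof (rule integral_dominated_convergence[OF meas _ w])
      show "(\<lambda>x. (F (Y n) x - F t0 x) / (Y n - t0)) \<in> borel_measurable M" for n
        using borel_measurable_integrable[OF int[OF Y(3)[of n]]]
          borel_measurable_integrable[OF int[of t0]] \<delta>
        by (intro borel_measurable_divide borel_measurable_diff) auto
      show "AE x in M. (\<lambda>n. (F (Y n) x - F t0 x) / (Y n - t0)) \<longlonglongrightarrow> F' t0 x"
      proof (intro AE_I2)
        fix x assume x: "x \<in> space M"
        have "((\<lambda>t. (F t x - F t0 x) / (t - t0)) \<longlongrightarrow> F' t0 x) (at t0)"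
          using der[of t0 x] \<delta> x by (simp add: has_field_derivative_iff)
        then have "((\<lambda>t. (F t x - F t0 x) / (t - t0)) \<circ> Y) \<longlonglongrightarrow> F' t0 x"
          using Y(1,2) unfolding tendsto_at_iff_sequentially by auto
        then show "(\<lambda>n. (F (Y n) x - F t0 x) / (Y n - t0)) \<longlonglongrightarrow> F' t0 x"
          by (simp add: o_def)
      qed
      show "AE x in M. norm ((F (Y n) x - F t0 x) / (Y n - t0)) \<le> w x" for n
      proof (intro AE_I2)
        fix x assume x: "x \<in> space M"
        have "norm (F (Y n) x - F t0 x) \<le> w x * norm (Y n - t0)"
        proof (rule field_differentiable_bound[of "ball t0 \<delta>"])
          show "((\<lambda>t. F t x) has_field_derivative F' t x) (at t within ball t0 \<delta>)" if "t \<in> ball t0 \<delta>" for t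
            using der[of t x] x that by (auto simp: dist_real_def abs_minus_commute intro: DERIV_subset)
          show "norm (F' t x) \<le> w x" if "t \<in> ball t0 \<delta>" for t
            using bound[of t x] x that by (auto simp: dist_real_def abs_minus_commute)
        qed (use \<delta> Y(3)[of n] in \<open>auto simp: dist_real_def abs_minus_commute\<close>)
        then show "norm ((F (Y n) x - F t0 x) / (Y n - t0)) \<le> w x"
          using Y(2)[of n] by (simp add: divide_le_eq)
      qed
    qed
    moreover have "(\<integral>x. (F (Y n) x - F t0 x) / (Y n - t0) \<partial>M)
        = ((\<integral>x. F (Y n) x \<partial>M) - (\<integral>x. F t0 x \<partial>M)) / (Y n - t0)" for n
      using int[OF Y(3)[of n]] int[of t0] \<delta> by simp
    ultimately have "(\<lambda>n. ((\<integral>x. F (X (n + N)) x \<partial>M) - (\<integral>x. F t0 x \<partial>M)) / (X (n + N) - t0)) \<longlonglongrightarrow> (\<integral>x. F' t0 x \<partial>M)"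
      by (simp only: Y_def)
    then have "(\<lambda>n. ((\<integral>x. F (X n) x \<partial>M) - (\<integral>x. F t0 x \<partial>M)) / (X n - t0)) \<longlonglongrightarrow> (\<integral>x. F' t0 x \<partial>M)"
      by (rule LIMSEQ_offset)
    then show "((\<lambda>t. ((\<integral>x. F t x \<partial>M) - (\<integral>x. F t0 x \<partial>M)) / (t - t0)) \<circ> X) \<longlonglongrightarrow> (\<integral>x. F' t0 x \<partial>M)"
      by (simp add: o_def)
  qed
  then show ?thesis by (simp add: has_field_derivative_iff)
qed

lemma gauss_L2_bounded:
  fixes g :: "real ^ 'n \<Rightarrow> real"
  assumes [measurable]: "g \<in> borel_measurable borel" and "\<And>x. \<bar>g x\<bar> \<le> C"
  shows "gauss_L2 g"
proof -
  have "integrable gauss (\<lambda>x. (g x)\<^sup>2)"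
  proof (rule integrable_gauss_bounded)
    show "\<bar>(g x)\<^sup>2\<bar> \<le> C\<^sup>2" for x
      using power_mono[OF assms(2), of x 2] by simp
  qed simp
  then show ?thesis by (simp add: gauss_L2_def)
qed

lemma abs_OU_le:
  fixes g :: "real ^ 'n \<Rightarrow> real"
  assumes [measurable]: "g \<in> borel_measurable borel" and b: "\<And>x. \<bar>g x\<bar> \<le> C"
  shows "\<bar>OU t g x\<bar> \<le> C"
proof -
  let ?h = "\<lambda>y. g (exp (- t) *\<^sub>R x + sqrt (1 - exp (- 2 * t)) *\<^sub>R y)"
  have i: "integrable gauss (\<lambda>y. \<bar>?h y\<bar>)"
    using b by (intro integrable_gauss_bounded[of _ C]) auto
  have "\<bar>OU t g x\<bar> \<le> (\<integral>y. \<bar>?h y\<bar> \<partial>gauss)"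
    unfolding OU_def by (rule integral_abs_bound)
  also have "\<dots> \<le> C"
    using b by (intro gauss.integral_le_const i) auto
  finally show ?thesis .
qed

lemma has_real_derivative_OU_path:
  fixes g :: "real ^ 'n \<Rightarrow> real"
  assumes g: "\<And>x. g differentiable (at x)" and t: "t > 0"
  defines "a \<equiv> \<lambda>t. exp (- t :: real)" and "s \<equiv> \<lambda>t. sqrt (1 - exp (- 2 * t :: real))"
  shows "((\<lambda>t. g (a t *\<^sub>R x + s t *\<^sub>R y)) has_real_derivative
    (\<Sum>i\<in>UNIV. partial i g (a t *\<^sub>R x + s t *\<^sub>R y) * (- a t * x $ i + (a t)\<^sup>2 / s t * y $ i))) (at t)"
proof -
  have s: "s t > 0" unfolding s_def by (rule OU_coeff[OF t])
  have s2: "1 - exp (- 2 * t) > 0" using t by simp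
  \<comment> \<open>Differentiating \<open>a^2 + s^2 = 1\<close> with \<open>a' = - a\<close> gives
    \<open>s' = a^2 / s\<close>.\<close>
  have ds: "(s has_real_derivative (a t)\<^sup>2 / s t) (at t)"
    unfolding s_def a_def using s2
    by (auto intro!: derivative_eq_intros simp: exp_double[symmetric] field_simps)
  have da: "(a has_real_derivative - a t) (at t)"
    unfolding a_def by (auto intro!: derivative_eq_intros)
  have "((\<lambda>t. a t *\<^sub>R x + s t *\<^sub>R y) has_derivative
      (\<lambda>h. (h * - a t) *\<^sub>R x + (h * ((a t)\<^sup>2 / s t)) *\<^sub>R y)) (at t)"
    using da ds unfolding has_field_derivative_def
    by (auto intro!: derivative_eq_intros simp: mult.commute)
  from has_derivative_compose[OF this has_derivative_partial[OF g]]
  have "((\<lambda>t. g (a t *\<^sub>R x + s t *\<^sub>R y)) has_derivative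
      (\<lambda>h. \<Sum>i\<in>UNIV. ((h * - a t) *\<^sub>R x + (h * ((a t)\<^sup>2 / s t)) *\<^sub>R y) $ i
        * partial i g (a t *\<^sub>R x + s t *\<^sub>R y))) (at t)" .
  moreover have "(\<lambda>h. \<Sum>i\<in>UNIV. ((h * - a t) *\<^sub>R x + (h * ((a t)\<^sup>2 / s t)) *\<^sub>R y) $ i
        * partial i g (a t *\<^sub>R x + s t *\<^sub>R y))
      = (*) (\<Sum>i\<in>UNIV. partial i g (a t *\<^sub>R x + s t *\<^sub>R y) * (- a t * x $ i + (a t)\<^sup>2 / s t * y $ i))"
    by (rule ext) (simp add: sum_distrib_right sum_distrib_left algebra_simps)
  ultimately show ?thesis by (simp only: has_field_derivative_def)
qed

lemma abs_sum_le_card: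
  fixes F :: "'n :: finite \<Rightarrow> real"
  assumes "\<And>i. \<bar>F i\<bar> \<le> K"
  shows "\<bar>\<Sum>i\<in>UNIV. F i\<bar> \<le> real CARD('n) * K"
proof -
  have "\<bar>\<Sum>i\<in>UNIV. F i\<bar> \<le> (\<Sum>i\<in>UNIV. \<bar>F i\<bar>)" by (rule sum_abs)
  also have "\<dots> \<le> real CARD('n) * K" using assms by (intro sum_bounded_above) auto
  finally show ?thesis .
qed

text \<open>Only pure second derivatives are bounded, since the second-order part in the time
  derivative of the semigroup is a Laplacian.\<close>

definition Ck2_bounded :: "real \<Rightarrow> (real ^ 'n \<Rightarrow> real) \<Rightarrow> bool" where
  "Ck2_bounded C g \<longleftrightarrow> Ck 2 g \<and> (\<forall>x. \<bar>g x\<bar> \<le> C) \<and> (\<forall>i x. \<bar>partial i g x\<bar> \<le> C)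
     \<and> (\<forall>i x. \<bar>partial i (partial i g) x\<bar> \<le> C)"

lemma Ck2_boundedD:
  assumes "Ck2_bounded C g"
  shows "Ck 2 g" "\<And>x. g differentiable (at x)" "\<And>i. Ck 1 (partial i g)" "\<And>i x. partial i g differentiable (at x)"
    "\<bar>g x\<bar> \<le> C" "\<bar>partial i g x\<bar> \<le> C" "\<bar>partial i (partial i g) x\<bar> \<le> C" "0 \<le> C"
    "g \<in> borel_measurable borel" "partial i g \<in> borel_measurable borel"
    "partial i (partial i g) \<in> borel_measurable borel"
    "gauss_L2 g" "gauss_L2 (partial i g)" "gauss_L2 (partial i (partial i g))"
proof -
  show c: "Ck 2 g" and d: "\<And>x. g differentiable (at x)" and c1: "\<And>i. Ck 1 (partial i g)"
    and "\<And>i x. partial i g differentiable (at x)"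
    using assms by (auto simp: Ck2_bounded_def numeral_2_eq_2)
  have b: "\<And>x. \<bar>g x\<bar> \<le> C" "\<And>x i. \<bar>partial i g x\<bar> \<le> C" "\<And>x i. \<bar>partial i (partial i g) x\<bar> \<le> C"
    using assms by (auto simp: Ck2_bounded_def)
  then show "\<bar>g x\<bar> \<le> C" "\<bar>partial i g x\<bar> \<le> C" "\<bar>partial i (partial i g) x\<bar> \<le> C" by auto
  show "0 \<le> C" using b(1) abs_ge_zero order_trans by blast
  have c0: "Ck 0 (partial i (partial i g))" for i
    using c1[of i] by simp
  show m: "g \<in> borel_measurable borel" "partial i g \<in> borel_measurable borel"
    "partial i (partial i g) \<in> borel_measurable borel" for i
    using Ck_measurable[OF c] Ck_measurable[OF c1] Ck_measurable[OF c0] by auto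
  show "gauss_L2 g" "gauss_L2 (partial i g)" "gauss_L2 (partial i (partial i g))"
    using gauss_L2_bounded[OF m(1) b(1)] gauss_L2_bounded[OF m(2) b(2)] gauss_L2_bounded[OF m(3) b(3)] by auto
qed

text \<open>The path derivative contains \<open>y $ i\<close> with the coefficient
  \<open>a^2 / s\<close>. Gaussian integration by parts in \<open>y\<close> exchanges
  \<open>y $ i\<close> for a further derivative and a factor \<open>s\<close>, which cancels the
  denominator.\<close>

lemma has_real_derivative_OU:
  fixes g :: "real ^ 'n \<Rightarrow> real"
  assumes g: "Ck2_bounded C g" and t: "t > 0"
  shows "((\<lambda>t. OU t g x) has_real_derivative
    (\<Sum>i\<in>UNIV. - exp (- t) * x $ i * OU t (partial i g) x + (exp (- t))\<^sup>2 * OU t (partial i (partial i g)) x)) (at t)"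
proof -
  note gD = Ck2_boundedD[OF g]
  note [measurable] = gD(9-11)
  define a where "a = (\<lambda>t. exp (- t :: real))"
  define s where "s = (\<lambda>t. sqrt (1 - exp (- 2 * t :: real)))"
  define F' where "F' t y = (\<Sum>i\<in>UNIV. partial i g (a t *\<^sub>R x + s t *\<^sub>R y)
    * (- a t * x $ i + (a t)\<^sup>2 / s t * y $ i))" for t y
  \<comment> \<open>Times within \<open>t / 2\<close> of \<open>t\<close> stay above
    \<open>t / 2\<close>, so \<open>K\<close> bounds \<open>1 / s\<close> uniformly there although
    it blows up at time 0.\<close>
  define K where "K = 1 / s (t / 2)"
  have s: "s u > 0" if "u > 0" for u unfolding s_def using OU_coeff[OF that] by simp
  have K: "K > 0" using s[of "t / 2"] t by (simp add: K_def)
  have au: "0 < a u" for u by (simp add: a_def)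
  have a1: "a u \<le> 1" if "u > 0" for u using that by (simp add: a_def)
  have m: "F' t \<in> borel_measurable gauss" unfolding F'_def by measurable
  have "((\<lambda>t. \<integral>y. g (a t *\<^sub>R x + s t *\<^sub>R y) \<partial>gauss) has_real_derivative (\<integral>y. F' t y \<partial>gauss)) (at t)"
  proof (rule has_real_derivative_integral_dominated[of "t / 2" _ _ _ _ "\<lambda>y. real CARD('n) * (C * (norm x + K * norm y))"])
    show "t / 2 > 0" using t by simp
    fix u :: real assume "\<bar>u - t\<bar> < t / 2"
    then have u: "u > t / 2" "u > 0" using t by linarith+
    show "integrable gauss (\<lambda>y. g (a u *\<^sub>R x + s u *\<^sub>R y))"
      using gD(5) by (intro integrable_gauss_bounded[of _ C]) auto
    fix y :: "real ^ 'n"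
    show "((\<lambda>t. g (a t *\<^sub>R x + s t *\<^sub>R y)) has_real_derivative F' u y) (at u)"
      unfolding F'_def a_def s_def by (rule has_real_derivative_OU_path[OF gD(2) u(2)])
    have "s (t / 2) \<le> s u" unfolding s_def using u by simp
    then have Ku: "1 / s u \<le> K"
      unfolding K_def using s[of "t / 2"] t by (intro divide_left_mono) auto
    have as: "(a u)\<^sup>2 / s u \<le> K"
    proof -
      have "(a u)\<^sup>2 \<le> 1" using a1[OF u(2)] au[of u] by (simp add: power_le_one)
      then have "(a u)\<^sup>2 / s u \<le> 1 / s u" using s[OF u(2)] by (intro divide_right_mono) auto
      with Ku show ?thesis by linarith
    qed
    have "\<bar>partial i g (a u *\<^sub>R x + s u *\<^sub>R y) * (- a u * x $ i + (a u)\<^sup>2 / s u * y $ i)\<bar>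
        \<le> C * (norm x + K * norm y)" for i
    proof -
      have "\<bar>- a u * x $ i + (a u)\<^sup>2 / s u * y $ i\<bar> \<le> \<bar>- a u * x $ i\<bar> + \<bar>(a u)\<^sup>2 / s u * y $ i\<bar>"
        by (rule abs_triangle_ineq)
      also have "\<dots> = a u * \<bar>x $ i\<bar> + (a u)\<^sup>2 / s u * \<bar>y $ i\<bar>"
        using au[of u] s[OF u(2)] by (simp add: abs_mult)
      also have "\<dots> \<le> 1 * norm x + K * norm y"
        using as a1[OF u(2)] au[of u] s[OF u(2)] K
        by (intro add_mono mult_mono component_le_norm_cart) auto
      finally show ?thesis
        unfolding abs_mult using gD(6,8) by (intro mult_mono) auto
    qed
    then show "\<bar>F' u y\<bar> \<le> real CARD('n) * (C * (norm x + K * norm y))"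
      unfolding F'_def by (rule abs_sum_le_card)
  next
    show "integrable gauss (\<lambda>y :: real ^ 'n. real CARD('n) * (C * (norm x + K * norm y)))"
      using integrable_gauss_norm
      by (intro integrable_mult_right Bochner_Integration.integrable_add) auto
  qed (rule m)
  moreover have "(\<integral>y. F' t y \<partial>gauss) = (\<Sum>i\<in>UNIV. - a t * x $ i * OU t (partial i g) x
      + (a t)\<^sup>2 * OU t (partial i (partial i g)) x)"
  proof -
    have i1: "integrable gauss (\<lambda>y. partial i g (a t *\<^sub>R x + s t *\<^sub>R y))" for i
      using gD(6) by (intro integrable_gauss_bounded[of _ C]) auto
    have i2: "integrable gauss (\<lambda>y. y $ i * partial i g (a t *\<^sub>R x + s t *\<^sub>R y))" for i
      using gD(6) by (intro integrable_gauss_mult_bounded[OF integrable_gauss_coord, of _ C]) auto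
    have ibp: "(\<integral>y. y $ i * partial i g (a t *\<^sub>R x + s t *\<^sub>R y) \<partial>gauss)
        = s t * OU t (partial i (partial i g)) x" for i
    proof -
      have p: "partial i (\<lambda>y. partial i g (a t *\<^sub>R x + s t *\<^sub>R y))
          = (\<lambda>y. s t * partial i (partial i g) (a t *\<^sub>R x + s t *\<^sub>R y))"
        by (rule partial_affine[OF gD(4)])
      have "(\<integral>y. y $ i * partial i g (a t *\<^sub>R x + s t *\<^sub>R y) \<partial>gauss)
          = (\<integral>y. partial i (\<lambda>y. partial i g (a t *\<^sub>R x + s t *\<^sub>R y)) y \<partial>gauss)"
      proof (rule integral_gauss_by_parts)
        show "Ck 1 (\<lambda>y. partial i g (a t *\<^sub>R x + s t *\<^sub>R y))" by (rule Ck_affine[OF gD(3)])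
        show "\<bar>partial i (\<lambda>y. partial i g (a t *\<^sub>R x + s t *\<^sub>R y)) y\<bar> \<le> s t * C" for y
          unfolding p using gD(7) s[OF t] by (auto simp: abs_mult)
      qed (rule gD(6))
      then show ?thesis unfolding p by (simp add: OU_def a_def s_def)
    qed
    have e: "F' t y = (\<Sum>i\<in>UNIV. - a t * x $ i * partial i g (a t *\<^sub>R x + s t *\<^sub>R y)
        + (a t)\<^sup>2 / s t * (y $ i * partial i g (a t *\<^sub>R x + s t *\<^sub>R y)))" for y
      unfolding F'_def by (intro sum.cong refl) (simp add: algebra_simps)
    have "(\<integral>y. F' t y \<partial>gauss) = (\<Sum>i\<in>UNIV. - a t * x $ i * (\<integral>y. partial i g (a t *\<^sub>R x + s t *\<^sub>R y) \<partial>gauss)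
        + (a t)\<^sup>2 / s t * (\<integral>y. y $ i * partial i g (a t *\<^sub>R x + s t *\<^sub>R y) \<partial>gauss))"
      unfolding e using i1 i2 by (subst Bochner_Integration.integral_sum) auto
    also have "\<dots> = (\<Sum>i\<in>UNIV. - a t * x $ i * OU t (partial i g) x
      + (a t)\<^sup>2 * OU t (partial i (partial i g)) x)"
      unfolding ibp using s[OF t] by (simp add: OU_def a_def s_def)
    finally show ?thesis .
  qed
  ultimately show ?thesis unfolding OU_def a_def s_def by simp
qed

text \<open>The quantity written \<open>c(g, t)\<close> in the overview.\<close>

definition OU_energy :: "(real ^ 'n \<Rightarrow> real) \<Rightarrow> real \<Rightarrow> real" where
  "OU_energy g t = (\<integral>x. (OU t g x)\<^sup>2 \<partial>gauss)"

text \<open>Differentiating the square gives a drift term and a second-order term. Integration by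
  parts of the drift term, with each derivative of the semigroup costing \<open>exp (- t)\<close>,
  cancels the second-order term and leaves the energies of the first derivatives.\<close>

lemma has_real_derivative_OU_energy:
  fixes g :: "real ^ 'n \<Rightarrow> real"
  assumes g: "Ck2_bounded C g" and t: "t > 0"
  shows "(OU_energy g has_real_derivative
    - (2 * exp (- 2 * t) * (\<Sum>i\<in>UNIV. OU_energy (partial i g) t))) (at t)"
proof -
  note gD = Ck2_boundedD[OF g]
  note [measurable] = gD(9-11)
  define a where "a = (\<lambda>t. exp (- t :: real))"
  have au: "0 < a u" for u by (simp add: a_def)
  have a1: "a u \<le> 1" if "u > 0" for u using that by (simp add: a_def)
  have OUb: "\<bar>OU u g x\<bar> \<le> C" "\<bar>OU u (partial i g) x\<bar> \<le> C" "\<bar>OU u (partial i (partial i g)) x\<bar> \<le> C" for u x i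
    using gD(5-7,9-11) by (auto intro!: abs_OU_le)
  have C: "C \<ge> 0" by (rule gD(8))
  define D where "D t x = (\<Sum>i\<in>UNIV. - a t * x $ i * OU t (partial i g) x + (a t)\<^sup>2 * OU t (partial i (partial i g)) x)"
    for t x
  have "((\<lambda>t. \<integral>x. (OU t g x)\<^sup>2 \<partial>gauss) has_real_derivative (\<integral>x. 2 * OU t g x * D t x \<partial>gauss)) (at t)"
  proof (rule has_real_derivative_integral_dominated[of t _ _ _ _ "\<lambda>x. 2 * C * (real CARD('n) * (C * (norm x + 1)))"])
    show "t > 0" by (rule t)
    fix u :: real assume "\<bar>u - t\<bar> < t"
    then have u: "u > 0" using t by (auto simp: abs_less_iff)
    show "integrable gauss (\<lambda>x. (OU u g x)\<^sup>2)"
      using gauss_L2_OU[OF gD(12), of u] u by (simp add: gauss_L2_def)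
    fix x :: "real ^ 'n"
    show "((\<lambda>t. (OU t g x)\<^sup>2) has_real_derivative 2 * OU u g x * D u x) (at u)"
      using has_real_derivative_OU[OF g u, of x] unfolding D_def a_def
      by (auto intro!: derivative_eq_intros)
    have "\<bar>- a u * x $ i * OU u (partial i g) x + (a u)\<^sup>2 * OU u (partial i (partial i g)) x\<bar> \<le> C * (norm x + 1)" for i
    proof -
      have "\<bar>- a u * x $ i * OU u (partial i g) x + (a u)\<^sup>2 * OU u (partial i (partial i g)) x\<bar>
          \<le> a u * \<bar>x $ i\<bar> * \<bar>OU u (partial i g) x\<bar> + (a u)\<^sup>2 * \<bar>OU u (partial i (partial i g)) x\<bar>"
        using abs_triangle_ineq[of "- a u * x $ i * OU u (partial i g) x" "(a u)\<^sup>2 * OU u (partial i (partial i g)) x"]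
          au[of u] by (simp add: abs_mult)
      also have "\<dots> \<le> 1 * norm x * C + 1 * C"
        using a1[OF u] au[of u] OUb C
        by (intro add_mono mult_mono component_le_norm_cart power_le_one) auto
      finally show ?thesis by (simp add: algebra_simps)
    qed
    then have "\<bar>D u x\<bar> \<le> real CARD('n) * (C * (norm x + 1))"
      unfolding D_def by (rule abs_sum_le_card)
    then show "\<bar>2 * OU u g x * D u x\<bar> \<le> 2 * C * (real CARD('n) * (C * (norm x + 1)))"
      unfolding abs_mult using OUb(1) C by (intro mult_mono) auto
  next
    show "integrable gauss (\<lambda>x :: real ^ 'n. 2 * C * (real CARD('n) * (C * (norm x + 1))))"
      using integrable_gauss_norm
      by (intro integrable_mult_right Bochner_Integration.integrable_add) auto
    show "(\<lambda>x. 2 * OU t g x * D t x) \<in> borel_measurable gauss"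
      unfolding D_def by measurable
  qed
  moreover have "(\<integral>x. 2 * OU t g x * D t x \<partial>gauss)
      = - (2 * exp (- 2 * t) * (\<Sum>i\<in>UNIV. OU_energy (partial i g) t))"
  proof -
    have i1: "integrable gauss (\<lambda>x. x $ i * (OU t g x * OU t (partial i g) x))" for i
      using OUb C by (intro integrable_gauss_mult_bounded[OF integrable_gauss_coord, of _ "C * C"])
        (auto simp: abs_mult intro!: mult_mono)
    have i2: "integrable gauss (\<lambda>x. OU t g x * OU t (partial i (partial i g)) x)" for i
      using OUb C by (intro integrable_gauss_bounded[of _ "C * C"])
        (auto simp: abs_mult intro!: mult_mono)
    have i3: "integrable gauss (\<lambda>x. (OU t (partial i g) x)\<^sup>2)" for i
      using gauss_L2_OU[OF gD(13), of t] t by (simp add: gauss_L2_def)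
    have ibp: "(\<integral>x. x $ i * (OU t g x * OU t (partial i g) x) \<partial>gauss)
        = a t * (\<integral>x. OU t g x * OU t (partial i (partial i g)) x \<partial>gauss) + a t * OU_energy (partial i g) t" for i
    proof -
      have c: "Ck 1 (OU t g)" "Ck 1 (OU t (partial i g))"
        using Ck_OU[OF gD(12) t] Ck_OU[OF gD(13) t] by blast+
      have g1: "Ck 1 g" using Ck_le[OF gD(1), of 1] by simp
      have "partial i (\<lambda>x. OU t g x * OU t (partial i g) x) x
          = OU t g x * partial i (OU t (partial i g)) x + partial i (OU t g) x * OU t (partial i g) x" for x
        using c by (intro partial_mult) auto
      then have p: "partial i (\<lambda>x. OU t g x * OU t (partial i g) x)
        = (\<lambda>x. a t * (OU t g x * OU t (partial i (partial i g)) x) + a t * (OU t (partial i g) x)\<^sup>2)"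
        unfolding partial_OU[OF g1 gD(12,13) t] partial_OU[OF gD(3,13,14) t]
        by (simp add: fun_eq_iff a_def power2_eq_square)
      have "(\<integral>x. x $ i * (OU t g x * OU t (partial i g) x) \<partial>gauss)
          = (\<integral>x. partial i (\<lambda>x. OU t g x * OU t (partial i g) x) x \<partial>gauss)"
      proof (rule integral_gauss_by_parts)
        show "Ck 1 (\<lambda>x. OU t g x * OU t (partial i g) x)" by (rule Ck_mult[OF c])
        show "\<bar>OU t g x * OU t (partial i g) x\<bar> \<le> C * C" for x
          unfolding abs_mult using OUb C by (intro mult_mono) auto
        show "\<bar>partial i (\<lambda>x. OU t g x * OU t (partial i g) x) x\<bar> \<le> a t * (C * C) + a t * C\<^sup>2" for x
        proof -
          have "\<bar>OU t g x * OU t (partial i (partial i g)) x\<bar> \<le> C * C"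
            unfolding abs_mult using OUb C by (intro mult_mono) auto
          moreover have "\<bar>(OU t (partial i g) x)\<^sup>2\<bar> \<le> C\<^sup>2"
            using power_mono[OF OUb(2), of _ _ _ 2] by simp
          ultimately show ?thesis
            unfolding p using au[of t]
            by (intro order_trans[OF abs_triangle_ineq] add_mono) (auto simp only: abs_mult abs_of_pos intro!: mult_left_mono)
        qed
      qed
      also have "\<dots> = a t * (\<integral>x. OU t g x * OU t (partial i (partial i g)) x \<partial>gauss) + a t * OU_energy (partial i g) t"
        unfolding p OU_energy_def using i2 i3 by simp
      finally show ?thesis .
    qed
    have e: "2 * OU t g x * D t x = (\<Sum>i\<in>UNIV. - (2 * a t) * (x $ i * (OU t g x * OU t (partial i g) x))
        + 2 * (a t)\<^sup>2 * (OU t g x * OU t (partial i (partial i g)) x))" for x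
      unfolding D_def by (simp add: sum_distrib_left algebra_simps)
    have "(\<integral>x. 2 * OU t g x * D t x \<partial>gauss) = (\<Sum>i\<in>UNIV. - (2 * a t) * (\<integral>x. x $ i * (OU t g x * OU t (partial i g) x) \<partial>gauss)
        + 2 * (a t)\<^sup>2 * (\<integral>x. OU t g x * OU t (partial i (partial i g)) x \<partial>gauss))"
      unfolding e using i1 i2 by (subst Bochner_Integration.integral_sum) auto
    also have "\<dots> = (\<Sum>i\<in>UNIV. - (2 * (a t)\<^sup>2 * OU_energy (partial i g) t))"
      unfolding ibp by (intro sum.cong refl) (simp add: algebra_simps power2_eq_square)
    also have "\<dots> = - (2 * exp (- 2 * t) * (\<Sum>i\<in>UNIV. OU_energy (partial i g) t))"
      by (simp add: sum_negf sum_distrib_left a_def exp_double[symmetric])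
    finally show ?thesis .
  qed
  ultimately show ?thesis by (simp add: OU_energy_def[abs_def])
qed

subsection \<open>The energy identity\<close>

lemma OU_energy_measurable [measurable]:
  fixes g :: "real ^ 'n \<Rightarrow> real"
  assumes [measurable]: "g \<in> borel_measurable borel"
  shows "OU_energy g \<in> borel_measurable borel"
  unfolding OU_energy_def OU_def by measurable

lemma OU_energy_nonneg: "0 \<le> OU_energy g t"
  unfolding OU_energy_def by simp

text \<open>Keeping both coefficients free serves two purposes: continuity of the energy at every
  time, 0 included, and its limit at infinity, where the coefficients tend to 0 and 1 and the inner
  integral becomes the mean of \<open>g\<close>.\<close>

lemma gauss_double_integral_tendsto:
  fixes g :: "real ^ 'n \<Rightarrow> real"
  assumes c: "continuous_on UNIV g" and b: "\<And>x. \<bar>g x\<bar> \<le> C" and a: "a \<longlonglongrightarrow> a0" and s: "s \<longlonglongrightarrow> s0"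
  shows "(\<lambda>n. \<integral>x. (\<integral>y. g (a n *\<^sub>R x + s n *\<^sub>R y) \<partial>gauss)\<^sup>2 \<partial>gauss)
    \<longlonglongrightarrow> (\<integral>x. (\<integral>y. g (a0 *\<^sub>R x + s0 *\<^sub>R y) \<partial>gauss)\<^sup>2 \<partial>(gauss :: (real ^ 'n) measure))"
proof -
  have [measurable]: "g \<in> borel_measurable borel" using c by (rule borel_measurable_continuous_onI)
  have bound: "\<bar>\<integral>y. g (u *\<^sub>R x + v *\<^sub>R y) \<partial>gauss\<bar> \<le> C" for u v and x :: "real ^ 'n"
  proof -
    have "integrable gauss (\<lambda>y. \<bar>g (u *\<^sub>R x + v *\<^sub>R y)\<bar>)"
      using b by (intro integrable_gauss_bounded[of _ C]) auto
    then have "(\<integral>y. \<bar>g (u *\<^sub>R x + v *\<^sub>R y)\<bar> \<partial>gauss) \<le> C"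
      using b by (intro gauss.integral_le_const) auto
    then show ?thesis by (rule order_trans[OF integral_abs_bound])
  qed
  have lim: "(\<lambda>n. \<integral>y. g (a n *\<^sub>R x + s n *\<^sub>R y) \<partial>gauss) \<longlonglongrightarrow> (\<integral>y. g (a0 *\<^sub>R x + s0 *\<^sub>R y) \<partial>gauss)" for x
  proof (rule integral_dominated_convergence[where w = "\<lambda>_. C"])
    have "isCont g z" for z using c by (simp add: continuous_on_eq_continuous_at)
    moreover have "(\<lambda>n. a n *\<^sub>R x + s n *\<^sub>R y) \<longlonglongrightarrow> a0 *\<^sub>R x + s0 *\<^sub>R y" for y
      by (intro tendsto_intros a s)
    ultimately show "AE y in gauss. (\<lambda>n. g (a n *\<^sub>R x + s n *\<^sub>R y)) \<longlonglongrightarrow> g (a0 *\<^sub>R x + s0 *\<^sub>R y)"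
      by (intro AE_I2) (rule isCont_tendsto_compose)
  qed (use b in auto)
  show ?thesis
  proof (rule integral_dominated_convergence[where w = "\<lambda>_. C\<^sup>2"])
    show "AE x in gauss. norm ((\<integral>y. g (a n *\<^sub>R x + s n *\<^sub>R y) \<partial>gauss)\<^sup>2) \<le> C\<^sup>2" for n
    proof (intro AE_I2)
      fix x :: "real ^ 'n"
      show "norm ((\<integral>y. g (a n *\<^sub>R x + s n *\<^sub>R y) \<partial>gauss)\<^sup>2) \<le> C\<^sup>2"
        using power_mono[OF bound[of "a n" x "s n"], of 2] by simp
    qed
    show "AE x in gauss. (\<lambda>n. (\<integral>y. g (a n *\<^sub>R x + s n *\<^sub>R y) \<partial>gauss)\<^sup>2)
        \<longlonglongrightarrow> (\<integral>y. g (a0 *\<^sub>R x + s0 *\<^sub>R y) \<partial>gauss)\<^sup>2"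
      by (intro AE_I2 tendsto_power lim)
  qed auto
qed

lemma isCont_OU_energy:
  fixes g :: "real ^ 'n \<Rightarrow> real"
  assumes "continuous_on UNIV g" and "\<And>x. \<bar>g x\<bar> \<le> C"
  shows "isCont (OU_energy g) t"
  unfolding continuous_at_sequentially
proof (intro allI impI)
  fix X :: "nat \<Rightarrow> real" assume X: "X \<longlonglongrightarrow> t"
  show "(OU_energy g \<circ> X) \<longlonglongrightarrow> OU_energy g t"
    unfolding OU_energy_def OU_def o_def
    by (rule gauss_double_integral_tendsto[OF assms]) (intro tendsto_intros X)+
qed

lemma exp_neg_mult_at_top:
  fixes c :: real
  assumes "c > 0"
  shows "((\<lambda>t. exp (- c * t)) \<longlongrightarrow> 0) at_top"
  by (rule filterlim_compose[OF exp_at_bot filterlim_tendsto_neg_mult_at_bot[OF tendsto_const _ filterlim_ident]])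
     (use assms in simp)

lemma OU_energy_at_top:
  fixes g :: "real ^ 'n \<Rightarrow> real"
  assumes "continuous_on UNIV g" and "\<And>x. \<bar>g x\<bar> \<le> C"
  shows "(OU_energy g \<longlongrightarrow> (\<integral>x. g x \<partial>gauss)\<^sup>2) at_top"
proof (rule tendsto_at_topI_sequentially)
  fix X :: "nat \<Rightarrow> real" assume X: "filterlim X at_top sequentially"
  have "((\<lambda>t :: real. exp (- t)) \<longlongrightarrow> 0) at_top" "((\<lambda>t :: real. exp (- 2 * t)) \<longlongrightarrow> 0) at_top"
    using exp_neg_mult_at_top[of 1] exp_neg_mult_at_top[of 2] by simp_all
  then have e: "(\<lambda>n. exp (- X n)) \<longlonglongrightarrow> 0" "(\<lambda>n. exp (- 2 * X n)) \<longlonglongrightarrow> 0"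
    using X by (auto dest: filterlim_compose)
  have "(\<lambda>n. sqrt (1 - exp (- 2 * X n))) \<longlonglongrightarrow> sqrt (1 - 0)" by (intro tendsto_intros e)
  from gauss_double_integral_tendsto[OF assms e(1) this]
  show "(\<lambda>n. OU_energy g (X n)) \<longlonglongrightarrow> (\<integral>x. g x \<partial>gauss)\<^sup>2"
    by (simp add: OU_energy_def OU_def)
qed

lemma OU_energy_identity_bounded:
  fixes g :: "real ^ 'n \<Rightarrow> real"
  assumes g: "Ck2_bounded C g" and t: "t \<ge> 0"
  shows "(\<integral>\<^sup>+ s. ennreal (2 * exp (- 2 * s) * (\<Sum>i\<in>UNIV. OU_energy (partial i g) s)) * indicator {t..} s \<partial>lborel)
    = ennreal (OU_energy g t - (\<integral>x. g x \<partial>gauss)\<^sup>2)"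
proof -
  note gD = Ck2_boundedD[OF g]
  note [measurable] = gD(9-11)
  have cg: "continuous_on UNIV g" using gD(1) by (rule Ck_continuous)
  define F where "F s = 2 * exp (- 2 * s) * (\<Sum>i\<in>UNIV. OU_energy (partial i g) s)" for s
  have F0: "F s \<ge> 0" for s unfolding F_def by (intro mult_nonneg_nonneg sum_nonneg OU_energy_nonneg) auto
  have [measurable]: "F \<in> borel_measurable borel" unfolding F_def by measurable
  have pos: "(\<integral>\<^sup>+ s. ennreal (F s) * indicator {t..} s \<partial>lborel) = ennreal (OU_energy g t - (\<integral>x. g x \<partial>gauss)\<^sup>2)"
    if t: "t > 0" for t
  proof -
    have "(\<integral>\<^sup>+ s. ennreal (F s) * indicator {t..} s \<partial>lborel)
        = ennreal (- ((\<integral>x. g x \<partial>gauss)\<^sup>2) - (- OU_energy g t))"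
    proof (rule nn_integral_FTC_atLeast)
      show "((\<lambda>t. - OU_energy g t) has_real_derivative F s) (at s)" if "t \<le> s" for s
        using DERIV_minus[OF has_real_derivative_OU_energy[OF g, of s]] that t by (simp add: F_def)
      show "((\<lambda>t. - OU_energy g t) \<longlongrightarrow> - ((\<integral>x. g x \<partial>gauss)\<^sup>2)) at_top"
        by (intro tendsto_minus OU_energy_at_top[OF cg gD(5)])
    qed (auto simp: F0)
    then show ?thesis by simp
  qed
  \<comment> \<open>The derivative formula is missing at 0, so the identity is taken on
    \<open>{e n..}\<close> with \<open>e n\<close> decreasing to 0: monotone convergence on the
    left, continuity of the energy on the right.\<close>
  have zero: "(\<integral>\<^sup>+ s. ennreal (F s) * indicator {0..} s \<partial>lborel) = ennreal (OU_energy g 0 - (\<integral>x. g x \<partial>gauss)\<^sup>2)"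
  proof -
    define e where "e n = inverse (real (Suc n))" for n
    have e: "e \<longlonglongrightarrow> 0" "\<And>n. e n > 0" "decseq e"
      unfolding e_def using LIMSEQ_inverse_real_of_nat by (auto simp: decseq_def field_simps)
    have "(\<lambda>n. \<integral>\<^sup>+ s. ennreal (F s) * indicator {e n..} s \<partial>lborel)
        \<longlonglongrightarrow> (\<integral>\<^sup>+ s. ennreal (F s) * indicator {0<..} s \<partial>lborel)"
    proof (rule nn_integral_LIMSEQ)
      show "incseq (\<lambda>n s. ennreal (F s) * indicator {e n..} s)"
        using e(3) by (auto simp: incseq_def decseq_def le_fun_def indicator_def intro: order_trans)
      fix s
      have "(\<lambda>n. indicator {e n..} s :: ennreal) \<longlonglongrightarrow> indicator {0<..} s"
      proof (cases "s > 0")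
        case True
        then have "eventually (\<lambda>n. e n < s) sequentially"
          using e(1) by (rule order_tendstoD(2)[rotated])
        then have "eventually (\<lambda>n. indicator {0<..} s = (indicator {e n..} s :: ennreal)) sequentially"
          by eventually_elim (use True in simp)
        then show ?thesis by (rule Lim_transform_eventually[OF tendsto_const])
      next
        case False
        then have "indicator {e n..} s = (0 :: ennreal)" for n
          using e(2)[of n] by (auto simp: indicator_def)
        with False show ?thesis by simp
      qed
      then show "(\<lambda>n. ennreal (F s) * indicator {e n..} s) \<longlonglongrightarrow> ennreal (F s) * indicator {0<..} s"
        by (intro ennreal_tendsto_cmult) auto
    qed measurable
    moreover have "(\<lambda>n. \<integral>\<^sup>+ s. ennreal (F s) * indicator {e n..} s \<partial>lborel)
        \<longlonglongrightarrow> ennreal (OU_energy g 0 - (\<integral>x. g x \<partial>gauss)\<^sup>2)"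
      unfolding pos[OF e(2)]
      by (intro tendsto_ennrealI tendsto_diff tendsto_const isCont_tendsto_compose[OF isCont_OU_energy[OF cg gD(5)] e(1)])
    ultimately have "(\<integral>\<^sup>+ s. ennreal (F s) * indicator {0<..} s \<partial>lborel) = ennreal (OU_energy g 0 - (\<integral>x. g x \<partial>gauss)\<^sup>2)"
      by (rule LIMSEQ_unique)
    moreover have "(\<integral>\<^sup>+ s. ennreal (F s) * indicator {0..} s \<partial>lborel) = (\<integral>\<^sup>+ s. ennreal (F s) * indicator {0<..} s \<partial>lborel)"
      using AE_lborel_singleton[of "0 :: real"]
      by (intro nn_integral_cong_AE) (auto simp: indicator_def elim: eventually_mono)
    ultimately show ?thesis by simp
  qed
  show ?thesis
    unfolding F_def[symmetric] using pos[of t] zero t by (cases "t = 0") auto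
qed

section \<open>Radial polynomial cutoffs\<close>

lemma DERIV_max_0_power:
  "((\<lambda>u. (max 0 u) ^ (k + 2)) has_real_derivative real (k + 2) * (max 0 u) ^ (k + 1)) (at (u :: real))"
proof (cases u "0 :: real" rule: linorder_cases)
  case less
  have "((\<lambda>u. 0) has_real_derivative 0) (at u)" by simp
  then have "((\<lambda>u. (max 0 u) ^ (k + 2)) has_real_derivative 0) (at u)"
    by (rule has_field_derivative_transform_within_open[of _ _ _ "{..<0}"]) (use less in auto)
  then show ?thesis using less by simp
next
  case greater
  have "((\<lambda>u :: real. u ^ (k + 2)) has_real_derivative real (k + 2) * u ^ (k + 1)) (at u)"
    using DERIV_pow[of "k + 2" u] by simp
  then have "((\<lambda>u. (max 0 u) ^ (k + 2)) has_real_derivative real (k + 2) * u ^ (k + 1)) (at u)"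
    by (rule has_field_derivative_transform_within_open[of _ _ _ "{0<..}"]) (use greater in auto)
  then show ?thesis using greater by simp
next
  case equal
  have "((\<lambda>h :: real. (max 0 h) ^ (k + 2) / h) \<longlongrightarrow> 0) (at 0)"
  proof (rule Lim_null_comparison)
    have "norm ((max 0 h) ^ (k + 2) / h) \<le> \<bar>h\<bar> ^ (k + 1)" for h :: real
    proof (cases "h > 0")
      case False
      then have "(max 0 h) ^ (k + 2) / h = 0" by simp
      then show ?thesis by (simp only: norm_zero zero_le_power abs_ge_zero)
    qed simp
    then show "eventually (\<lambda>h. norm ((max 0 h) ^ (k + 2) / h) \<le> \<bar>h\<bar> ^ (k + 1)) (at (0 :: real))"
      by simp
    have "((\<lambda>h :: real. \<bar>h\<bar> ^ (k + 1)) \<longlongrightarrow> \<bar>0\<bar> ^ (k + 1)) (at 0)" by (intro tendsto_intros)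
    then show "((\<lambda>h :: real. \<bar>h\<bar> ^ (k + 1)) \<longlongrightarrow> 0) (at 0)" by simp
  qed
  then show ?thesis using equal by (simp add: has_field_derivative_iff)
qed

text \<open>\<open>k = 3\<close> is the smallest power for which the cutoff is \<open>C\<^sup>2\<close>.\<close>

definition cutoff :: "nat \<Rightarrow> real \<Rightarrow> real ^ 'n \<Rightarrow> real" where
  "cutoff k q x = (max 0 (1 - q * (norm x)\<^sup>2)) ^ k"

lemma cutoff_has_derivative:
  "(cutoff (k + 2) q has_derivative
    (\<lambda>h. - (2 * q) * real (k + 2) * (x \<bullet> h) * cutoff (k + 1) q x)) (at (x :: real ^ 'n))"
proof -
  have d: "((\<lambda>x :: real ^ 'n. 1 - q * (norm x)\<^sup>2) has_derivative (\<lambda>h. - (q * (2 * (x \<bullet> h))))) (at x)"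
    unfolding power2_norm_eq_inner
    by (auto intro!: derivative_eq_intros simp: inner_commute)
  have "(cutoff (k + 2) q has_derivative
      (\<lambda>h. real (k + 2) * (max 0 (1 - q * (norm x)\<^sup>2)) ^ (k + 1) * - (q * (2 * (x \<bullet> h))))) (at x)"
    using has_derivative_compose[OF d DERIV_max_0_power[unfolded has_field_derivative_def, of k]]
    unfolding cutoff_def[abs_def] .
  moreover have "real (k + 2) * (max 0 (1 - q * (norm x)\<^sup>2)) ^ (k + 1) * - (q * (2 * (x \<bullet> h)))
      = - (2 * q) * real (k + 2) * (x \<bullet> h) * cutoff (k + 1) q x" for h
    unfolding cutoff_def by (simp only: mult_minus_left mult_minus_right mult_ac)
  ultimately show ?thesis by (simp only:)
qed

lemma partial_cutoff:
  "partial i (cutoff (k + 2) q) = (\<lambda>x. (- (2 * q) * real (k + 2)) * (x $ i * cutoff (k + 1) q x))"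
  by (rule ext) (subst partial_eq[OF cutoff_has_derivative], simp add: inner_axis)

text \<open>A derivative lowers the exponent by one and multiplies by a coordinate, so each order of
  differentiability costs one power; the last remaining power is continuous.\<close>

lemma Ck_cutoff: "Ck k (cutoff (k + 1) q :: real ^ 'n \<Rightarrow> real)"
proof (induction k)
  case 0
  then show ?case unfolding cutoff_def by (auto intro!: continuous_intros)
next
  case (Suc k)
  have "(cutoff (k + 2) q :: real ^ 'n \<Rightarrow> real) differentiable (at x)" for x
    using cutoff_has_derivative unfolding differentiable_def by blast
  moreover have "Ck k (partial i (cutoff (k + 2) q :: real ^ 'n \<Rightarrow> real))" for i
    unfolding partial_cutoff by (intro Ck_mult Ck_const Ck_coord Suc)
  ultimately show ?case by simp
qed

lemma cutoff_bounds:
  assumes "0 \<le> q"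
  shows "0 \<le> cutoff k q x" "cutoff k q x \<le> 1"
  unfolding cutoff_def using assms by (auto intro!: power_le_one)

text \<open>On the support \<open>q * (norm x)^2 \<le> 1\<close>, hence
  \<open>(q * \<bar>x $ i\<bar>)^2 \<le> q \<le> 1\<close>. The bound is uniform in
  \<open>q\<close>, as a common majorant for all cutoffs requires.\<close>

lemma partial_cutoff_bound:
  assumes q: "0 < q" "q \<le> 1"
  shows "\<bar>partial i (cutoff (k + 2) q) x\<bar> \<le> 2 * real (k + 2)"
proof -
  have "q * (\<bar>x $ i\<bar> * cutoff (k + 1) q x) \<le> 1"
  proof (cases "q * (norm x)\<^sup>2 \<le> 1")
    case True
    have "(q * \<bar>x $ i\<bar>)\<^sup>2 \<le> (q * norm x)\<^sup>2"
      using q by (intro power_mono mult_left_mono component_le_norm_cart) auto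
    also have "\<dots> = q * (q * (norm x)\<^sup>2)" by (simp add: power2_eq_square mult_ac)
    also have "\<dots> \<le> 1 * 1" using q True by (intro mult_mono) auto
    finally have "(q * \<bar>x $ i\<bar>)\<^sup>2 \<le> 1\<^sup>2" by (simp only: power_one mult_1_left)
    then have "q * \<bar>x $ i\<bar> \<le> 1" by (rule power2_le_imp_le) simp
    then have "(q * \<bar>x $ i\<bar>) * cutoff (k + 1) q x \<le> 1 * 1"
      using q cutoff_bounds[of q "k + 1" x] by (intro mult_mono) auto
    then show ?thesis by (simp add: mult.assoc)
  next
    case False
    then show ?thesis by (simp add: cutoff_def)
  qed
  then have "(2 * real (k + 2)) * (q * (\<bar>x $ i\<bar> * cutoff (k + 1) q x)) \<le> (2 * real (k + 2)) * 1"
    by (intro mult_left_mono) auto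
  then show ?thesis
    unfolding partial_cutoff using q cutoff_bounds[of q "k + 1" x] by (simp add: abs_mult mult_ac)
qed

lemma cutoff_tendsto: "q \<longlonglongrightarrow> 0 \<Longrightarrow> (\<lambda>n. cutoff k (q n) x) \<longlonglongrightarrow> 1"
proof -
  assume q: "q \<longlonglongrightarrow> 0"
  have "(\<lambda>n. cutoff k (q n) x) \<longlonglongrightarrow> (max 0 (1 - 0 * (norm x)\<^sup>2)) ^ k"
    unfolding cutoff_def by (intro tendsto_intros q)
  then show ?thesis by simp
qed

lemma partial_zero_on_open:
  fixes f :: "real ^ 'n \<Rightarrow> real"
  assumes "open U" "x \<in> U" "\<And>y. y \<in> U \<Longrightarrow> f y = 0"
  shows "partial i f x = 0"
proof -
  have "(f has_derivative (\<lambda>h. 0)) (at x)"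
    by (rule has_derivative_transform_within_open[of "\<lambda>_. 0" _ x UNIV U]) (use assms in auto)
  from partial_eq[OF this] show ?thesis .
qed

lemma compact_support_bounded:
  fixes f :: "real ^ 'n \<Rightarrow> real"
  assumes "continuous_on UNIV f" "\<And>x. norm x > R \<Longrightarrow> f x = 0"
  shows "\<exists>B \<ge> 0. \<forall>x. \<bar>f x\<bar> \<le> B"
proof -
  have "compact (f ` cball 0 R)"
    using assms(1) by (intro compact_continuous_image) (auto intro: continuous_on_subset)
  then obtain B where "\<forall>y\<in>f ` cball 0 R. norm y \<le> B"
    using compact_imp_bounded bounded_iff by blast
  then have B: "\<bar>f x\<bar> \<le> B" if "norm x \<le> R" for x using that by simp
  have "\<bar>f x\<bar> \<le> \<bar>B\<bar>" for x
    using assms(2)[of x] B[of x] by (cases "norm x \<le> R") auto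
  then show ?thesis by (intro exI[of _ "\<bar>B\<bar>"]) auto
qed

lemma Ck2_bounded_compact_support:
  fixes f :: "real ^ 'n \<Rightarrow> real"
  assumes f: "Ck 2 f" and z: "\<And>x. norm x > R \<Longrightarrow> f x = 0"
  shows "\<exists>C. Ck2_bounded C f"
proof -
  have U: "open {x :: real ^ 'n. norm x > R}"
    by (intro open_Collect_less continuous_intros)
  have z1: "partial i f x = 0" if "norm x > R" for x i
    by (rule partial_zero_on_open[OF U]) (use z that in auto)
  have z2: "partial i (partial i f) x = 0" if "norm x > R" for x i
    by (rule partial_zero_on_open[OF U]) (use z1 that in auto)
  have c: "continuous_on UNIV f" "continuous_on UNIV (partial i f)" "continuous_on UNIV (partial i (partial i f))" for i
  proof -
    have "Ck 1 (partial i f)" using f by (simp add: numeral_2_eq_2)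
    then show "continuous_on UNIV (partial i f)" "continuous_on UNIV (partial i (partial i f))"
      using Ck_continuous[of 1 "partial i f"] by auto
  qed (rule Ck_continuous[OF f])
  obtain B0 where B0: "B0 \<ge> 0" "\<And>x. \<bar>f x\<bar> \<le> B0"
    using compact_support_bounded[OF c(1) z] by blast
  have "\<forall>i. \<exists>B \<ge> 0. \<forall>x. \<bar>partial i f x\<bar> \<le> B"
    using compact_support_bounded[OF c(2) z1] by blast
  then obtain B1 where B1: "\<And>i. B1 i \<ge> 0" "\<And>i x. \<bar>partial i f x\<bar> \<le> B1 i" by metis
  have "\<forall>i. \<exists>B \<ge> 0. \<forall>x. \<bar>partial i (partial i f) x\<bar> \<le> B"
    using compact_support_bounded[OF c(3) z2] by blast
  then obtain B2 where B2: "\<And>i. B2 i \<ge> 0" "\<And>i x. \<bar>partial i (partial i f) x\<bar> \<le> B2 i" by metis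
  define C where "C = B0 + (\<Sum>i\<in>UNIV. B1 i) + (\<Sum>i\<in>UNIV. B2 i)"
  have s: "B1 i \<le> (\<Sum>i\<in>UNIV. B1 i)" "B2 i \<le> (\<Sum>i\<in>UNIV. B2 i)" "0 \<le> (\<Sum>i\<in>UNIV. B1 i)" "0 \<le> (\<Sum>i\<in>UNIV. B2 i)" for i
    using B1(1) B2(1) by (auto intro: member_le_sum sum_nonneg)
  have "\<bar>f x\<bar> \<le> C" "\<bar>partial i f x\<bar> \<le> C" "\<bar>partial i (partial i f) x\<bar> \<le> C" for i x
    unfolding C_def using B0(1) B0(2)[of x] B1(2)[of i x] B2(2)[of i x] s(1)[of i] s(2)[of i] s(3,4)
    by linarith+
  then show ?thesis using f by (intro exI[of _ C]) (auto simp: Ck2_bounded_def)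
qed

section \<open>From compactly supported functions to square-integrable ones\<close>

lemma integrable_OU:
  fixes g :: "real ^ 'n \<Rightarrow> real"
  assumes "gauss_L2 g" and "t \<ge> 0"
  shows "integrable gauss (\<lambda>y. g (exp (- t) *\<^sub>R x + sqrt (1 - exp (- 2 * t)) *\<^sub>R y))"
  using integrable_OU_pos[OF assms(1), of t x] assms(2) by (cases "t = 0") auto

text \<open>Dominated convergence twice: inside the semigroup, where the integrand built from
  \<open>G\<close> is integrable for every \<open>x\<close>, and outside, where positivity gives the
  majorant \<open>(OU t G x)^2\<close>, integrable by contraction.\<close>

lemma OU_energy_tendsto_dominated:
  fixes h :: "real ^ 'n \<Rightarrow> real"
  assumes [measurable]: "\<And>n. H n \<in> borel_measurable borel" "h \<in> borel_measurable borel"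
    and G: "gauss_L2 G" and le: "\<And>n x. \<bar>H n x\<bar> \<le> G x"
    and lim: "\<And>x. (\<lambda>n. H n x) \<longlonglongrightarrow> h x" and t: "t \<ge> 0"
  shows "(\<lambda>n. OU_energy (H n) t) \<longlonglongrightarrow> OU_energy h t"
  unfolding OU_energy_def
proof (rule integral_dominated_convergence[where w = "\<lambda>x. (OU t G x)\<^sup>2"])
  have [measurable]: "G \<in> borel_measurable borel" using G by (rule gauss_L2_measurable)
  show "integrable gauss (\<lambda>x. (OU t G x)\<^sup>2)"
    using gauss_L2_OU[OF G t] by (simp add: gauss_L2_def)
  have "(\<lambda>n. OU t (H n) x) \<longlonglongrightarrow> OU t h x" for x
    unfolding OU_def
    by (rule integral_dominated_convergence[OF _ _ integrable_OU[OF G t]]) (use le lim in auto)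
  then show "AE x in gauss. (\<lambda>n. (OU t (H n) x)\<^sup>2) \<longlonglongrightarrow> (OU t h x)\<^sup>2"
    by (intro AE_I2 tendsto_power)
  have "\<bar>OU t (H n) x\<bar> \<le> OU t G x" for n x
  proof -
    have L: "gauss_L2 (H n)" by (rule gauss_L2_bound[OF G]) (use le[of n] in \<open>auto intro: order_trans[OF _ abs_ge_self]\<close>)
    have "\<bar>OU t (H n) x\<bar> \<le> (\<integral>y. \<bar>H n (exp (- t) *\<^sub>R x + sqrt (1 - exp (- 2 * t)) *\<^sub>R y)\<bar> \<partial>gauss)"
      unfolding OU_def by (rule integral_abs_bound)
    also have "\<dots> \<le> OU t G x"
      unfolding OU_def using le by (intro integral_mono integrable_abs integrable_OU L G t) auto
    finally show ?thesis .
  qed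
  then show "AE x in gauss. norm ((OU t (H n) x)\<^sup>2) \<le> (OU t G x)\<^sup>2" for n
    by (intro AE_I2) (metis abs_ge_zero norm_power power_mono real_norm_def)
qed auto

lemma OU_energy_le:
  assumes "gauss_L2 h" "gauss_L2 G" "\<And>x. \<bar>h x\<bar> \<le> G x" "t \<ge> 0"
  shows "OU_energy h t \<le> (\<integral>x. (G x)\<^sup>2 \<partial>gauss)"
proof -
  have "OU_energy h t \<le> (\<integral>x. (h x)\<^sup>2 \<partial>gauss)"
    unfolding OU_energy_def by (rule integral_OU_square_le[OF assms(1,4)])
  also have "\<dots> \<le> (\<integral>x. (G x)\<^sup>2 \<partial>gauss)"
  proof (rule integral_mono)
    show "(h x)\<^sup>2 \<le> (G x)\<^sup>2" for x
      using power_mono[OF assms(3), of x 2] by simp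
  qed (use assms in \<open>auto simp: gauss_L2_def\<close>)
  finally show ?thesis .
qed

lemma OU_energy_identity:
  fixes g :: "real ^ 'n \<Rightarrow> real"
  assumes g: "Ck 2 g" and L: "gauss_L2 g" "\<And>i. gauss_L2 (partial i g)" and t: "t \<ge> 0"
  shows "(\<integral>\<^sup>+ s. ennreal (2 * exp (- 2 * s) * (\<Sum>i\<in>UNIV. OU_energy (partial i g) s)) * indicator {t..} s \<partial>lborel)
    = ennreal (OU_energy g t - (\<integral>x. g x \<partial>gauss)\<^sup>2)"
proof -
  define q where "q n = inverse (real (Suc n))" for n
  have q: "q \<longlonglongrightarrow> 0" "\<And>n. q n > 0" "\<And>n. q n \<le> 1"
    unfolding q_def using LIMSEQ_inverse_real_of_nat by (auto simp: field_simps)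
  define ct :: "nat \<Rightarrow> real ^ 'n \<Rightarrow> real" where "ct n = cutoff 3 (q n)" for n
  have ct: "Ck 2 (ct n)" for n
    using Ck_cutoff[of 2 "q n"] by (simp add: ct_def)
  have pct: "partial i (ct n) = (\<lambda>x. (- (2 * q n) * 3) * (x $ i * cutoff 2 (q n) x))" for i n
    using partial_cutoff[of i 1 "q n"] by (simp add: ct_def numeral_3_eq_3 numeral_2_eq_2)
  have ct_bound: "0 \<le> ct n x" "ct n x \<le> 1" for n x
    unfolding ct_def using q(2)[of n] by (auto intro!: cutoff_bounds)
  have pct_bound: "\<bar>partial i (ct n) x\<bar> \<le> 6" for n i x
    using partial_cutoff_bound[OF q(2,3), of i 1 n x] by (simp add: ct_def numeral_3_eq_3)
  define H where "H n x = ct n x * g x" for n x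
  have H: "Ck 2 (H n)" for n unfolding H_def by (intro Ck_mult ct g)
  have "\<exists>C. Ck2_bounded C (H n)" for n
  proof (rule Ck2_bounded_compact_support[OF H])
    \<comment> \<open>The support has radius \<open>sqrt (Suc n)\<close>; the larger radius
      \<open>Suc n\<close> avoids the root.\<close>
    fix x :: "real ^ 'n" assume "norm x > real (Suc n)"
    then have "real (Suc n) \<le> norm x * 1" by simp
    moreover have "norm x * 1 \<le> norm x * norm x"
      using \<open>norm x > real (Suc n)\<close> by (intro mult_left_mono) auto
    ultimately have "real (Suc n) \<le> (norm x)\<^sup>2" by (simp add: power2_eq_square)
    then have "1 - q n * (norm x)\<^sup>2 \<le> 0" by (simp add: q_def field_simps)
    then show "H n x = 0" by (simp add: H_def ct_def cutoff_def)
  qed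
  then obtain C where C: "\<And>n. Ck2_bounded (C n) (H n)" by metis
  note HD = Ck2_boundedD[OF C]
  have d: "g differentiable (at x)" "ct n differentiable (at x)" for x n
    using g ct[of n] by (auto simp: numeral_2_eq_2)
  have pH: "partial i (H n) x = ct n x * partial i g x + partial i (ct n) x * g x" for i n x
    unfolding H_def by (rule partial_mult[OF d(2,1)])
  \<comment> \<open>An L2 majorant for the gradients of all truncations: the product rule adds a
    derivative of the cutoff times \<open>g\<close>, and that derivative is at most
    \<open>2 * 3 = 6\<close>.\<close>
  define G where "G i x = \<bar>partial i g x\<bar> + 6 * \<bar>g x\<bar>" for i x
  have [measurable]: "g \<in> borel_measurable borel" "partial i g \<in> borel_measurable borel" for i
    using L by (auto simp: gauss_L2_def)
  have L': "gauss_L2 (\<lambda>x. \<bar>g x\<bar>)" "gauss_L2 (\<lambda>x. \<bar>partial i g x\<bar>)" for i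
    using L(1) L(2)[of i] by (auto intro: gauss_L2_bound)
  have G: "gauss_L2 (G i)" for i
    unfolding G_def by (intro gauss_L2_add gauss_L2_cmult L')
  have H_le: "\<bar>H n x\<bar> \<le> \<bar>g x\<bar>" for n x
    unfolding H_def abs_mult using ct_bound[of n x] by (auto intro: mult_left_le_one_le)
  have pH_le: "\<bar>partial i (H n) x\<bar> \<le> G i x" for i n x
  proof -
    have "\<bar>partial i (H n) x\<bar> \<le> \<bar>ct n x\<bar> * \<bar>partial i g x\<bar> + \<bar>partial i (ct n) x\<bar> * \<bar>g x\<bar>"
      unfolding pH abs_mult[symmetric] by (rule abs_triangle_ineq)
    also have "\<dots> \<le> 1 * \<bar>partial i g x\<bar> + 6 * \<bar>g x\<bar>"
      using ct_bound[of n x] pct_bound[of i n x] by (intro add_mono mult_right_mono) auto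
    finally show ?thesis by (simp add: G_def)
  qed
  have ct_lim: "(\<lambda>n. ct n x) \<longlonglongrightarrow> 1" for x
    unfolding ct_def by (rule cutoff_tendsto[OF q(1)])
  have H_lim: "(\<lambda>n. H n x) \<longlonglongrightarrow> g x" for x
    unfolding H_def using tendsto_mult[OF ct_lim[of x] tendsto_const[of "g x"]] by simp
  have pH_lim: "(\<lambda>n. partial i (H n) x) \<longlonglongrightarrow> partial i g x" for i x
  proof -
    have "(\<lambda>n. ct n x * partial i g x + (- (2 * q n) * 3) * (x $ i * cutoff 2 (q n) x) * g x)
        \<longlonglongrightarrow> 1 * partial i g x + (- (2 * 0) * 3) * (x $ i * 1) * g x"
      by (intro tendsto_intros ct_lim q(1) cutoff_tendsto)
    then show ?thesis unfolding pH pct by simp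
  qed
  have E_lim: "(\<lambda>n. OU_energy (partial i (H n)) s) \<longlonglongrightarrow> OU_energy (partial i g) s" if "s \<ge> 0" for i s
    by (rule OU_energy_tendsto_dominated[OF HD(10) _ G pH_le pH_lim that]) simp
  \<comment> \<open>By contraction \<open>K\<close> bounds the total gradient energy for all
    \<open>n\<close> and all times at once, so \<open>2 * exp (- 2 * s) * K\<close> dominates in the
    time integral.\<close>
  define K where "K = (\<Sum>i\<in>UNIV. \<integral>x. (G i x)\<^sup>2 \<partial>gauss)"
  have K: "K \<ge> 0" unfolding K_def by (intro sum_nonneg) simp
  have "(\<lambda>n. \<integral>\<^sup>+ s. ennreal (2 * exp (- 2 * s) * (\<Sum>i\<in>UNIV. OU_energy (partial i (H n)) s)) * indicator {t..} s \<partial>lborel)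
    \<longlonglongrightarrow> (\<integral>\<^sup>+ s. ennreal (2 * exp (- 2 * s) * (\<Sum>i\<in>UNIV. OU_energy (partial i g) s)) * indicator {t..} s \<partial>lborel)"
  proof (rule nn_integral_dominated_convergence[where w = "\<lambda>s. ennreal (2 * exp (- 2 * s) * K) * indicator {t..} s"])
    show "(\<lambda>s. ennreal (2 * exp (- 2 * s) * (\<Sum>i\<in>UNIV. OU_energy (partial i (H n)) s)) * indicator {t..} s)
        \<in> borel_measurable lborel" for n
      using HD(10) by measurable
    have "(\<integral>\<^sup>+ s. ennreal (2 * exp (- 2 * s) * K) * indicator {t..} s \<partial>lborel) = ennreal (0 - - (exp (- 2 * t) * K))"
    proof (rule nn_integral_FTC_atLeast)
      show "((\<lambda>s. - (exp (- 2 * s) * K)) has_real_derivative 2 * exp (- 2 * s) * K) (at s)" for s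
        by (auto intro!: derivative_eq_intros)
      have "((\<lambda>s :: real. exp (- 2 * s)) \<longlongrightarrow> 0) at_top"
        using exp_neg_mult_at_top[of 2] by simp
      from tendsto_minus[OF tendsto_mult[OF this tendsto_const[of K]]]
      show "((\<lambda>s. - (exp (- 2 * s) * K)) \<longlongrightarrow> 0) at_top" by simp
    qed (use K in auto)
    then show "(\<integral>\<^sup>+ s. ennreal (2 * exp (- 2 * s) * K) * indicator {t..} s \<partial>lborel) < \<infinity>" by simp
    show "AE s in lborel. ennreal (2 * exp (- 2 * s) * (\<Sum>i\<in>UNIV. OU_energy (partial i (H n)) s)) * indicator {t..} s
        \<le> ennreal (2 * exp (- 2 * s) * K) * indicator {t..} s" for n
    proof (intro AE_I2)
      fix s
      show "ennreal (2 * exp (- 2 * s) * (\<Sum>i\<in>UNIV. OU_energy (partial i (H n)) s)) * indicator {t..} s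
        \<le> ennreal (2 * exp (- 2 * s) * K) * indicator {t..} s"
      proof (cases "s \<ge> t")
        case True
        have "(\<Sum>i\<in>UNIV. OU_energy (partial i (H n)) s) \<le> K"
          unfolding K_def using True t by (intro sum_mono OU_energy_le HD(13) G pH_le) auto
        then show ?thesis by (intro mult_right_mono ennreal_leI mult_left_mono) auto
      qed simp
    qed
    show "AE s in lborel. (\<lambda>n. ennreal (2 * exp (- 2 * s) * (\<Sum>i\<in>UNIV. OU_energy (partial i (H n)) s)) * indicator {t..} s)
        \<longlonglongrightarrow> ennreal (2 * exp (- 2 * s) * (\<Sum>i\<in>UNIV. OU_energy (partial i g) s)) * indicator {t..} s"
    proof (intro AE_I2)
      fix s
      show "(\<lambda>n. ennreal (2 * exp (- 2 * s) * (\<Sum>i\<in>UNIV. OU_energy (partial i (H n)) s)) * indicator {t..} s)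
        \<longlonglongrightarrow> ennreal (2 * exp (- 2 * s) * (\<Sum>i\<in>UNIV. OU_energy (partial i g) s)) * indicator {t..} s"
      proof (cases "s \<ge> t")
        case True
        then have "(\<lambda>n. ennreal (2 * exp (- 2 * s) * (\<Sum>i\<in>UNIV. OU_energy (partial i (H n)) s)))
          \<longlonglongrightarrow> ennreal (2 * exp (- 2 * s) * (\<Sum>i\<in>UNIV. OU_energy (partial i g) s))"
          using t by (intro tendsto_ennrealI tendsto_mult tendsto_const tendsto_sum E_lim) auto
        then show ?thesis using True by simp
      qed simp
    qed
  qed measurable
  moreover have "(\<lambda>n. ennreal (OU_energy (H n) t - (\<integral>x. H n x \<partial>gauss)\<^sup>2))
      \<longlonglongrightarrow> ennreal (OU_energy g t - (\<integral>x. g x \<partial>gauss)\<^sup>2)"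
  proof (intro tendsto_ennrealI tendsto_diff tendsto_power)
    show "(\<lambda>n. OU_energy (H n) t) \<longlonglongrightarrow> OU_energy g t"
      by (rule OU_energy_tendsto_dominated[OF HD(9) _ L'(1) H_le H_lim t]) simp
    show "(\<lambda>n. \<integral>x. H n x \<partial>gauss) \<longlonglongrightarrow> (\<integral>x. g x \<partial>gauss)"
      by (rule integral_dominated_convergence[OF _ _ gauss_L2_integrable[OF L'(1)]])
         (use HD(9) H_lim H_le in auto)
  qed
  ultimately show ?thesis
    unfolding OU_energy_identity_bounded[OF C t] using LIMSEQ_unique by blast
qed

subsection \<open>The variance bound\<close>

lemma gauss_L2_I:
  fixes h :: "real ^ 'n \<Rightarrow> real"
  assumes [measurable]: "h \<in> borel_measurable borel" and S: "integrable gauss S" and le: "\<And>x. (h x)\<^sup>2 \<le> S x"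
  shows "gauss_L2 h"
proof -
  have "integrable gauss (\<lambda>x. (h x)\<^sup>2)"
  proof (rule Bochner_Integration.integrable_bound[OF S])
    show "AE x in gauss. norm ((h x)\<^sup>2) \<le> norm (S x)"
      using le by (auto intro: order_trans[OF _ abs_ge_self])
  qed simp
  then show ?thesis by (simp add: gauss_L2_def)
qed

lemma smooth_Ck: "smooth f \<Longrightarrow> Ck k f"
  by (simp add: smooth_def)

lemma smooth_partial: "smooth f \<Longrightarrow> smooth (partial i f)"
  unfolding smooth_def by (metis Ck.simps(2))

text \<open>The square of each derivative is a single summand in the closed form of \<Gamma> or
  \<Gamma>2, whose remaining summands are nonnegative; integrability of the whole therefore passes
  to each derivative.\<close>

lemma
  fixes f :: "real ^ 'n \<Rightarrow> real"
  assumes "regular f"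
  shows regular_smooth: "smooth f"
    and regular_gauss_L2: "gauss_L2 f"
    and regular_gauss_L2_partial: "gauss_L2 (partial i f)"
    and regular_gauss_L2_partial2: "gauss_L2 (partial j (partial i f))"
proof -
  show s: "smooth f" using assms by (simp add: regular_def)
  note c = smooth_Ck[OF s] smooth_Ck[OF smooth_partial[OF s]] smooth_Ck[OF smooth_partial[OF smooth_partial[OF s]]]
  show "gauss_L2 f"
    using assms Ck_measurable[OF c(1)] by (simp add: regular_def gauss_L2_def)
  show "gauss_L2 (partial i f)"
  proof (rule gauss_L2_I)
    show "(partial i f x)\<^sup>2 \<le> carre_du_champ f f x" for x
      unfolding carre_du_champ_eq[OF c(1,1)] power2_eq_square[symmetric]
      by (rule member_le_sum) auto
  qed (use assms Ck_measurable[OF c(2)] in \<open>auto simp: regular_def\<close>)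
  show "gauss_L2 (partial j (partial i f))"
  proof (rule gauss_L2_I)
    fix x
    have "(partial j (partial i f) x)\<^sup>2 \<le> (\<Sum>j\<in>UNIV. (partial j (partial i f) x)\<^sup>2)"
      by (rule member_le_sum) auto
    also have "\<dots> \<le> (\<Sum>i\<in>UNIV. \<Sum>j\<in>UNIV. (partial j (partial i f) x)\<^sup>2)"
      by (rule member_le_sum[where f = "\<lambda>i. \<Sum>j\<in>UNIV. (partial j (partial i f) x)\<^sup>2"]) (auto intro: sum_nonneg)
    also have "\<dots> \<le> carre_du_champ2 f f x"
      unfolding carre_du_champ2_eq[OF c(1)] by (auto intro: sum_nonneg)
    finally show "(partial j (partial i f) x)\<^sup>2 \<le> carre_du_champ2 f f x" .
  qed (use assms Ck_measurable[OF c(3)] in \<open>auto simp: regular_def\<close>)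
qed

text \<open>Commutation costs \<open>exp (- t)\<close> per derivative: once for the gradient, twice
  for the Hessian. Squaring yields the weights \<open>exp (- 2 * t)\<close> and
  \<open>exp (- 4 * t)\<close>.\<close>

lemma
  fixes f :: "real ^ 'n \<Rightarrow> real"
  assumes f: "regular f" and t: "t > 0"
  shows integral_carre_du_champ_OU:
      "(\<integral>x. carre_du_champ (OU t f) (OU t f) x \<partial>gauss) = (\<Sum>i\<in>UNIV. exp (- 2 * t) * OU_energy (partial i f) t)"
    and integral_carre_du_champ2_OU:
      "(\<integral>x. carre_du_champ2 (OU t f) (OU t f) x \<partial>gauss)
        = (\<Sum>i\<in>UNIV. \<Sum>j\<in>UNIV. exp (- 4 * t) * OU_energy (partial j (partial i f)) t)
          + (\<Sum>i\<in>UNIV. exp (- 2 * t) * OU_energy (partial i f) t)"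
proof -
  note s = regular_smooth[OF f]
  note L = regular_gauss_L2[OF f] regular_gauss_L2_partial[OF f] regular_gauss_L2_partial2[OF f]
  have C: "Ck k (OU t f)" for k by (rule Ck_OU[OF L(1) t])
  have p1: "partial i (OU t f) = (\<lambda>x. exp (- t) * OU t (partial i f) x)" for i
    by (rule partial_OU[OF smooth_Ck[OF s] L(1,2) t])
  have p2: "partial j (partial i (OU t f)) x = exp (- t) * (exp (- t) * OU t (partial j (partial i f)) x)" for i j x
  proof -
    have "OU t (partial i f) differentiable (at x)"
      using Ck_OU[OF L(2) t, of 1 i] by simp
    then show ?thesis
      unfolding p1 by (subst partial_cmult)
        (auto simp: partial_OU[OF smooth_Ck[OF smooth_partial[OF s]] L(2,3) t])
  qed
  have i1: "integrable gauss (\<lambda>x. (OU t (partial i f) x)\<^sup>2)" for i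
    using gauss_L2_OU[OF L(2), of t i] t by (simp add: gauss_L2_def)
  have i2: "integrable gauss (\<lambda>x. (OU t (partial j (partial i f)) x)\<^sup>2)" for i j
    using gauss_L2_OU[OF L(3), of t j i] t by (simp add: gauss_L2_def)
  have e2: "exp (- 2 * t) = (exp (- t))\<^sup>2"
    by (simp add: power2_eq_square exp_add[symmetric])
  have G: "carre_du_champ (OU t f) (OU t f) x = (\<Sum>i\<in>UNIV. exp (- 2 * t) * (OU t (partial i f) x)\<^sup>2)" for x
    unfolding carre_du_champ_eq[OF C C] p1 e2
    by (simp add: power2_eq_square mult_ac)
  have e4: "exp (- 4 * t) = (exp (- t) * exp (- t))\<^sup>2"
    by (simp add: power2_eq_square exp_add[symmetric])
  have G2: "carre_du_champ2 (OU t f) (OU t f) x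
      = (\<Sum>i\<in>UNIV. \<Sum>j\<in>UNIV. exp (- 4 * t) * (OU t (partial j (partial i f)) x)\<^sup>2)
        + (\<Sum>i\<in>UNIV. exp (- 2 * t) * (OU t (partial i f) x)\<^sup>2)" for x
    unfolding carre_du_champ2_eq[OF C] p2 e4 e2 unfolding p1
    by (simp add: power_mult_distrib mult.assoc)
  show "(\<integral>x. carre_du_champ (OU t f) (OU t f) x \<partial>gauss) = (\<Sum>i\<in>UNIV. exp (- 2 * t) * OU_energy (partial i f) t)"
    unfolding G OU_energy_def using i1 by (subst Bochner_Integration.integral_sum) auto
  have "(\<integral>x. (\<Sum>i\<in>UNIV. \<Sum>j\<in>UNIV. exp (- 4 * t) * (OU t (partial j (partial i f)) x)\<^sup>2) \<partial>gauss)
      = (\<Sum>i\<in>UNIV. \<Sum>j\<in>UNIV. exp (- 4 * t) * OU_energy (partial j (partial i f)) t)"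
    unfolding OU_energy_def using i2 by (simp add: Bochner_Integration.integral_sum)
  moreover have "(\<integral>x. (\<Sum>i\<in>UNIV. exp (- 2 * t) * (OU t (partial i f) x)\<^sup>2) \<partial>gauss)
      = (\<Sum>i\<in>UNIV. exp (- 2 * t) * OU_energy (partial i f) t)"
    unfolding OU_energy_def using i1 by (simp add: Bochner_Integration.integral_sum)
  ultimately show "(\<integral>x. carre_du_champ2 (OU t f) (OU t f) x \<partial>gauss)
        = (\<Sum>i\<in>UNIV. \<Sum>j\<in>UNIV. exp (- 4 * t) * OU_energy (partial j (partial i f)) t)
          + (\<Sum>i\<in>UNIV. exp (- 2 * t) * OU_energy (partial i f) t)"
    unfolding G2 using i1 i2 by (subst Bochner_Integration.integral_add) auto
qed

text \<open>Normalised to the weight \<open>exp (- 2 * s)\<close> so that both time integrals match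
  the form of \<open>psi_integral\<close>.\<close>

lemma OU_energy_identity_half:
  fixes g :: "real ^ 'n \<Rightarrow> real"
  assumes g: "Ck 2 g" and L: "gauss_L2 g" "\<And>i. gauss_L2 (partial i g)" and t: "t \<ge> 0"
  shows "(\<integral>\<^sup>+ s. ennreal (exp (- 2 * s) * (\<Sum>i\<in>UNIV. OU_energy (partial i g) s)) * indicator {t..} s \<partial>lborel)
    = ennreal ((OU_energy g t - (\<integral>x. g x \<partial>gauss)\<^sup>2) / 2)"
proof -
  have [measurable]: "partial i g \<in> borel_measurable borel" for i
    using L(2) by (rule gauss_L2_measurable)
  have "ennreal (exp (- 2 * s) * (\<Sum>i\<in>UNIV. OU_energy (partial i g) s))
      = ennreal (1 / 2) * ennreal (2 * exp (- 2 * s) * (\<Sum>i\<in>UNIV. OU_energy (partial i g) s))" for s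
    by (subst ennreal_mult'[symmetric]) auto
  then have "(\<integral>\<^sup>+ s. ennreal (exp (- 2 * s) * (\<Sum>i\<in>UNIV. OU_energy (partial i g) s)) * indicator {t..} s \<partial>lborel)
      = (\<integral>\<^sup>+ s. ennreal (1 / 2) * (ennreal (2 * exp (- 2 * s) * (\<Sum>i\<in>UNIV. OU_energy (partial i g) s)) * indicator {t..} s) \<partial>lborel)"
    by (simp only: mult.assoc)
  also have "\<dots> = ennreal (1 / 2) * ennreal (OU_energy g t - (\<integral>x. g x \<partial>gauss)\<^sup>2)"
    by (subst nn_integral_cmult) (auto simp only: OU_energy_identity[OF assms], measurable)
  also have "\<dots> = ennreal ((OU_energy g t - (\<integral>x. g x \<partial>gauss)\<^sup>2) / 2)"
    by (subst ennreal_mult'[symmetric]) auto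
  finally show ?thesis .
qed

text \<open>Moves the Borel energies between \<open>lborel\<close>, where the identity lives, and
  the restricted Lebesgue measure of \<open>psi_integral\<close>.\<close>

lemma nn_integral_lebesgue_on:
  fixes t :: real
  assumes [measurable]: "F \<in> borel_measurable borel"
  shows "(\<integral>\<^sup>+ s. F s \<partial>lebesgue_on {t..}) = (\<integral>\<^sup>+ s. F s * indicator {t..} s \<partial>lborel)"
proof -
  have "(\<integral>\<^sup>+ s. F s \<partial>lebesgue_on {t..}) = (\<integral>\<^sup>+ s. F s * indicator {t..} s \<partial>lebesgue)"
    by (rule nn_integral_restrict_space) simp
  also have "\<dots> = (\<integral>\<^sup>+ s. F s * indicator {t..} s \<partial>lborel)"
    by (rule nn_integral_completion) measurable
  finally show ?thesis .
qed

text \<open>The mean gradient is a vector-valued integral; its integrability is established so that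
  coordinates may be taken under the integral sign.\<close>

lemma norm_integral_grad:
  fixes f :: "real ^ 'n \<Rightarrow> real"
  assumes "\<And>i. integrable gauss (partial i f)"
  shows "(norm (\<integral>x. grad f x \<partial>gauss))\<^sup>2 = (\<Sum>i\<in>UNIV. (\<integral>x. partial i f x \<partial>gauss)\<^sup>2)"
proof -
  have e: "grad f x = (\<Sum>i\<in>UNIV. partial i f x *\<^sub>R axis i 1)" for x
    unfolding grad_def using basis_expansion[of "\<chi> i. partial i f x"]
    by (simp add: scalar_mult_eq_scaleR)
  have "integrable gauss (\<lambda>x. grad f x)"
    unfolding e by (intro Bochner_Integration.integrable_sum integrable_scaleR_left assms)
  moreover have "grad f x $ i = partial i f x" for x i by (simp add: grad_def)
  ultimately have "(\<integral>x. grad f x \<partial>gauss) $ i = (\<integral>x. partial i f x \<partial>gauss)" for i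
    using integral_bounded_linear[OF bounded_linear_vec_nth[of i], of gauss "grad f"] by simp
  then show ?thesis by (simp add: power2_norm_vec)
qed

theorem theorem1p1:
  fixes f :: "real ^ 'n \<Rightarrow> real" and \<psi> :: "real \<Rightarrow> real"
  assumes "regular f"
    and "\<psi> \<in> borel_measurable (lebesgue_on {0..})"
    and "\<And>t. t \<ge> 0 \<Longrightarrow>
           (\<integral>x. carre_du_champ2 (OU t f) (OU t f) x \<partial>gauss)
             \<le> (\<integral>x. carre_du_champ (OU t f) (OU t f) x \<partial>gauss) + \<psi> t"
    and "psi_integral \<psi> < \<infinity>"
  shows "gauss_var f \<le> (norm (\<integral>x. grad f x \<partial>gauss))\<^sup>2 + 4 * enn2real (psi_integral \<psi>)"
proof -
  note s = regular_smooth[OF assms(1)]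
  note L = regular_gauss_L2[OF assms(1)] regular_gauss_L2_partial[OF assms(1)]
    regular_gauss_L2_partial2[OF assms(1)]
  note C = smooth_Ck[OF s] smooth_Ck[OF smooth_partial[OF s]]
  have [measurable]: "partial i f \<in> borel_measurable borel" "partial j (partial i f) \<in> borel_measurable borel" for i j
    using L(2,3) by (auto intro: gauss_L2_measurable)
  define m where "m i = (\<integral>x. partial i f x \<partial>gauss)\<^sup>2" for i
  define M where "M = (\<Sum>i\<in>UNIV. m i)"
  have M: "(norm (\<integral>x. grad f x \<partial>gauss))\<^sup>2 = M" "M \<ge> 0"
    using norm_integral_grad[OF gauss_L2_integrable[OF L(2)]] by (auto simp: M_def m_def intro: sum_nonneg)
  \<comment> \<open>The gradient energies cancel from both sides of the hypothesis. Multiplication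
    by \<open>exp (2 * t)\<close> turns the Hessian weight \<open>exp (- 4 * t)\<close> into the
    \<open>exp (- 2 * t)\<close> of the identity and puts on \<psi> the weight of the inner
    integral.\<close>
  have hess: "exp (- 2 * t) * (\<Sum>i\<in>UNIV. \<Sum>j\<in>UNIV. OU_energy (partial j (partial i f)) t) \<le> exp (2 * t) * \<psi> t"
    if t: "t > 0" for t
  proof -
    have "(\<Sum>i\<in>UNIV. \<Sum>j\<in>UNIV. exp (- 4 * t) * OU_energy (partial j (partial i f)) t) \<le> \<psi> t"
      using assms(3)[of t] t
      unfolding integral_carre_du_champ_OU[OF assms(1) t] integral_carre_du_champ2_OU[OF assms(1) t] by simp
    then have "exp (- 4 * t) * (\<Sum>i\<in>UNIV. \<Sum>j\<in>UNIV. OU_energy (partial j (partial i f)) t) \<le> \<psi> t"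
      by (simp only: sum_distrib_left)
    then have "exp (2 * t) * (exp (- 4 * t) * (\<Sum>i\<in>UNIV. \<Sum>j\<in>UNIV. OU_energy (partial j (partial i f)) t)) \<le> exp (2 * t) * \<psi> t"
      by (rule mult_left_mono) simp
    then show ?thesis by (simp add: mult.assoc[symmetric] exp_add[symmetric])
  qed
  \<comment> \<open>Half the excess of the gradient energy at time \<open>t\<close> over its limit
    \<open>M\<close>. For \<open>t \<ge> 0\<close>, the identity for the first partials equates it
    with the inner integral of the Hessian energies.\<close>
  define D where "D t = (\<Sum>i\<in>UNIV. ennreal ((OU_energy (partial i f) t - m i) / 2))" for t
  have Dm [measurable]: "D \<in> borel_measurable borel" unfolding D_def by measurable
  have D_le: "D t \<le> (\<integral>\<^sup>+ s. ennreal (exp (2 * s) * \<psi> s) \<partial>lebesgue_on {t..})" if t: "t \<ge> 0" for t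
  proof -
    have "D t = (\<Sum>i\<in>UNIV. \<integral>\<^sup>+ s. ennreal (exp (- 2 * s) * (\<Sum>j\<in>UNIV. OU_energy (partial j (partial i f)) s)) * indicator {t..} s \<partial>lborel)"
      unfolding D_def m_def using OU_energy_identity_half[OF C(2) L(2,3) t] by simp
    also have "\<dots> = (\<integral>\<^sup>+ s. (\<Sum>i\<in>UNIV. ennreal (exp (- 2 * s) * (\<Sum>j\<in>UNIV. OU_energy (partial j (partial i f)) s)) * indicator {t..} s) \<partial>lborel)"
      by (rule nn_integral_sum[symmetric]) measurable
    also have "\<dots> = (\<integral>\<^sup>+ s. ennreal (exp (- 2 * s) * (\<Sum>i\<in>UNIV. \<Sum>j\<in>UNIV. OU_energy (partial j (partial i f)) s)) * indicator {t..} s \<partial>lborel)"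
      by (intro nn_integral_cong)
         (simp add: sum_distrib_left sum_distrib_right[symmetric] sum_ennreal sum_nonneg OU_energy_nonneg)
    also have "\<dots> = (\<integral>\<^sup>+ s. ennreal (exp (- 2 * s) * (\<Sum>i\<in>UNIV. \<Sum>j\<in>UNIV. OU_energy (partial j (partial i f)) s)) \<partial>lebesgue_on {t..})"
      by (rule nn_integral_lebesgue_on[symmetric]) measurable
    \<comment> \<open>The comparison is made under \<open>lebesgue\<close> because \<psi> is assumed
      only Lebesgue measurable, not Borel.\<close>
    also have "\<dots> = (\<integral>\<^sup>+ s. ennreal (exp (- 2 * s) * (\<Sum>i\<in>UNIV. \<Sum>j\<in>UNIV. OU_energy (partial j (partial i f)) s)) * indicator {t..} s \<partial>lebesgue)"
      by (rule nn_integral_restrict_space) simp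
    also have "\<dots> \<le> (\<integral>\<^sup>+ s. ennreal (exp (2 * s) * \<psi> s) * indicator {t..} s \<partial>lebesgue)"
    proof (rule nn_integral_mono_AE)
      \<comment> \<open>The Hessian bound holds for positive times; the excluded point matters only
        when \<open>t = 0\<close>.\<close>
      have "AE s in lebesgue. s \<noteq> (0 :: real)"
        by (rule AE_completion) (rule AE_lborel_singleton)
      then show "AE s in lebesgue. ennreal (exp (- 2 * s) * (\<Sum>i\<in>UNIV. \<Sum>j\<in>UNIV. OU_energy (partial j (partial i f)) s)) * indicator {t..} s
          \<le> ennreal (exp (2 * s) * \<psi> s) * indicator {t..} s"
      proof eventually_elim
        case (elim s)
        show ?case
        proof (cases "s \<ge> t")
          case True
          with elim t have "s > 0" by simp
          then show ?thesis by (intro mult_right_mono ennreal_leI hess) auto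
        qed simp
      qed
    qed
    also have "\<dots> = (\<integral>\<^sup>+ s. ennreal (exp (2 * s) * \<psi> s) \<partial>lebesgue_on {t..})"
      by (rule nn_integral_restrict_space[symmetric]) simp
    finally show ?thesis .
  qed
  have "(\<integral>\<^sup>+ t. ennreal (exp (- 2 * t)) * D t * indicator {0..} t \<partial>lborel) = (\<integral>\<^sup>+ t. ennreal (exp (- 2 * t)) * D t \<partial>lebesgue_on {0..})"
    by (rule nn_integral_lebesgue_on[symmetric]) measurable
  also have "\<dots> \<le> psi_integral \<psi>"
    unfolding psi_integral_def by (intro nn_integral_mono mult_left_mono D_le) (auto simp: space_restrict_space)
  finally have psi: "(\<integral>\<^sup>+ t. ennreal (exp (- 2 * t)) * D t * indicator {0..} t \<partial>lborel) \<le> psi_integral \<psi>" .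
  have expM: "(\<integral>\<^sup>+ t. ennreal (M * exp (- 2 * t)) * indicator {0..} t \<partial>lborel) = ennreal (M / 2)"
  proof -
    have "(\<integral>\<^sup>+ t. ennreal (M * exp (- 2 * t)) * indicator {0..} t \<partial>lborel) = ennreal (0 - - (M / 2 * exp (- 2 * 0)))"
    proof (rule nn_integral_FTC_atLeast)
      show "((\<lambda>s. - (M / 2 * exp (- 2 * s))) has_real_derivative M * exp (- 2 * s)) (at s)" for s
        by (auto intro!: derivative_eq_intros)
      show "((\<lambda>s. - (M / 2 * exp (- 2 * s))) \<longlongrightarrow> 0) at_top"
        using tendsto_minus[OF tendsto_mult[OF tendsto_const[of "M / 2"] exp_neg_mult_at_top[of 2]]] by simp
    qed (use M(2) in auto)
    then show ?thesis by simp
  qed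
  have "ennreal (gauss_var f / 2) = (\<integral>\<^sup>+ t. ennreal (exp (- 2 * t) * (\<Sum>i\<in>UNIV. OU_energy (partial i f) t)) * indicator {0..} t \<partial>lborel)"
    using OU_energy_identity_half[OF C(1) L(1,2), of 0] by (simp add: gauss_var_def OU_energy_def)
  also have "\<dots> \<le> (\<integral>\<^sup>+ t. ennreal (M * exp (- 2 * t)) * indicator {0..} t
      + 2 * (ennreal (exp (- 2 * t)) * D t * indicator {0..} t) \<partial>lborel)"
  proof (intro nn_integral_mono)
    fix t :: real
    have "(\<Sum>i\<in>UNIV. OU_energy (partial i f) t) = (\<Sum>i\<in>UNIV. m i + 2 * ((OU_energy (partial i f) t - m i) / 2))"
      by (intro sum.cong refl) (simp add: field_simps)
    also have "\<dots> = M + 2 * (\<Sum>i\<in>UNIV. (OU_energy (partial i f) t - m i) / 2)"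
      by (simp only: M_def sum.distrib sum_distrib_left)
    \<comment> \<open>Positive parts reproduce the truncation that \<open>ennreal\<close> performs
      in \<open>D\<close>, for negative times as well; the indicator discards those times
      afterwards.\<close>
    also have "\<dots> \<le> M + 2 * (\<Sum>i\<in>UNIV. max 0 ((OU_energy (partial i f) t - m i) / 2))"
      by (intro add_left_mono mult_left_mono sum_mono) auto
    finally have "exp (- 2 * t) * (\<Sum>i\<in>UNIV. OU_energy (partial i f) t)
        \<le> exp (- 2 * t) * (M + 2 * (\<Sum>i\<in>UNIV. max 0 ((OU_energy (partial i f) t - m i) / 2)))"
      by (rule mult_left_mono) simp
    also have "\<dots> = M * exp (- 2 * t) + 2 * (exp (- 2 * t) * (\<Sum>i\<in>UNIV. max 0 ((OU_energy (partial i f) t - m i) / 2)))"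
      by (simp only: distrib_left mult.left_commute[of _ 2] mult.commute[of _ M])
    finally have "ennreal (exp (- 2 * t) * (\<Sum>i\<in>UNIV. OU_energy (partial i f) t))
        \<le> ennreal (M * exp (- 2 * t) + 2 * (exp (- 2 * t) * (\<Sum>i\<in>UNIV. max 0 ((OU_energy (partial i f) t - m i) / 2))))"
      by (rule ennreal_leI)
    also have "\<dots> = ennreal (M * exp (- 2 * t)) + 2 * (ennreal (exp (- 2 * t)) * ennreal (\<Sum>i\<in>UNIV. max 0 ((OU_energy (partial i f) t - m i) / 2)))"
      using M(2) sum_nonneg[of UNIV "\<lambda>i. max 0 ((OU_energy (partial i f) t - m i) / 2)"]
      by (simp add: ennreal_plus ennreal_mult)
    also have "ennreal (\<Sum>i\<in>UNIV. max 0 ((OU_energy (partial i f) t - m i) / 2)) = D t"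
    proof -
      have "D t = (\<Sum>i\<in>UNIV. ennreal (max 0 ((OU_energy (partial i f) t - m i) / 2)))"
        unfolding D_def by (intro sum.cong refl) (simp add: max_def ennreal_neg)
      then show ?thesis by (simp only: sum_ennreal max.cobounded1)
    qed
    finally show "ennreal (exp (- 2 * t) * (\<Sum>i\<in>UNIV. OU_energy (partial i f) t)) * indicator {0..} t
        \<le> ennreal (M * exp (- 2 * t)) * indicator {0..} t + 2 * (ennreal (exp (- 2 * t)) * D t * indicator {0..} t)"
      by (simp add: indicator_def)
  qed
  also have "\<dots> = ennreal (M / 2) + 2 * (\<integral>\<^sup>+ t. ennreal (exp (- 2 * t)) * D t * indicator {0..} t \<partial>lborel)"
    by (subst nn_integral_add, measurable, subst nn_integral_cmult, measurable, simp only: expM)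
  also have "\<dots> \<le> ennreal (M / 2) + 2 * psi_integral \<psi>"
    by (intro add_left_mono mult_left_mono psi) auto
  also have "psi_integral \<psi> = ennreal (enn2real (psi_integral \<psi>))"
    using assms(4) by simp
  also have "ennreal (M / 2) + 2 * ennreal (enn2real (psi_integral \<psi>)) = ennreal (M / 2 + 2 * enn2real (psi_integral \<psi>))"
    using M(2) by (simp add: ennreal_plus ennreal_mult)
  finally have "gauss_var f / 2 \<le> M / 2 + 2 * enn2real (psi_integral \<psi>)"
    using M(2) by (subst (asm) ennreal_le_iff) auto
  then show ?thesis unfolding M(1) by simp
qed

end
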